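(* Let $A=A(\mathcal{A}^{(4)},W)$, where $W$ is any cell system on $\mathcal{A}^{(4)}$. Let $S=A_0$ and let $X$ be a graded vector space with Hilbert series $H_X(t)=t^3$. Then the Hochschild and cyclic homology of $A$ are given, as graded vector spaces, by $HH_0(A) \cong S$, $HH_1(A)=0$, $HH_2(A) \cong X$, $HH_3(A) \cong X$, $HH_4(A)=HH_5(A)=HH_6(A)=HH_7(A)=0$, $HH_8(A) \cong X^{\ast}[12]$, $HH_9(A) \cong X^{\ast}[12]$, $HH_{10}(A)=HH_{11}(A)=HH_{12}(A)=0$, $HH_{12+i}(A) \cong HH_i(A)[12]$ for $i \geq 1$; and $HC_0(A) \cong S$, $HC_1(A)=0$, $HC_2(A) \cong X$, $HC_3(A)=HC_4(A)=HC_5(A)=HC_6(A)=HC_7(A)=0$, $HC_8(A) \cong X^{\ast}[12]$, $HC_9(A)=HC_{10}(A)=HC_{11}(A)=HC_{12}(A)=0$, $HC_{12+i}(A) \cong HC_i(A)[12]$ for $i \geq 1$.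
   Context: All vector spaces and algebras are over $\mathbb{C}$. For a finite directed graph $\mathcal{G}$ (loops and multiple edges allowed), $s(a)$, $r(a)$ denote the source and range of an edge $a$. The path algebra $\mathbb{C}\mathcal{G}$ has as basis all finite paths (vertices are the paths of length 0), with product $ab$ the concatenation (first $a$, then $b$) if $r(a)=s(b)$ and $0$ otherwise; it is graded by path length. The graph $\mathcal{A}^{(n)}$, $n\ge4$ (Coxeter number $h=n$), has vertices $(\lambda_1,\lambda_2)$ with $\lambda_1,\lambda_2\ge0$ integers and $\lambda_1+\lambda_2\le n-3$, and one edge from $(\lambda_1,\lambda_2)$ to each of $(\lambda_1+1,\lambda_2)$, $(\lambda_1-1,\lambda_2+1)$, $(\lambda_1,\lambda_2-1)$ that is a vertex. Here $n=4$. Cell systems. Let $h$ be the Coxeter number of $\mathcal{G}$, $q=e^{i\pi/h}$, $[m]_q=(q^m-q^{-m})/(q-q^{-1})$, and let $(\phi_v)_v$ be the Perron-Frobenius eigenvector of $\mathcal{G}$ (eigenvalue $[3]_q$). A cell system $W$ on $\mathcal{G}$ assigns to each closed path $abc$ of length 3 a complex number $W(abc)=W(bca)=W(cab)$ such that: (I) for all vertices $i,j$ and edges $a,a'$ from $i$ to $j$, $\sum W(ab_1b_2)\overline{W(a'b_1b_2)}=\delta_{a,a'}[2]_q\phi_i\phi_j$, summed over all paths $b_1b_2$ of length 2 from $j$ to $i$; (II) for all edges $a_1:i_4\to i_1$, $a_2:i_2\to i_1$, $a_3:i_2\to i_3$, $a_4:i_4\to i_3$, $\sum \phi_k^{-1}W(a_2b_1b_2)\overline{W(a_3b_3b_2)}W(a_4b_3b_4)\overline{W(a_1b_1b_4)}=\delta_{a_1,a_4}\delta_{a_2,a_3}\phi_{i_4}\phi_{i_1}\phi_{i_2}+\delta_{a_1,a_2}\delta_{a_3,a_4}\phi_{i_1}\phi_{i_2}\phi_{i_3}$,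 summed over all vertices $k$ and edges $b_1:i_1\to k$, $b_2:k\to i_2$, $b_3:i_3\to k$, $b_4:k\to i_4$. The almost Calabi-Yau algebra $A(\mathcal{G},W)$ is the quotient of $\mathbb{C}\mathcal{G}$ by the two-sided ideal generated by the elements $\sum_{b,b'}W(abb')\,bb'$, one for each edge $a$, the sum being over all paths $bb'$ of length 2 from $r(a)$ to $s(a)$. It is graded by path length; $S=A_0=(\mathbb{C}\mathcal{G})_0$. Graded conventions. Isomorphisms are of graded vector spaces, with grading induced by path length. $V[n]$ is $V$ with degrees raised by $n$ ($V[n]_j=V_{j-n}$); $V^\ast$ is the graded dual, $(V^\ast)_j=(V_{-j})^\ast$. The Hilbert series of $V$ is $H_V(t)=\sum_j\dim(V_j)t^j$. $HH_n(A)=\mathrm{Tor}_n^{A^e}(A,A)$, where $A^e=A^{\mathrm{op}}\otimes A$ is the enveloping algebra. Reduced Hochschild homology: $\overline{HH}_0(A)=HH_0(A)/S$, $\overline{HH}_n(A)=HH_n(A)$ for $n>0$. With $B:\overline{HH}_n(A)\to\overline{HH}_{n+1}(A)$ the (degree-preserving) Connes differential, the sequence $0\to\overline{HH}_0(A)\to\overline{HH}_1(A)\to\overline{HH}_2(A)\to\cdots$ is exact, and reduced cyclic homology is $\overline{HC}_n(A)=\ker(B:\overline{HH}_{n+1}(A)\to\overline{HH}_{n+2}(A))=\mathrm{Im}(B:\overline{HH}_n(A)\to\overline{HH}_{n+1}(A))$. The convention for cyclic homology used here is $\overline{HC}_0(A)=HC_0(A)/S$ and $HC_n(A)=\overline{HC}_n(A)$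 for $n>0$. *)

theory Defs
  imports
    "HOL-Algebra.QuotRing"
    "HOL-Algebra.Module"
    "HOL-Computational_Algebra.Formal_Laurent_Series"
    "HOL-Library.Poly_Mapping"
    "HOL-Analysis.Complex_Transcendental"
    "Graph_Theory.Graph_Theory"
begin

section \<open>Complex vector spaces\<close>

text \<open>Complex vector spaces are modules in the sense of HOL-Algebra over the following ring.
  The record type of modules also has fields for a multiplication and a unit; for a
  vector space that is not an algebra these two fields carry no information.\<close>

definition complex_field :: "complex ring" where
  "complex_field = \<lparr>carrier = UNIV, monoid.mult = (*), one = 1, zero = 0, add = (+)\<rparr>"

type_synonym 'a cvs = "(complex, 'a) module"

definition span_of :: "(complex, 'a, 'm) module_scheme \<Rightarrow> 'a set \<Rightarrow> 'a set" where
  "span_of M B = (\<lambda>H. submodule H complex_field M) hull B"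

text \<open>\<open>M / N\<close>, with the cosets of \<open>N\<close> as elements. The ring operations are those of \<open>M Quot N\<close>,
  so that this is a quotient algebra if \<open>M\<close> is an algebra and \<open>N\<close> is an ideal.\<close>

definition quotient :: "(complex, 'a, 'm) module_scheme \<Rightarrow> 'a set \<Rightarrow> 'a set cvs" where
  "quotient M N = ring.extend (M Quot N) (module.fields (\<lambda>c Y. \<Union>x\<in>Y. N +>\<^bsub>M\<^esub> (c \<odot>\<^bsub>M\<^esub> x)))"

text \<open>The map into \<open>M / N\<close> induced by \<open>f\<close>, on a coset \<open>Y\<close> in the domain of \<open>f\<close>.\<close>

definition induced_map ::
  "(complex, 'b, 'm) module_scheme \<Rightarrow> 'b set \<Rightarrow> ('a \<Rightarrow> 'b) \<Rightarrow> 'a set \<Rightarrow> 'b set" where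
  "induced_map M N f Y = (\<Union>x\<in>Y. N +>\<^bsub>M\<^esub> f x)"

definition linear_iso ::
  "(complex, 'a, 'm) module_scheme \<Rightarrow> (complex, 'b, 'n) module_scheme \<Rightarrow> bool" where
  "linear_iso M N \<longleftrightarrow> (\<exists>f. bij_betw f (carrier M) (carrier N)
     \<and> (\<forall>x\<in>carrier M. \<forall>y\<in>carrier M. f (x \<oplus>\<^bsub>M\<^esub> y) = f x \<oplus>\<^bsub>N\<^esub> f y)
     \<and> (\<forall>c. \<forall>x\<in>carrier M. f (c \<odot>\<^bsub>M\<^esub> x) = c \<odot>\<^bsub>N\<^esub> f x))"

definition is_basis :: "(complex, 'a, 'm) module_scheme \<Rightarrow> 'a set \<Rightarrow> bool" where
  "is_basis M B \<longleftrightarrow> finite B \<and> B \<subseteq> carrier M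
     \<and> (\<forall>x\<in>carrier M. \<exists>!c. c \<in> B \<rightarrow>\<^sub>E UNIV \<and> x = (\<Oplus>\<^bsub>M\<^esub>b\<in>B. c b \<odot>\<^bsub>M\<^esub> b))"

definition has_dim :: "(complex, 'a, 'm) module_scheme \<Rightarrow> nat \<Rightarrow> bool" where
  "has_dim M n \<longleftrightarrow> (\<exists>B. is_basis M B \<and> card B = n)"

definition dual_space :: "(complex, 'a, 'm) module_scheme \<Rightarrow> ('a \<Rightarrow> complex) cvs" where
  "dual_space M =
     \<lparr>carrier = {f \<in> extensional (carrier M).
        (\<forall>x\<in>carrier M. \<forall>y\<in>carrier M. f (x \<oplus>\<^bsub>M\<^esub> y) = f x + f y) \<and>
        (\<forall>c. \<forall>x\<in>carrier M. f (c \<odot>\<^bsub>M\<^esub> x) = c * f x)},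
      monoid.mult = undefined, one = undefined,
      zero = (\<lambda>x\<in>carrier M. 0),
      add = (\<lambda>f g. \<lambda>x\<in>carrier M. f x + g x),
      module.smult = (\<lambda>c f. \<lambda>x\<in>carrier M. c * f x)\<rparr>"


section \<open>Graded vector spaces\<close>

text \<open>A graded vector space is given by its homogeneous components.\<close>

type_synonym 'a graded = "int \<Rightarrow> 'a cvs"

definition graded_space :: "'a graded \<Rightarrow> bool" where
  "graded_space V \<longleftrightarrow> (\<forall>j. Module.module complex_field (V j))"

definition graded_iso :: "'a graded \<Rightarrow> 'b graded \<Rightarrow> bool" (infix \<open>\<cong>\<^sub>g\<close> 50) where
  "V \<cong>\<^sub>g W \<longleftrightarrow> (\<forall>j. linear_iso (V j) (W j))"

definition is_zero_space :: "'a graded \<Rightarrow> bool" where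
  "is_zero_space V \<longleftrightarrow> (\<forall>j. carrier (V j) = {\<zero>\<^bsub>V j\<^esub>})"

definition degree_shift :: "'a graded \<Rightarrow> int \<Rightarrow> 'a graded" (\<open>_\<lbrakk>_\<rbrakk>\<close> [1000, 0] 1000) where
  "V\<lbrakk>n\<rbrakk> = (\<lambda>j. V (j - n))"

definition graded_dual :: "'a graded \<Rightarrow> ('a \<Rightarrow> complex) graded" where
  "graded_dual V = (\<lambda>j. dual_space (V (- j)))"

definition has_hilbert_series :: "'a graded \<Rightarrow> int fls \<Rightarrow> bool" where
  "has_hilbert_series V H \<longleftrightarrow> (\<forall>j. \<exists>n. has_dim (V j) n \<and> fls_nth H j = int n)"


section \<open>Free vector spaces\<close>

definition scale :: "complex \<Rightarrow> ('k \<Rightarrow>\<^sub>0 complex) \<Rightarrow> ('k \<Rightarrow>\<^sub>0 complex)" where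
  "scale c x = Poly_Mapping.map ((*) c) x"

definition free_space :: "'k set \<Rightarrow> ('k \<Rightarrow>\<^sub>0 complex) cvs" where
  "free_space K =
     \<lparr>carrier = {x. Poly_Mapping.keys x \<subseteq> K}, monoid.mult = undefined, one = undefined,
      zero = 0, add = (+), module.smult = scale\<rparr>"

definition lin_ext :: "('k \<Rightarrow> ('l \<Rightarrow>\<^sub>0 complex)) \<Rightarrow> ('k \<Rightarrow>\<^sub>0 complex) \<Rightarrow> ('l \<Rightarrow>\<^sub>0 complex)" where
  "lin_ext f x = (\<Sum>k\<in>Poly_Mapping.keys x. scale (Poly_Mapping.lookup x k) (f k))"

abbreviation gen :: "'k \<Rightarrow> ('k \<Rightarrow>\<^sub>0 complex)" where
  "gen k \<equiv> Poly_Mapping.single k 1"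


section \<open>Graded algebras and path algebras\<close>

record 'a galgebra = "(complex, 'a) module" +
  homog :: "int \<Rightarrow> 'a set"

text \<open>The quotient by an ideal, with the image grading.\<close>

definition quotient_algebra :: "'a galgebra \<Rightarrow> 'a set \<Rightarrow> 'a set galgebra" where
  "quotient_algebra R I =
     module.extend (quotient R I) (galgebra.fields (\<lambda>d. (\<lambda>x. I +>\<^bsub>R\<^esub> x) ` homog R d))"

text \<open>A path is a triple consisting of its source, its list of edges and its range.\<close>

type_synonym ('v, 'e) path = "'v \<times> 'e list \<times> 'v"

definition paths :: "('v, 'e) pre_digraph \<Rightarrow> ('v, 'e) path set" where
  "paths G = {(u, p, v). pre_digraph.awalk G u p v}"

fun path_mult :: "('v, 'e) path \<Rightarrow> ('v, 'e) path \<Rightarrow> (('v, 'e) path \<Rightarrow>\<^sub>0 complex)" where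
  "path_mult (u, p, v) (v', q, w) = (if v = v' then gen (u, p @ q, w) else 0)"

definition path_algebra :: "('v, 'e) pre_digraph \<Rightarrow> (('v, 'e) path \<Rightarrow>\<^sub>0 complex) galgebra" where
  "path_algebra G =
     \<lparr>carrier = {x. Poly_Mapping.keys x \<subseteq> paths G},
      monoid.mult = (\<lambda>x y. lin_ext (\<lambda>p. lin_ext (\<lambda>q. path_mult p q) y) x),
      one = (\<Sum>v\<in>verts G. gen (v, [], v)),
      zero = 0, add = (+), module.smult = scale,
      homog = (\<lambda>d. {x. Poly_Mapping.keys x \<subseteq> {(u, p, v) \<in> paths G. int (length p) = d}})\<rparr>"


section \<open>The graphs, cell systems and almost Calabi-Yau algebras\<close>

definition A_graph :: "nat \<Rightarrow> (int \<times> int, (int \<times> int) \<times> (int \<times> int)) pre_digraph" where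
  "A_graph n = (let V = {(k, l). 0 \<le> k \<and> 0 \<le> l \<and> k + l \<le> int n - 3} in
     \<lparr>verts = V,
      arcs = {((k, l), v) | k l v. (k, l) \<in> V \<and> v \<in> V \<and>
                v \<in> {(k + 1, l), (k - 1, l + 1), (k, l - 1)}},
      tail = fst, head = snd\<rparr>)"

definition quantum_int :: "nat \<Rightarrow> nat \<Rightarrow> complex" where
  "quantum_int h m = (let q = exp (\<i> * of_real pi / of_nat h)
     in (q ^ m - inverse q ^ m) / (q - inverse q))"

text \<open>The Perron-Frobenius eigenvector is only determined up to a positive scalar; no
  normalisation is imposed.\<close>

definition perron_frobenius :: "('v, 'e) pre_digraph \<Rightarrow> nat \<Rightarrow> ('v \<Rightarrow> real) \<Rightarrow> bool" where
  "perron_frobenius G h \<phi> \<longleftrightarrow> (\<forall>v\<in>verts G. \<phi> v > 0 \<and>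
     (\<Sum>e\<in>out_arcs G v. complex_of_real (\<phi> (head G e))) = quantum_int h 3 * \<phi> v)"

definition paths2 :: "('v, 'e) pre_digraph \<Rightarrow> 'v \<Rightarrow> 'v \<Rightarrow> ('e \<times> 'e) set" where
  "paths2 G u v = {(b, b'). pre_digraph.awalk G u [b, b'] v}"

text \<open>The value \<open>W a b c\<close> is only relevant if \<open>abc\<close> is a closed path.\<close>

definition cell_system ::
  "('v, 'e) pre_digraph \<Rightarrow> nat \<Rightarrow> ('v \<Rightarrow> real) \<Rightarrow> ('e \<Rightarrow> 'e \<Rightarrow> 'e \<Rightarrow> complex) \<Rightarrow> bool" where
  "cell_system G h \<phi> W \<longleftrightarrow>
    (\<forall>v a b c. pre_digraph.awalk G v [a, b, c] v \<longrightarrow> W a b c = W b c a \<and> W b c a = W c a b) \<and>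
    (\<forall>i j a a'. pre_digraph.awalk G i [a] j \<and> pre_digraph.awalk G i [a'] j \<longrightarrow>
       (\<Sum>(b1, b2)\<in>paths2 G j i. W a b1 b2 * cnj (W a' b1 b2)) =
         (if a = a' then quantum_int h 2 * \<phi> i * \<phi> j else 0)) \<and>
    (\<forall>i1 i2 i3 i4 a1 a2 a3 a4.
       pre_digraph.awalk G i4 [a1] i1 \<and> pre_digraph.awalk G i2 [a2] i1 \<and>
       pre_digraph.awalk G i2 [a3] i3 \<and> pre_digraph.awalk G i4 [a4] i3 \<longrightarrow>
       (\<Sum>(k, b1, b2, b3, b4) \<in> {(k, b1, b2, b3, b4).
            pre_digraph.awalk G i1 [b1] k \<and> pre_digraph.awalk G k [b2] i2 \<and>
            pre_digraph.awalk G i3 [b3] k \<and> pre_digraph.awalk G k [b4] i4}.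
          inverse (of_real (\<phi> k)) * W a2 b1 b2 * cnj (W a3 b3 b2) * W a4 b3 b4 * cnj (W a1 b1 b4)) =
       (if a1 = a4 \<and> a2 = a3 then of_real (\<phi> i4 * \<phi> i1 * \<phi> i2) else 0) +
       (if a1 = a2 \<and> a3 = a4 then of_real (\<phi> i1 * \<phi> i2 * \<phi> i3) else 0))"

definition acy_relation ::
  "('v, 'e) pre_digraph \<Rightarrow> ('e \<Rightarrow> 'e \<Rightarrow> 'e \<Rightarrow> complex) \<Rightarrow> 'e \<Rightarrow> (('v, 'e) path \<Rightarrow>\<^sub>0 complex)" where
  "acy_relation G W a = (\<Sum>(b, b')\<in>paths2 G (head G a) (tail G a).
     scale (W a b b') (gen (head G a, [b, b'], tail G a)))"

definition acy_algebra ::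
  "('v, 'e) pre_digraph \<Rightarrow> ('e \<Rightarrow> 'e \<Rightarrow> 'e \<Rightarrow> complex) \<Rightarrow> (('v, 'e) path \<Rightarrow>\<^sub>0 complex) set galgebra" where
  "acy_algebra G W =
     quotient_algebra (path_algebra G) (Idl\<^bsub>path_algebra G\<^esub> (acy_relation G W ` arcs G))"

text \<open>\<open>A\<^sub>0\<close> as a graded vector space concentrated in degree 0.\<close>

definition degree_zero_part :: "'a galgebra \<Rightarrow> 'a graded" where
  "degree_zero_part A =
     (\<lambda>d. (module.truncate A)\<lparr>carrier := if d = 0 then homog A 0 else {\<zero>\<^bsub>A\<^esub>}\<rparr>)"


section \<open>Hochschild homology\<close>

text \<open>\<open>Tor\<^sup>A\<^sup>e(A, A)\<close> is the homology of \<open>A \<otimes>\<^bsub>A\<^sup>e\<^esub> P\<close>, where \<open>P\<close> is a resolution of \<open>A\<close> by projective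
  left \<open>A\<^sup>e\<close>-modules. As \<open>P\<close> we take the bar resolution \<open>P\<^sub>n = A\<^bsup>\<otimes>(n + 2)\<^esup>\<close> (tensor products over the
  complex numbers), with
  \<open>\<partial>(x\<^sub>0, ..., x\<^bsub>n+1\<^esub>) = (\<Sum>i\<le>n. (-1)\<^sup>i (x\<^sub>0, ..., x\<^sub>i x\<^bsub>i+1\<^esub>, ..., x\<^bsub>n+1\<^esub>))\<close>.
  The algebra \<open>A\<^sup>e = A\<^sup>o\<^sup>p \<otimes> A\<close> acts on \<open>P\<^sub>n\<close> from the left by
  \<open>(x \<otimes> y) (x\<^sub>0, ..., x\<^bsub>n+1\<^esub>) = (y x\<^sub>0, ..., x\<^bsub>n+1\<^esub> x)\<close> and on \<open>A\<close> from the right by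
  \<open>m (x \<otimes> y) = x m y\<close>.

  The space \<open>A \<otimes>\<^bsub>A\<^sup>e\<^esub> P\<^sub>n\<close> is the free vector space on the lists \<open>[m, x\<^sub>0, ..., x\<^bsub>n+1\<^esub>]\<close> of elements
  of \<open>A\<close> modulo multilinearity and \<open>A\<^sup>e\<close>-balancedness.\<close>

definition bar_free :: "'a galgebra \<Rightarrow> nat \<Rightarrow> ('a list \<Rightarrow>\<^sub>0 complex) cvs" where
  "bar_free A n = free_space {xs. length xs = n + 3 \<and> set xs \<subseteq> carrier A}"

definition multilinear_rels :: "'a galgebra \<Rightarrow> ('a list \<Rightarrow>\<^sub>0 complex) set" where
  "multilinear_rels A =
     {gen (us @ (x \<oplus>\<^bsub>A\<^esub> y) # vs) - gen (us @ x # vs) - gen (us @ y # vs) | us x y vs.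
        set us \<union> {x, y} \<union> set vs \<subseteq> carrier A} \<union>
     {gen (us @ (c \<odot>\<^bsub>A\<^esub> x) # vs) - scale c (gen (us @ x # vs)) | us c x vs.
        set us \<union> {x} \<union> set vs \<subseteq> carrier A}"

definition balanced_rels :: "'a galgebra \<Rightarrow> ('a list \<Rightarrow>\<^sub>0 complex) set" where
  "balanced_rels A =
     {gen ((x \<otimes>\<^bsub>A\<^esub> m \<otimes>\<^bsub>A\<^esub> y) # u # us @ [v]) - gen (m # (y \<otimes>\<^bsub>A\<^esub> u) # us @ [v \<otimes>\<^bsub>A\<^esub> x]) | x y m u us v.
        {x, y, m, u, v} \<union> set us \<subseteq> carrier A}"

definition bar_rels :: "'a galgebra \<Rightarrow> nat \<Rightarrow> ('a list \<Rightarrow>\<^sub>0 complex) set" where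
  "bar_rels A n =
     span_of (bar_free A n) (carrier (bar_free A n) \<inter> (multilinear_rels A \<union> balanced_rels A))"

definition bar_space :: "'a galgebra \<Rightarrow> nat \<Rightarrow> ('a list \<Rightarrow>\<^sub>0 complex) set cvs" where
  "bar_space A n = quotient (bar_free A n) (bar_rels A n)"

text \<open>Degree \<open>d\<close> is spanned by the tensors of homogeneous elements whose degrees add up to \<open>d\<close>.\<close>

definition bar_chains :: "'a galgebra \<Rightarrow> nat \<Rightarrow> ('a list \<Rightarrow>\<^sub>0 complex) set graded" where
  "bar_chains A n = (\<lambda>d. (bar_space A n)\<lparr>carrier :=
     span_of (bar_space A n)
       {bar_rels A n +>\<^bsub>bar_free A n\<^esub> gen xs | xs ds. length xs = n + 3 \<and>
          list_all2 (\<lambda>x j. x \<in> homog A j) xs ds \<and> sum_list ds = d}\<rparr>)"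

definition merge_at :: "'a galgebra \<Rightarrow> nat \<Rightarrow> 'a list \<Rightarrow> 'a list" where
  "merge_at A i xs = take i xs @ (xs ! i \<otimes>\<^bsub>A\<^esub> xs ! Suc i) # drop (i + 2) xs"

text \<open>The differential \<open>id \<otimes> \<partial>\<close> on lists \<open>[m, x\<^sub>0, ..., x\<^bsub>n+1\<^esub>]\<close>; the entry \<open>x\<^sub>i\<close> is at position
  \<open>i + 1\<close>.\<close>

definition bar_diff_list :: "'a galgebra \<Rightarrow> 'a list \<Rightarrow> ('a list \<Rightarrow>\<^sub>0 complex)" where
  "bar_diff_list A xs = (\<Sum>i<length xs - 2. scale ((-1) ^ i) (gen (merge_at A (i + 1) xs)))"

text \<open>The differential from homological degree \<open>n + 1\<close> to \<open>n\<close>.\<close>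

definition bar_diff ::
  "'a galgebra \<Rightarrow> nat \<Rightarrow> ('a list \<Rightarrow>\<^sub>0 complex) set \<Rightarrow> ('a list \<Rightarrow>\<^sub>0 complex) set" where
  "bar_diff A n = induced_map (bar_free A n) (bar_rels A n) (lin_ext (bar_diff_list A))"

definition cycles :: "'a galgebra \<Rightarrow> nat \<Rightarrow> int \<Rightarrow> ('a list \<Rightarrow>\<^sub>0 complex) set set" where
  "cycles A n d = {z \<in> carrier (bar_chains A n d).
     case n of 0 \<Rightarrow> True | Suc m \<Rightarrow> bar_diff A m z = \<zero>\<^bsub>bar_space A m\<^esub>}"

definition boundaries :: "'a galgebra \<Rightarrow> nat \<Rightarrow> int \<Rightarrow> ('a list \<Rightarrow>\<^sub>0 complex) set set" where
  "boundaries A n d = bar_diff A n ` carrier (bar_chains A (Suc n) d)"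

definition HH :: "'a galgebra \<Rightarrow> nat \<Rightarrow> ('a list \<Rightarrow>\<^sub>0 complex) set set graded" where
  "HH A n = (\<lambda>d. quotient ((bar_space A n)\<lparr>carrier := cycles A n d\<rparr>) (boundaries A n d))"


section \<open>The Connes differential and cyclic homology\<close>

text \<open>The identification of \<open>A \<otimes>\<^bsub>A\<^sup>e\<^esub> P\<^sub>n\<close> with \<open>A\<^bsup>\<otimes>(n + 1)\<^esup>\<close>, the usual Hochschild chains: the tensor
  \<open>[m, x\<^sub>0, ..., x\<^bsub>n+1\<^esub>]\<close> corresponds to \<open>[x\<^bsub>n+1\<^esub> m x\<^sub>0, x\<^sub>1, ..., x\<^sub>n]\<close>, and conversely
  \<open>[a\<^sub>0, ..., a\<^sub>n]\<close> corresponds to \<open>[a\<^sub>0, 1, a\<^sub>1, ..., a\<^sub>n, 1]\<close>.\<close>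

definition to_hochschild :: "'a galgebra \<Rightarrow> 'a list \<Rightarrow> 'a list" where
  "to_hochschild A xs = (last xs \<otimes>\<^bsub>A\<^esub> hd xs \<otimes>\<^bsub>A\<^esub> xs ! 1) # butlast (drop 2 xs)"

definition from_hochschild :: "'a galgebra \<Rightarrow> 'a list \<Rightarrow> 'a list" where
  "from_hochschild A as = hd as # \<one>\<^bsub>A\<^esub> # tl as @ [\<one>\<^bsub>A\<^esub>]"

text \<open>On Hochschild chains, \<open>B = (1 - t) s N\<close> with \<open>t(a\<^sub>0, ..., a\<^sub>n) = (-1)\<^sup>n (a\<^sub>n, a\<^sub>0, ..., a\<^bsub>n-1\<^esub>)\<close>,
  \<open>s(a\<^sub>0, ..., a\<^sub>n) = (1, a\<^sub>0, ..., a\<^sub>n)\<close> and \<open>N = 1 + t + ... + t\<^sup>n\<close>. That is,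
  \<open>B(a\<^sub>0, ..., a\<^sub>n) = (\<Sum>i\<le>n. (-1)\<^bsup>n i\<^esup> ((1, a\<^sub>i, ..., a\<^sub>n, a\<^sub>0, ..., a\<^bsub>i-1\<^esub>)
     + (-1)\<^sup>n (a\<^bsub>i-1\<^esub>, 1, a\<^sub>i, ..., a\<^sub>n, a\<^sub>0, ..., a\<^bsub>i-2\<^esub>)))\<close>, with indices of \<open>a\<close> modulo \<open>n + 1\<close>. The second
  summand vanishes on normalised chains.\<close>

definition connes_list :: "'a galgebra \<Rightarrow> 'a list \<Rightarrow> ('a list \<Rightarrow>\<^sub>0 complex)" where
  "connes_list A xs = (let as = to_hochschild A xs; n = length as - 1 in
     \<Sum>i\<le>n. let bs = rotate i as in
       scale ((-1) ^ (n * i))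
         (gen (from_hochschild A (\<one>\<^bsub>A\<^esub> # bs)) +
          scale ((-1) ^ n) (gen (from_hochschild A (last bs # \<one>\<^bsub>A\<^esub> # butlast bs)))))"

definition connes_chain ::
  "'a galgebra \<Rightarrow> nat \<Rightarrow> ('a list \<Rightarrow>\<^sub>0 complex) set \<Rightarrow> ('a list \<Rightarrow>\<^sub>0 complex) set" where
  "connes_chain A n =
     induced_map (bar_free A (Suc n)) (bar_rels A (Suc n)) (lin_ext (connes_list A))"

text \<open>The map from \<open>HH\<^sub>n(A)\<close> to \<open>HH\<^bsub>n+1\<^esub>(A)\<close> in degree \<open>d\<close>.\<close>

definition connes_B ::
  "'a galgebra \<Rightarrow> nat \<Rightarrow> int \<Rightarrow> ('a list \<Rightarrow>\<^sub>0 complex) set set \<Rightarrow> ('a list \<Rightarrow>\<^sub>0 complex) set set" where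
  "connes_B A n d = induced_map (bar_space A (Suc n)) (boundaries A (Suc n) d) (connes_chain A n)"

text \<open>Reduced cyclic homology in homological degree \<open>n\<close> is the kernel of \<open>B\<close> on reduced Hochschild
  homology in degree \<open>n + 1\<close>. Reduced and unreduced Hochschild homology agree in the positive
  degrees \<open>n + 1\<close> and \<open>n + 2\<close>.\<close>

definition reduced_HC :: "'a galgebra \<Rightarrow> nat \<Rightarrow> ('a list \<Rightarrow>\<^sub>0 complex) set set graded" where
  "reduced_HC A n = (\<lambda>d. (HH A (n + 1) d)\<lparr>carrier :=
     {z \<in> carrier (HH A (n + 1) d). connes_B A (n + 1) d z = \<zero>\<^bsub>HH A (n + 2) d\<^esub>}\<rparr>)"

text \<open>\<open>HC\<^sub>0(A) = A / [A, A] = HH\<^sub>0(A)\<close>, whose quotient by \<open>A\<^sub>0\<close> is isomorphic to reduced cyclic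
  homology in degree 0 by exactness of the Connes sequence; in positive degrees cyclic homology is
  the reduced one by convention.\<close>

definition HC :: "'a galgebra \<Rightarrow> nat \<Rightarrow> ('a list \<Rightarrow>\<^sub>0 complex) set set graded" where
  "HC A n = (if n = 0 then HH A 0 else reduced_HC A n)"

end

theory Submission
  imports Defs "HOL-Library.Numeral_Type"
begin

text \<open>All weights of a cell system on the 3-cycle are nonzero by axiom (I), so every path of length two is a
  relation and the algebra has radical square zero. Its bar resolution retracts onto the composable words all of
  whose inner letters are arrows; the retraction is the projection \<open>\<phi>\<close> onto these words, it commutes with the
  differential and with the bimodule structure, and \<open>1 - \<phi>\<close> is null homotopic. In degree \<open>m > 0\<close> the Hochschild
  complex thereby becomes \<open>1 + (-1)\<^sup>m r\<close>, where \<open>r\<close> rotates the closed paths of length \<open>m\<close>. There are three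
  of these if \<open>m\<close> is divisible by 3 and none otherwise. For \<open>m\<close> divisible by 6 the map is invertible, for odd
  multiples of 3 its kernel and cokernel are the lines \<open>HH\<^sub>m\<close> and \<open>HH\<^bsub>m-1\<^esub>\<close>, and the Connes differential maps
  the second isomorphically onto the first.\<close>

text \<open>The homology is defined on cosets of formal combinations of lists whose entries are
  themselves cosets of combinations of paths. No two such quotients are compared directly: each
  space receives coordinates, a linear bijection onto a set of finitely supported functions, and two
  spaces with the same coordinate set are isomorphic. In the basis of three idempotents and three
  arrows, tensors over the complex numbers become words in six letters, composable or not. The
  projection commutes with the differential because an idempotent inside a composable word is merged
  to the left and to the right with the same result and opposite signs. As it is a bimodule map
  inducing the identity on the augmentation, the comparison theorem gives the homotopy, which is
  built as a bimodule map so that it passes to Hochschild chains. On what is left products of two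
  arrows vanish, and only the two faces touching the marked first letter survive: a path and its
  rotation. Since \<open>r^3 = 1\<close>, the number -1 is no eigenvalue of \<open>r\<close> and 1
  is a simple one, which separates the two cases for \<open>m\<close>.\<close>

subsection \<open>Formal linear combinations\<close>

abbreviation supp :: "('k \<Rightarrow>\<^sub>0 complex) \<Rightarrow> 'k set" where "supp \<equiv> Poly_Mapping.keys"
abbreviation coef :: "('k \<Rightarrow>\<^sub>0 complex) \<Rightarrow> 'k \<Rightarrow> complex" where "coef \<equiv> Poly_Mapping.lookup"

lemma lookup_scale [simp]: "coef (scale c x) k = c * coef x k"
  unfolding scale_def by (cases "coef x k = 0") (auto simp: Poly_Mapping.map.rep_eq)

lemma scale_zero [simp]: "scale c 0 = 0" "scale 0 x = 0"
  by (rule poly_mapping_eqI, simp)+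

lemma scale_one [simp]: "scale 1 x = x"
  by (rule poly_mapping_eqI) simp

lemma scale_scale [simp]: "scale a (scale b x) = scale (a * b) x"
  by (rule poly_mapping_eqI) simp

lemma scale_add: "scale c (x + y) = scale c x + scale c y"
  by (rule poly_mapping_eqI) (simp add: lookup_add distrib_left)

lemma scale_diff: "scale c (x - y) = scale c x - scale c y"
  by (rule poly_mapping_eqI) (simp add: lookup_minus right_diff_distrib)

lemma scale_minus [simp]: "scale c (- x) = - scale c x"
  by (rule poly_mapping_eqI) simp

lemma scale_uminus_left: "scale (- c) x = - scale c x"
  by (rule poly_mapping_eqI) simp

lemma scale_add_left: "scale (a + b) x = scale a x + scale b x"
  by (rule poly_mapping_eqI) (simp add: lookup_add distrib_right)

lemma scale_sum: "scale c (sum f A) = (\<Sum>a\<in>A. scale c (f a))"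
  by (rule poly_mapping_eqI) (simp add: lookup_sum sum_distrib_left)

lemma scale_sum_left: "scale (sum f A) x = (\<Sum>a\<in>A. scale (f a) x)"
  by (rule poly_mapping_eqI) (simp add: lookup_sum sum_distrib_right)

lemma keys_scale: "supp (scale c x) \<subseteq> supp x"
  by (auto simp: in_keys_iff)

lemma gen_expansion: "x = (\<Sum>k\<in>supp x. scale (coef x k) (gen k))"
proof (rule poly_mapping_eqI)
  fix l
  have "(\<Sum>k\<in>supp x. coef x k * coef (gen k) l)
      = (\<Sum>k\<in>supp x. if k = l then coef x k else 0)"
    by (rule sum.cong) (auto simp: lookup_single when_def)
  then show "coef x l =
      coef (\<Sum>k\<in>supp x. scale (coef x k) (gen k)) l"
    by (simp add: lookup_sum in_keys_iff)
qed

definition linear_op :: "(('k \<Rightarrow>\<^sub>0 complex) \<Rightarrow> ('l \<Rightarrow>\<^sub>0 complex)) \<Rightarrow> bool" where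
  "linear_op T \<longleftrightarrow> (\<forall>x y. T (x + y) = T x + T y) \<and> (\<forall>c x. T (scale c x) = scale c (T x))"

lemma linear_opD:
  assumes "linear_op T"
  shows linear_op_add: "T (x + y) = T x + T y"
    and linear_op_scale: "T (scale c x) = scale c (T x)"
    and linear_op_zero: "T 0 = 0"
    and linear_op_minus: "T (- x) = - T x"
    and linear_op_diff: "T (x - y) = T x - T y"
proof -
  show add: "\<And>x y. T (x + y) = T x + T y" and sc: "\<And>c x. T (scale c x) = scale c (T x)"
    using assms by (auto simp: linear_op_def)
  show "T 0 = 0" using sc[of 0 0] by simp
  have m: "T (- x) = - T x" for x
    using sc[of "-1" x] by (simp add: scale_uminus_left)
  show "T (- x) = - T x" by (rule m)
  show "T (x - y) = T x - T y" using add[of x "- y"] m[of y] by simp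
qed

lemma linear_op_sum:
  assumes "linear_op T" shows "T (sum f A) = (\<Sum>a\<in>A. T (f a))"
  by (induction A rule: infinite_finite_induct)
     (auto simp: linear_op_add[OF assms] linear_op_zero[OF assms])

lemma lin_ext_superset:
  assumes "finite K" "supp x \<subseteq> K"
  shows "lin_ext f x = (\<Sum>k\<in>K. scale (coef x k) (f k))"
  unfolding lin_ext_def by (rule sum.mono_neutral_left) (use assms in \<open>auto simp: in_keys_iff\<close>)

lemma linear_op_lin_ext [intro, simp]: "linear_op (lin_ext f)"
  unfolding linear_op_def
proof (intro conjI allI)
  fix x y :: "'a \<Rightarrow>\<^sub>0 complex" and c
  let ?K = "supp x \<union> supp y"
  have "lin_ext f z = (\<Sum>k\<in>?K. scale (coef z k) (f k))"
    if "z \<in> {x, y, x + y}" for z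
    by (rule lin_ext_superset) (use that keys_add[of x y] in auto)
  then show "lin_ext f (x + y) = lin_ext f x + lin_ext f y"
    by (simp add: lookup_add scale_add_left sum.distrib)
  have "lin_ext f (scale c x)
      = (\<Sum>k\<in>supp x. scale (coef (scale c x) k) (f k))"
    by (rule lin_ext_superset) (auto simp: keys_scale)
  then show "lin_ext f (scale c x) = scale c (lin_ext f x)"
    by (simp add: lin_ext_def scale_sum)
qed

lemmas lin_ext_add [simp] = linear_op_add[OF linear_op_lin_ext]
  and lin_ext_scale [simp] = linear_op_scale[OF linear_op_lin_ext]
  and lin_ext_zero [simp] = linear_op_zero[OF linear_op_lin_ext]
  and lin_ext_minus [simp] = linear_op_minus[OF linear_op_lin_ext]
  and lin_ext_diff [simp] = linear_op_diff[OF linear_op_lin_ext]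
  and lin_ext_sum = linear_op_sum[OF linear_op_lin_ext]

lemma lin_ext_gen [simp]: "lin_ext f (gen k) = f k"
  by (simp add: lin_ext_def)

named_theorems lin_intros

lemma linear_op_ident [intro, simp, lin_intros]: "linear_op (\<lambda>x. x)"
  by (simp add: linear_op_def)

lemma linear_op_const_zero [intro, simp, lin_intros]: "linear_op (\<lambda>x. 0)"
  by (simp add: linear_op_def)

lemma linear_op_compose: "linear_op S \<Longrightarrow> linear_op T \<Longrightarrow> linear_op (\<lambda>x. S (T x))"
  by (simp add: linear_op_def)

lemmas lin_ext_linear [lin_intros] = linear_op_compose[OF linear_op_lin_ext]

lemma linear_op_plus [lin_intros]: "linear_op S \<Longrightarrow> linear_op T \<Longrightarrow> linear_op (\<lambda>x. S x + T x)"
  by (simp add: linear_op_def scale_add algebra_simps)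

lemma linear_op_scale_comp [lin_intros]: "linear_op S \<Longrightarrow> linear_op (\<lambda>x. scale c (S x))"
  by (simp add: linear_op_def scale_add algebra_simps)

lemma linear_op_subtract [lin_intros]: "linear_op S \<Longrightarrow> linear_op T \<Longrightarrow> linear_op (\<lambda>x. S x - T x)"
  by (simp add: linear_op_def scale_diff algebra_simps)

lemma linear_op_sums [lin_intros]: "(\<And>a. a \<in> A \<Longrightarrow> linear_op (S a)) \<Longrightarrow> linear_op (\<lambda>x. \<Sum>a\<in>A. S a x)"
  by (induction A rule: infinite_finite_induct) (auto intro!: lin_intros)

lemma linear_op_funpow [lin_intros]: "linear_op T \<Longrightarrow> linear_op (T ^^ n)"
  for T :: "('k \<Rightarrow>\<^sub>0 complex) \<Rightarrow> ('k \<Rightarrow>\<^sub>0 complex)"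
  by (induction n) (simp_all add: linear_op_def)

lemma linear_op_expand:
  assumes "linear_op T"
  shows "T x = (\<Sum>k\<in>supp x. scale (coef x k) (T (gen k)))"
proof -
  have "T x = T (\<Sum>k\<in>supp x. scale (coef x k) (gen k))"
    by (rule arg_cong[OF gen_expansion])
  then show ?thesis by (simp add: linear_op_sum[OF assms] linear_op_scale[OF assms])
qed

text \<open>Most operator identities below are reduced by this rule to a single word. Since only
  words of the support have to be checked, assumptions on the length or nonemptiness of the words of
  a chain pass to the word.\<close>

lemma linear_op_eqI:
  assumes "linear_op S" "linear_op T"
    and "\<And>k. k \<in> supp x \<Longrightarrow> S (gen k) = T (gen k)"
  shows "S x = T x"
  unfolding linear_op_expand[OF assms(1), of x] linear_op_expand[OF assms(2), of x]
  by (rule sum.cong) (use assms(3) in auto)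

lemma keys_linear_op:
  assumes "linear_op T"
    and "\<And>k. k \<in> supp x \<Longrightarrow> supp (T (gen k)) \<subseteq> K"
  shows "supp (T x) \<subseteq> K"
proof -
  have "supp (T x)
      \<subseteq> (\<Union>k\<in>supp x. supp (scale (coef x k) (T (gen k))))"
    by (subst linear_op_expand[OF assms(1)]) (rule keys_sum)
  also have "\<dots> \<subseteq> K" using assms(2) keys_scale by fast
  finally show ?thesis .
qed

lemma keys_lin_ext:
  assumes "\<And>k. k \<in> supp x \<Longrightarrow> supp (f k) \<subseteq> K"
  shows "supp (lin_ext f x) \<subseteq> K"
  by (rule keys_linear_op) (use assms in auto)

lemma keys_diff_subset:
  "supp x \<subseteq> K \<Longrightarrow> supp y \<subseteq> K \<Longrightarrow> supp (x - y) \<subseteq> K"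
  for x y :: "'k \<Rightarrow>\<^sub>0 complex"
  by (metis keys_diff le_sup_iff subset_trans)

lemma keys_add_subset:
  "supp x \<subseteq> K \<Longrightarrow> supp y \<subseteq> K \<Longrightarrow> supp (x + y) \<subseteq> K"
  for x y :: "'k \<Rightarrow>\<^sub>0 complex"
  by (metis keys_add le_sup_iff subset_trans)

lemma keys_sum_subset:
  "(\<And>a. a \<in> A \<Longrightarrow> supp (f a) \<subseteq> K) \<Longrightarrow> supp (\<Sum>a\<in>A. f a) \<subseteq> K"
  for f :: "'a \<Rightarrow> 'k \<Rightarrow>\<^sub>0 complex"
  using keys_sum[of f A] by fast

lemma keys_scale_subset: "supp x \<subseteq> K \<Longrightarrow> supp (scale c x) \<subseteq> K"
  using keys_scale by fast

text \<open>The letter \<open>(i, False)\<close> is the idempotent at the vertex \<open>i\<close> of the 3-cycle, \<open>(i, True)\<close> the arrow from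
  \<open>i\<close> to \<open>i + 1\<close>; the numeral type \<open>3\<close> is the ring of integers modulo 3.\<close>

type_synonym letter = "3 \<times> bool"
type_synonym word = "letter list"
type_synonym chain = "word \<Rightarrow>\<^sub>0 complex"

definition tgt :: "letter \<Rightarrow> 3" where
  "tgt x = (if snd x then fst x + 1 else fst x)"

abbreviation src :: "letter \<Rightarrow> 3" where "src \<equiv> fst"
abbreviation arrow :: "letter \<Rightarrow> bool" where "arrow \<equiv> snd"
abbreviation idem :: "3 \<Rightarrow> letter" where "idem i \<equiv> (i, False)"

lemma tgt_idem [simp]: "tgt (idem i) = i" by (simp add: tgt_def)

text \<open>\<open>None\<close> stands for the zero product, so products of basis elements stay
  within the letters. Two arrows never have a product because all paths of length two are
  relations.\<close>

definition lmult :: "letter \<Rightarrow> letter \<Rightarrow> letter option" where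
  "lmult x y = (if tgt x = src y \<and> \<not> (arrow x \<and> arrow y) then Some (src x, arrow x \<or> arrow y) else None)"

lemma lmult_assoc:
  "Option.bind (lmult x y) (\<lambda>u. lmult u z) = Option.bind (lmult y z) (\<lambda>u. lmult x u)"
  by (cases x; cases y; cases z) (auto simp: lmult_def tgt_def)

lemma lmult_assoc_cases:
  "(case lmult x y of None \<Rightarrow> None | Some u \<Rightarrow> lmult u z) = (case lmult y z of None \<Rightarrow> None | Some u \<Rightarrow> lmult x u)"
  using lmult_assoc[of x y z] by (auto split: option.splits)

lemma lmult_idem_left: "lmult (idem i) y = (if i = src y then Some y else None)"
  by (cases y) (auto simp: lmult_def)

lemma lmult_idem_right: "lmult x (idem i) = (if tgt x = i then Some x else None)"
  by (cases x) (auto simp: lmult_def)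

lemma lmult_SomeD:
  assumes "lmult x y = Some z"
  shows "tgt x = src y" "src z = src x" "tgt z = tgt y" "arrow z \<longleftrightarrow> arrow x \<or> arrow y"
    "\<not> (arrow x \<and> arrow y)"
  using assms by (auto simp: lmult_def tgt_def split: if_splits)

subsection \<open>Left and right multiplication of words\<close>

abbreviation opt_chain :: "word option \<Rightarrow> chain" where
  "opt_chain u \<equiv> (case u of None \<Rightarrow> 0 | Some w \<Rightarrow> gen w)"

definition pre :: "letter \<Rightarrow> chain \<Rightarrow> chain" where
  "pre x = lin_ext (\<lambda>w. gen (x # w))"

definition lact :: "letter \<Rightarrow> chain \<Rightarrow> chain" where
  "lact a = lin_ext (\<lambda>w. case w of [] \<Rightarrow> 0 | x # v \<Rightarrow> opt_chain (map_option (\<lambda>z. z # v) (lmult a x)))"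

definition ract :: "letter \<Rightarrow> chain \<Rightarrow> chain" where
  "ract b = lin_ext (\<lambda>w. if w = [] then 0
     else opt_chain (map_option (\<lambda>z. butlast w @ [z]) (lmult (last w) b)))"

lemma linear_pre [intro, simp]: "linear_op (pre x)"
  and linear_lact [intro, simp]: "linear_op (lact x)"
  and linear_ract [intro, simp]: "linear_op (ract x)"
  by (simp_all add: pre_def lact_def ract_def)

lemma pre_gen [simp]: "pre x (gen w) = gen (x # w)"
  by (simp add: pre_def)

lemma lact_gen [simp]: "lact a (gen []) = 0"
  "lact a (gen (x # w)) = opt_chain (map_option (\<lambda>z. z # w) (lmult a x))"
  by (simp_all add: lact_def)

lemma ract_gen [simp]: "ract b (gen []) = 0"
  "ract b (gen (w @ [x])) = opt_chain (map_option (\<lambda>z. w @ [z]) (lmult x b))"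
  by (simp_all add: ract_def)

lemma ract_single: "ract b (gen [x]) = opt_chain (map_option (\<lambda>z. [z]) (lmult x b))"
  using ract_gen(2)[of b "[]" x] by simp

lemmas linear_pre_comp [lin_intros] = linear_op_compose[OF linear_pre]
lemmas pre_simps [simp] = linear_opD[OF linear_pre] linear_op_sum[OF linear_pre]
lemmas linear_lact_comp [lin_intros] = linear_op_compose[OF linear_lact]
lemmas lact_simps [simp] = linear_opD[OF linear_lact] linear_op_sum[OF linear_lact]
lemmas linear_ract_comp [lin_intros] = linear_op_compose[OF linear_ract]
lemmas ract_simps [simp] = linear_opD[OF linear_ract] linear_op_sum[OF linear_ract]

lemma lact_pre: "lact a (pre x z) = (case lmult a x of None \<Rightarrow> 0 | Some c \<Rightarrow> pre c z)"
proof (cases "lmult a x")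
  case None
  show ?thesis unfolding None option.case
    by (rule linear_op_eqI[where x = z]) (auto simp: None intro!: lin_intros)
next
  case (Some c)
  show ?thesis unfolding Some option.case
    by (rule linear_op_eqI[where x = z]) (auto simp: Some intro!: lin_intros)
qed

text \<open>The empty word is excluded because \<open>ract b\<close> acts on \<open>[x]\<close>
  through its only letter but kills \<open>[]\<close>.\<close>

lemma ract_pre:
  assumes "[] \<notin> supp z"
  shows "ract b (pre x z) = pre x (ract b z)"
proof -
  have *: "ract b (pre x (gen w)) = pre x (ract b (gen w))" if "w \<noteq> []" for w
  proof -
    from that obtain v y where "w = v @ [y]" by (metis rev_exhaust)
    then show ?thesis
      using ract_gen(2)[of b "x # v" y] by (cases "lmult y b") simp_all
  qed
  show ?thesis
  proof (rule linear_op_eqI[where x = z])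
    show "ract b (pre x (gen k)) = pre x (ract b (gen k))" if "k \<in> supp z" for k
      using that assms by (intro *) auto
  qed (auto intro!: lin_intros)
qed

lemma lact_lact: "lact a (lact b z) = (case lmult a b of None \<Rightarrow> 0 | Some c \<Rightarrow> lact c z)"
proof -
  have *: "lact a (lact b (gen w)) = (case lmult a b of None \<Rightarrow> 0 | Some c \<Rightarrow> lact c (gen w))" for w
    using lmult_assoc_cases[where x = a and y = b and z = "hd w"]
    by (cases w) (auto split: option.splits)
  show ?thesis
  proof (cases "lmult a b")
    case None
    show ?thesis unfolding None option.case
      by (rule linear_op_eqI[where x = z]) (use * None in \<open>auto intro!: lin_intros\<close>)
  next
    case (Some c)
    show ?thesis unfolding Some option.case
      by (rule linear_op_eqI[where x = z]) (use * Some in \<open>auto intro!: lin_intros\<close>)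
  qed
qed

text \<open>On a word of length one both actions hit the same letter and the claim is associativity;
  on longer words they touch different letters.\<close>

lemma lact_ract: "lact a (ract b z) = ract b (lact a z)"
proof (rule linear_op_eqI[where x = z])
  fix w :: word
  show "lact a (ract b (gen w)) = ract b (lact a (gen w))"
  proof (cases w)
    case (Cons x v)
    show ?thesis
    proof (cases v rule: rev_cases)
      case Nil
      then show ?thesis using Cons lmult_assoc_cases[where x = a and y = x and z = b]
        by (auto simp: ract_single split: option.splits)
    next
      case (snoc u y)
      then show ?thesis using Cons ract_gen(2)[of b "x # u" y] ract_gen(2)[of b "the (lmult a x) # u" y]
        by (cases "lmult a x"; cases "lmult y b") auto
    qed
  qed simp
qed (auto intro!: lin_intros)

lemma sum_lact_idem: "(\<Sum>u\<in>UNIV. lact (idem u) z) = z" if "[] \<notin> supp z"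
proof (rule linear_op_eqI[where x = z])
  fix w assume "w \<in> supp z"
  with that obtain x v where w: "w = x # v" by (cases w) auto
  have "(\<Sum>u\<in>UNIV. lact (idem u) (gen w)) = (\<Sum>u\<in>UNIV. if u = src x then gen w else 0)"
    by (rule sum.cong) (auto simp: w lmult_idem_left)
  then show "(\<Sum>u\<in>UNIV. lact (idem u) (gen w)) = gen w" by simp
qed (auto intro!: lin_intros)

text \<open>The sum is \<open>w\<close> preceded by the unit of the algebra. Hence left linear maps
  are determined by their values on words with the unit in front; \<open>ract_sum_idem\<close> is
  the same on the right.\<close>

lemma lact_sum_idem: "lact a (\<Sum>u\<in>UNIV. gen (idem u # w)) = gen (a # w)"
proof -
  have "lact a (\<Sum>u\<in>UNIV. gen (idem u # w)) = (\<Sum>u\<in>UNIV. if u = tgt a then gen (a # w) else 0)"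
    unfolding lact_simps by (rule sum.cong) (auto simp: lmult_idem_right)
  then show ?thesis by simp
qed

lemma ract_sum_idem: "ract b (\<Sum>v\<in>UNIV. gen (w @ [idem v])) = gen (w @ [b])"
proof -
  have "ract b (\<Sum>u\<in>UNIV. gen (w @ [idem u])) = (\<Sum>u\<in>UNIV. if u = src b then gen (w @ [b]) else 0)"
    unfolding ract_simps by (rule sum.cong) (auto simp: lmult_idem_left)
  then show ?thesis by simp
qed

subsection \<open>The augmented bar complex on words\<close>

definition wset :: "nat \<Rightarrow> nat \<Rightarrow> word set" where
  "wset n d = {w. length w = n \<and> length (filter arrow w) = d}"

lemma keys_pre: "supp (pre x z) \<subseteq> (#) x ` supp z"
  by (rule keys_linear_op) auto

lemma keys_pre_wset:
  assumes "supp z \<subseteq> wset n d"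
  shows "supp (pre x z) \<subseteq> wset (Suc n) (d + (if arrow x then 1 else 0))"
  using keys_pre[of x z] assms by (fastforce simp: wset_def)

lemma keys_lact_wset: "supp (lact x (gen w)) \<subseteq> wset (length w) (length (filter arrow (x # w)))"
  by (cases w) (auto simp: wset_def split: option.splits dest: lmult_SomeD)

text \<open>A word of length \<open>n + 2\<close> is a basis element of the \<open>n\<close>-th term of the bar resolution; words of length 1
  form the augmentation.\<close>

primrec bd_word :: "word \<Rightarrow> chain" where
  "bd_word [] = 0"
| "bd_word (x # w) = lact x (gen w) - pre x (bd_word w)"

definition bd :: "chain \<Rightarrow> chain" where
  "bd = lin_ext bd_word"

lemma linear_bd [intro, simp]: "linear_op bd" by (simp add: bd_def)
lemmas linear_bd_comp [lin_intros] = linear_op_compose[OF linear_bd]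
lemmas bd_simps [simp] = linear_opD[OF linear_bd] linear_op_sum[OF linear_bd]

lemma bd_gen [simp]: "bd (gen w) = bd_word w" by (simp add: bd_def)

lemma keys_bd_word: "supp (bd_word w) \<subseteq> wset (length w - 1) (length (filter arrow w))"
proof (induction w)
  case (Cons x w)
  show ?case
  proof (cases "w = []")
    case False
    show ?thesis unfolding bd_word.simps
      using keys_lact_wset[of x w] keys_pre_wset[OF Cons, of x] False
      by (intro keys_diff_subset) auto
  qed simp
qed simp

lemma bd_word_short: "length w \<le> 1 \<Longrightarrow> bd_word w = 0"
  by (cases w) auto

lemma Nil_notin_keys_bd_word: "[] \<notin> supp (bd_word w)"
  using keys_bd_word[of w] bd_word_short[of w] by (cases "length w \<le> 1") (auto simp: wset_def)

text \<open>Summed over all idempotents \<open>x\<close>, this says that putting the unit in front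
  is a contraction of the augmented complex.\<close>

lemma bd_pre: "bd (pre x z) = lact x z - pre x (bd z)"
  by (rule linear_op_eqI[where x = z]) (auto intro!: lin_intros)

lemma bd_lact: "bd (lact a z) = lact a (bd z)"
proof (rule linear_op_eqI[where x = z])
  fix w :: word
  show "bd (lact a (gen w)) = lact a (bd (gen w))"
    by (cases w) (auto simp: lact_lact lact_pre split: option.splits)
qed (auto intro!: lin_intros)

lemma bd_ract: "bd (ract b z) = ract b (bd z)"
proof (rule linear_op_eqI[where x = z])
  fix w :: word
  show "bd (ract b (gen w)) = ract b (bd (gen w))"
  proof (induction w)
    case (Cons x w)
    show ?case
    proof (cases "w = []")
      case True
      then show ?thesis by (cases "lmult x b") (auto simp: ract_single)
    next
      case False
      then have "ract b (gen (x # w)) = pre x (ract b (gen w))"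
        using ract_pre[of "gen w" b x] by simp
      moreover have "ract b (pre x (bd_word w)) = pre x (ract b (bd_word w))"
        by (rule ract_pre) (rule Nil_notin_keys_bd_word)
      ultimately show ?thesis using Cons by (simp add: bd_pre lact_ract)
    qed
  qed simp
qed (auto intro!: lin_intros)

text \<open>The two mixed terms \<open>lact x (bd_word w)\<close> cancel because left multiplication
  commutes with \<open>bd\<close>.\<close>

lemma bd_bd_word: "bd (bd_word w) = 0"
  by (induction w) (auto simp: bd_pre bd_lact)

lemma bd_bd: "bd (bd z) = 0"
  by (rule linear_op_eqI[where x = z and T = "\<lambda>_. 0"]) (auto simp: bd_bd_word intro!: lin_intros)

subsection \<open>The projection onto composable words with arrows inside\<close>

text \<open>In the third clause \<open>w = []\<close> means that \<open>y\<close> is the last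
  letter. Like the first one it is an outer factor of the bimodule and may be an idempotent.\<close>

fun good :: "word \<Rightarrow> bool" where
  "good [] \<longleftrightarrow> True"
| "good [x] \<longleftrightarrow> True"
| "good (x # y # w) \<longleftrightarrow> tgt x = src y \<and> (w = [] \<or> arrow y) \<and> good (y # w)"

definition phi :: "chain \<Rightarrow> chain" where
  "phi = lin_ext (\<lambda>w. if good w then gen w else 0)"

lemma linear_phi [intro, simp]: "linear_op phi" by (simp add: phi_def)
lemmas linear_phi_comp [lin_intros] = linear_op_compose[OF linear_phi]
lemmas phi_simps [simp] = linear_opD[OF linear_phi] linear_op_sum[OF linear_phi]
lemma phi_gen [simp]: "phi (gen w) = (if good w then gen w else 0)" by (simp add: phi_def)

text \<open>A product from the left keeps the target of the first letter, and on this letter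
  \<open>good\<close> imposes nothing else.\<close>

lemma phi_lact: "phi (lact a z) = lact a (phi z)"
proof (rule linear_op_eqI[where x = z])
  fix w :: word
  show "phi (lact a (gen w)) = lact a (phi (gen w))"
  proof (cases w rule: good.cases)
    case (3 x y v)
    then show ?thesis by (cases "lmult a x") (auto dest: lmult_SomeD)
  qed (auto split: option.splits)
qed (auto intro!: lin_intros)

text \<open>The last letter enters \<open>good\<close> only through its source, which a product from
  the right keeps.\<close>

lemma good_last:
  assumes "lmult z b = Some c"
  shows "good (w @ [c]) = good (w @ [z])"
proof (induction w rule: good.induct)
  case (2 x)
  then show ?case using assms by (auto dest: lmult_SomeD)
next
  case (3 x y w)
  then show ?case by (cases w) auto
qed simp

lemma phi_ract: "phi (ract b z) = ract b (phi z)"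
proof (rule linear_op_eqI[where x = z])
  fix w :: word
  show "phi (ract b (gen w)) = ract b (phi (gen w))"
  proof (cases w rule: rev_cases)
    case (snoc v z)
    then show ?thesis by (cases "lmult z b") (auto simp: good_last)
  qed auto
qed (auto intro!: lin_intros)

text \<open>The share of \<open>good\<close> that concerns the joint created by putting
  \<open>x\<close> in front of \<open>w\<close>, see \<open>good_Cons\<close>.\<close>

definition joins :: "letter \<Rightarrow> word \<Rightarrow> bool" where
  "joins x w \<longleftrightarrow> w = [] \<or> tgt x = src (hd w) \<and> (tl w = [] \<or> arrow (hd w))"

definition jproj :: "letter \<Rightarrow> chain \<Rightarrow> chain" where
  "jproj x = lin_ext (\<lambda>w. if joins x w then gen w else 0)"

lemma linear_jproj [intro, simp]: "linear_op (jproj x)" by (simp add: jproj_def)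
lemmas linear_jproj_comp [lin_intros] = linear_op_compose[OF linear_jproj]
lemmas jproj_simps [simp] = linear_opD[OF linear_jproj] linear_op_sum[OF linear_jproj]
lemma jproj_gen [simp]: "jproj x (gen w) = (if joins x w then gen w else 0)" by (simp add: jproj_def)

lemma good_Cons: "good (x # w) \<longleftrightarrow> joins x w \<and> good w"
  by (cases w) (auto simp: joins_def)

lemma phi_pre: "phi (pre x z) = pre x (jproj x (phi z))"
  by (rule linear_op_eqI[where x = z]) (auto simp: good_Cons intro!: lin_intros)

text \<open>Excluding the empty word makes \<open>y\<close> an inner letter, so that it has to be an
  arrow.\<close>

lemma jproj_pre:
  assumes "[] \<notin> supp z"
  shows "jproj x (pre y z) = (if tgt x = src y \<and> arrow y then pre y z else 0)"
proof -
  have *: "jproj x (gen (y # w)) = (if tgt x = src y \<and> arrow y then gen (y # w) else 0)"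
    if "w \<in> supp z" for w
    using that assms by (auto simp: joins_def)
  show ?thesis
  proof (cases "tgt x = src y \<and> arrow y")
    case True
    show ?thesis unfolding if_P[OF True]
      by (rule linear_op_eqI[where x = z]) (use * True in \<open>auto intro!: lin_intros simp del: jproj_gen\<close>)
  next
    case False
    show ?thesis unfolding if_not_P[OF False]
      by (rule linear_op_eqI[where x = z and T = "\<lambda>_. 0"])
        (use * False in \<open>auto intro!: lin_intros simp del: jproj_gen\<close>)
  qed
qed

text \<open>Induction leaves only the joint between \<open>x\<close> and the rest of the word. If
  \<open>x\<close> and the next letter do not compose, no surviving face can repair the joint; if
  that letter is an arrow composing with \<open>x\<close>, nothing is projected away; the remaining
  case is a cancellation.\<close>

lemma phi_bd_word: "phi (bd_word w) = bd (phi (gen w))"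
proof (induction w)
  case (Cons x w)
  have eq: "phi (bd_word (x # w)) = lact x (phi (gen w)) - pre x (jproj x (bd (phi (gen w))))"
    by (simp add: phi_lact phi_pre Cons)
  show ?case
  proof (cases "good w")
    case False
    then show ?thesis unfolding eq by (simp add: good_Cons)
  next
    case True
    show ?thesis
    proof (cases w rule: good.cases)
      case 1
      then show ?thesis by (simp add: eq)
    next
      case (2 y)
      then show ?thesis by (auto simp: eq lmult_def)
    next
      case (3 y y' v)
      have j: "jproj x (pre y (bd_word (y' # v)))
          = (if tgt x = src y \<and> arrow y then pre y (bd_word (y' # v)) else 0)"
        by (rule jproj_pre) (rule Nil_notin_keys_bd_word)
      have yy': "tgt y = src y'" "v = [] \<or> arrow y'" using True 3 by auto
      have pw: "phi (gen w) = gen w" using True by simp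
      have bw: "bd (gen w) = lact y (gen (y' # v)) - pre y (bd_word (y' # v))" unfolding 3 by simp
      have eq': "phi (bd_word (x # w)) = lact x (gen w)
          - pre x (jproj x (lact y (gen (y' # v))) - jproj x (pre y (bd_word (y' # v))))"
        unfolding eq pw bw jproj_simps ..
      consider "tgt x \<noteq> src y" | "tgt x = src y" "arrow y" | "tgt x = src y" "\<not> arrow y" by blast
      then show ?thesis
      proof cases
        case 1
        have "jproj x (lact y (gen (y' # v))) = 0"
          using 1 by (auto simp: joins_def split: option.splits dest: lmult_SomeD)
        moreover have "lact x (gen w) = 0" using 1 by (simp add: 3 lmult_def)
        moreover have "phi (gen (x # w)) = 0" using 1 by (simp add: 3)
        ultimately show ?thesis unfolding eq' j using 1 by simp
      next
        case 2
        have "jproj x (lact y (gen (y' # v))) = lact y (gen (y' # v))"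
          using 2 yy' by (auto simp: joins_def lmult_def)
        moreover have "phi (gen (x # w)) = gen (x # w)" using 2 True by (simp add: 3)
        ultimately show ?thesis unfolding eq' j using 2 bw by simp
      next
        \<comment> \<open>An idempotent \<open>y\<close> in an inner position: merging it with
          \<open>x\<close> and merging it with \<open>y'\<close> yield the same word, with opposite
          signs.\<close>
        case c3: 3
        then obtain i where y: "y = idem i" by (cases y) auto
        have "lact y (gen (y' # v)) = gen (y' # v)"
          using yy' by (simp add: y lmult_idem_left)
        moreover have "joins x (y' # v)" using yy' c3 by (auto simp: joins_def y)
        moreover have "lact x (gen w) = gen (x # y' # v)"
          using c3 by (simp add: 3 y lmult_idem_right)
        moreover have "phi (gen (x # w)) = 0" using c3 by (simp add: 3)
        ultimately show ?thesis unfolding eq' j using c3 by simp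
      qed
    qed
  qed
qed simp

lemma phi_bd: "phi (bd z) = bd (phi z)"
  by (rule linear_op_eqI[where x = z]) (auto simp: phi_bd_word intro!: lin_intros simp del: phi_gen)

subsection \<open>A contracting homotopy of the kernel of the projection\<close>

text \<open>The usual lift of a bimodule map inducing zero to a null homotopy, along the contraction
  \<open>z \<mapsto> 1 \<otimes> z\<close> of the bar resolution. The first argument bounds the recursion; only
  \<open>htp_aux (length w) w\<close> is meaningful.\<close>

primrec htp_aux :: "nat \<Rightarrow> word \<Rightarrow> chain" where
  "htp_aux 0 w = 0"
| "htp_aux (Suc n) w = (case w of [] \<Rightarrow> 0 | x # v \<Rightarrow>
     pre x (\<Sum>u\<in>UNIV. gen (idem u # v) - phi (gen (idem u # v)) - lin_ext (htp_aux n) (bd_word (idem u # v))))"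

definition htp :: "chain \<Rightarrow> chain" where
  "htp = lin_ext (\<lambda>w. htp_aux (length w) w)"

lemma linear_htp [intro, simp]: "linear_op htp" by (simp add: htp_def)
lemmas linear_htp_comp [lin_intros] = linear_op_compose[OF linear_htp]
lemmas htp_simps [simp] = linear_opD[OF linear_htp] linear_op_sum[OF linear_htp]

lemma htp_Nil [simp]: "htp (gen []) = 0" by (simp add: htp_def)

text \<open>The recursion bound disappears: all words in the boundary of \<open>idem u # v\<close>
  have the length of \<open>v\<close>, which is exactly the bound passed on.\<close>

lemma htp_Cons:
  "htp (gen (x # v)) =
     pre x (\<Sum>u\<in>UNIV. gen (idem u # v) - phi (gen (idem u # v)) - htp (bd (gen (idem u # v))))"
proof -
  have "lin_ext (htp_aux (length v)) (bd_word (idem u # v)) = htp (bd_word (idem u # v))" for u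
    unfolding htp_def
    by (rule linear_op_eqI) (use keys_bd_word[of "idem u # v"] in \<open>auto simp: wset_def\<close>)
  then show ?thesis by (simp add: htp_def del: bd_word.simps)
qed

text \<open>The recursion depends on the first letter only through the outer \<open>pre x\<close>,
  so left linearity is built in.\<close>

lemma htp_lact: "htp (lact a z) = lact a (htp z)"
proof (rule linear_op_eqI[where x = z])
  fix w :: word
  show "htp (lact a (gen w)) = lact a (htp (gen w))"
    by (cases w) (auto simp: htp_Cons lact_pre split: option.splits)
qed (auto intro!: lin_intros)

text \<open>On the augmentation \<open>phi\<close> is the identity, so the homotopy starts with
  zero.\<close>

lemma htp_single: "htp (gen [x]) = 0"
  by (simp add: htp_Cons)

lemma keys_htp: "supp (htp (gen w)) \<subseteq> wset (Suc (length w)) (length (filter arrow w))"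
proof (induction "length w" arbitrary: w rule: less_induct)
  case less
  show ?case
  proof (cases w)
    case (Cons x v)
    show ?thesis
    proof (cases "v = []")
      case True
      then show ?thesis by (simp add: Cons htp_single)
    next
      case False
      let ?k = "\<lambda>u. gen (idem u # v) - phi (gen (idem u # v)) - htp (bd (gen (idem u # v)))"
      have "supp (?k u) \<subseteq> wset (length w) (length (filter arrow v))" for u
      proof -
        have "supp (htp (bd (gen (idem u # v)))) \<subseteq> wset (length w) (length (filter arrow v))"
        proof (rule keys_linear_op[OF linear_htp])
          fix k assume "k \<in> supp (bd (gen (idem u # v)))"
          then have k: "length k = length v" "length (filter arrow k) = length (filter arrow v)"
            using keys_bd_word[of "idem u # v"] by (auto simp: wset_def)
          then show "supp (htp (gen k)) \<subseteq> wset (length w) (length (filter arrow v))"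
            using less[of k] by (simp add: Cons)
        qed
        moreover have "supp (gen (idem u # v) - phi (gen (idem u # v)))
            \<subseteq> wset (length w) (length (filter arrow v))"
          by (auto simp: wset_def Cons)
        ultimately show ?thesis by (rule keys_diff_subset[rotated])
      qed
      then have "supp (\<Sum>u\<in>UNIV. ?k u) \<subseteq> wset (length w) (length (filter arrow v))"
        by (intro keys_sum_subset)
      moreover have "length (filter arrow v) + (if arrow x then 1 else 0) = length (filter arrow w)"
        by (simp add: Cons)
      moreover have "htp (gen w) = pre x (\<Sum>u\<in>UNIV. ?k u)"
        unfolding Cons by (rule htp_Cons)
      ultimately show ?thesis
        using keys_pre_wset[of "\<Sum>u\<in>UNIV. ?k u" "length w" "length (filter arrow v)" x] by metis
    qed
  qed simp
qed

lemma Nil_notin_keys_htp: "[] \<notin> supp (htp z)"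
proof -
  have "supp (htp z) \<subseteq> - {[]}"
  proof (rule keys_linear_op[of htp])
    show "supp (htp (gen k)) \<subseteq> - {[]}" for k
      using keys_htp[of k] by (auto simp: wset_def)
  qed simp
  then show ?thesis by auto
qed

text \<open>In contrast to the left side this needs induction on the length: the last letter lies
  deep in the recursion, and it is reached through \<open>bd\<close>, \<open>phi\<close> and
  \<open>htp\<close> on shorter words, all of which are right linear.\<close>

lemma htp_ract: "htp (ract b z) = ract b (htp z)"
proof (rule linear_op_eqI[where x = z])
  fix w :: word
  show "htp (ract b (gen w)) = ract b (htp (gen w))"
  proof (induction "length w" arbitrary: w rule: less_induct)
    case less
    show ?case
    proof (cases w)
      case (Cons x v)
      show ?thesis
      proof (cases v rule: rev_cases)
        case Nil
        then show ?thesis by (auto simp: Cons htp_single ract_single split: option.splits)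
      next
        case (snoc t y)
        have IH: "htp (ract b z) = ract b (htp z)" if "supp z \<subseteq> wset (length v) d" for z d
          by (rule linear_op_eqI[where x = z])
            (use less that in \<open>auto simp: Cons wset_def intro!: lin_intros\<close>)
        have b: "ract b (htp (bd (gen (idem u # v)))) = htp (bd (ract b (gen (idem u # v))))" for u
          unfolding bd_ract using IH[OF keys_bd_word[of "idem u # v", simplified]] by simp
        let ?k = "\<Sum>u\<in>UNIV. gen (idem u # v) - phi (gen (idem u # v)) - htp (bd (gen (idem u # v)))"
        have k: "ract b ?k = (\<Sum>u\<in>UNIV. ract b (gen (idem u # v)) - phi (ract b (gen (idem u # v)))
            - htp (bd (ract b (gen (idem u # v)))))"
          unfolding ract_simps phi_ract b ..
        have "[] \<notin> supp ?k"
        proof -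
          have "supp ?k \<subseteq> - {[]}"
            by (intro keys_sum_subset keys_diff_subset) (use Nil_notin_keys_htp in \<open>auto simp del: bd_gen\<close>)
          then show ?thesis by auto
        qed
        then have R: "ract b (htp (gen w)) = pre x (ract b ?k)"
          unfolding Cons htp_Cons by (rule ract_pre)
        have r: "ract b (gen (c # v)) = (case lmult y b of None \<Rightarrow> 0 | Some z \<Rightarrow> gen (c # t @ [z]))" for c
          using ract_gen(2)[of b "c # t" y] by (auto simp: snoc split: option.splits)
        have "htp (ract b (gen w)) = pre x (ract b ?k)"
        proof (cases "lmult y b")
          case None
          then show ?thesis unfolding k Cons r by simp
        next
          case (Some z)
          then show ?thesis unfolding k Cons r option.case Some by (intro htp_Cons)
        qed
        then show ?thesis unfolding R .
      qed
    qed simp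
  qed
qed (auto intro!: lin_intros)

text \<open>The induction hypothesis for the boundary of \<open>idem u # v\<close> makes
  \<open>?k u\<close> a cycle. Hence \<open>bd (pre x k) = lact x k\<close> for the sum
  \<open>k\<close> of these, and by left linearity \<open>lact x\<close> turns the unit in front of
  \<open>v\<close> into \<open>x\<close>.\<close>

lemma htp_homotopy: "bd (htp z) + htp (bd z) = z - phi z"
proof (rule linear_op_eqI[where x = z])
  fix w :: word
  show "bd (htp (gen w)) + htp (bd (gen w)) = gen w - phi (gen w)"
  proof (induction "length w" arbitrary: w rule: less_induct)
    case less
    show ?case
    proof (cases w)
      case (Cons x v)
      let ?g = "\<lambda>u. gen (idem u # v)"
      let ?k = "\<lambda>u. ?g u - phi (?g u) - htp (bd (?g u))"
      have "bd (?k u) = 0" for u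
      proof -
        have "bd (htp (bd (?g u))) + htp (bd (bd (?g u))) = bd (?g u) - phi (bd (?g u))"
        proof (rule linear_op_eqI[where x = "bd (?g u)"])
          fix k assume "k \<in> supp (bd (?g u))"
          then have "length k < length w" using keys_bd_word[of "idem u # v"] by (auto simp: wset_def Cons)
          then show "bd (htp (gen k)) + htp (bd (gen k)) = gen k - phi (gen k)" by (rule less)
        qed (auto intro!: lin_intros)
        then show ?thesis by (simp add: bd_bd phi_bd del: bd_gen phi_gen bd_word.simps)
      qed
      then have "bd (htp (gen w)) = lact x (\<Sum>u\<in>UNIV. ?k u)"
        unfolding Cons htp_Cons bd_pre bd_simps by simp
      also have "\<dots> = lact x (\<Sum>u\<in>UNIV. ?g u) - phi (lact x (\<Sum>u\<in>UNIV. ?g u))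
          - htp (bd (lact x (\<Sum>u\<in>UNIV. ?g u)))"
        unfolding htp_lact bd_lact phi_lact lact_simps htp_simps bd_simps phi_simps sum_subtractf ..
      also have "\<dots> = gen w - phi (gen w) - htp (bd (gen w))"
        unfolding lact_sum_idem Cons ..
      finally show ?thesis by simp
    qed simp
  qed
qed (auto intro!: lin_intros)

subsection \<open>From the bar resolution to Hochschild chains\<close>

definition triple :: "letter \<Rightarrow> letter \<Rightarrow> letter \<Rightarrow> letter option" where
  "triple b m a = Option.bind (lmult b m) (\<lambda>u. lmult u a)"

lemma triple_idem: "triple (idem v) m (idem u) = (if v = src m \<and> u = tgt m then Some m else None)"
  by (cases m) (auto simp: triple_def lmult_def tgt_def)

text \<open>Both sides are the product of \<open>y\<close>, \<open>b\<close>, \<open>m\<close>,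
  \<open>a\<close>, \<open>x\<close> in this order, bracketed in two ways.\<close>

lemma triple_assoc:
  "Option.bind (lmult y b) (\<lambda>y'. Option.bind (lmult a x) (triple y' m))
     = Option.bind (triple b m a) (\<lambda>m'. triple y m' x)"
  by (cases "arrow y"; cases "arrow b"; cases "arrow m"; cases "arrow a"; cases "arrow x")
     (auto simp: triple_def lmult_def tgt_def)

text \<open>The class of \<open>m \<otimes> (y\<^sub>0, ..., y\<^bsub>k+1\<^esub>)\<close> in the tensor product over the enveloping algebra is
  the Hochschild chain \<open>(y\<^bsub>k+1\<^esub> m y\<^sub>0, y\<^sub>1, ..., y\<^sub>k)\<close>.\<close>

definition wrap :: "letter \<Rightarrow> chain \<Rightarrow> chain" where
  "wrap m = lin_ext (\<lambda>w. if length w < 2 then 0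
     else opt_chain (map_option (\<lambda>c. c # butlast (tl w)) (triple (last w) m (hd w))))"

lemma linear_wrap [intro, simp]: "linear_op (wrap m)" by (simp add: wrap_def)
lemmas linear_wrap_comp [lin_intros] = linear_op_compose[OF linear_wrap]
lemmas wrap_simps [simp] = linear_opD[OF linear_wrap] linear_op_sum[OF linear_wrap]

lemma wrap_short: "length w < 2 \<Longrightarrow> wrap m (gen w) = 0" by (simp add: wrap_def)

lemma wrap_gen: "wrap m (gen (a # x @ [b])) = opt_chain (map_option (\<lambda>c. c # x) (triple b m a))"
  by (simp add: wrap_def butlast_append)

lemma long_word_cases:
  assumes "\<not> length w < 2" obtains a x b where "w = a # x @ [b]"
proof -
  from assms obtain a v where "w = a # v" "v \<noteq> []" by (cases w) auto
  with that show ?thesis by (metis rev_exhaust)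
qed

text \<open>The balancing relation of the tensor product over the enveloping algebra, in terms of
  letters.\<close>

lemma wrap_act: "wrap m (lact a (ract b z)) = (case triple b m a of None \<Rightarrow> 0 | Some c \<Rightarrow> wrap c z)"
proof -
  have *: "wrap m (lact a (ract b (gen w))) = (case triple b m a of None \<Rightarrow> 0 | Some c \<Rightarrow> wrap c (gen w))" for w
  proof (cases "length w < 2")
    case True
    then consider "w = []" | x where "w = [x]" by (cases w) auto
    then show ?thesis
    proof cases
      case 2
      then show ?thesis
        by (auto simp: ract_single wrap_short split: option.splits)
    qed (simp add: wrap_short split: option.splits)
  next
    case False
    then obtain x v y where w: "w = x # v @ [y]" by (rule long_word_cases)
    show ?thesis
    proof (cases "lmult y b")
      case None
      then show ?thesis using triple_assoc[where y = y and b = b and a = a and x = x and m = m] ract_gen(2)[of b "x # v" y]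
        by (auto simp: w wrap_gen split: option.splits)
    next
      case (Some y')
      then have r: "ract b (gen w) = gen (x # v @ [y'])" using ract_gen(2)[of b "x # v" y] by (simp add: w)
      show ?thesis unfolding r
        using triple_assoc[where y = y and b = b and a = a and x = x and m = m] Some
        by (cases "lmult a x"; cases "triple b m a") (auto simp: w wrap_gen)
    qed
  qed
  show ?thesis
  proof (cases "triple b m a")
    case None
    show ?thesis unfolding None option.case
      by (rule linear_op_eqI[where x = z]) (use * None in \<open>auto intro!: lin_intros\<close>)
  next
    case (Some c)
    show ?thesis unfolding Some option.case
      by (rule linear_op_eqI[where x = z]) (use * Some in \<open>auto intro!: lin_intros\<close>)
  qed
qed

text \<open>The operator on Hochschild chains induced by a bimodule map \<open>T\<close>: the chain
  \<open>m # x\<close> is represented by \<open>m\<close> and the bar element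
  \<open>(1, x, 1)\<close>, both units being expanded into idempotents.\<close>

definition descend :: "(chain \<Rightarrow> chain) \<Rightarrow> chain \<Rightarrow> chain" where
  "descend T = lin_ext (\<lambda>w. case w of [] \<Rightarrow> 0 | m # x \<Rightarrow>
     \<Sum>u\<in>UNIV. \<Sum>v\<in>UNIV. wrap m (T (gen (idem u # x @ [idem v]))))"

lemma linear_descend [intro, simp]: "linear_op (descend T)" by (simp add: descend_def)
lemmas linear_descend_comp [lin_intros] = linear_op_compose[OF linear_descend]
lemmas descend_simps [simp] = linear_opD[OF linear_descend] linear_op_sum[OF linear_descend]

lemma descend_Nil: "descend T (gen []) = 0"
  and descend_gen: "descend T (gen (m # x)) =
     (\<Sum>u\<in>UNIV. \<Sum>v\<in>UNIV. wrap m (T (gen (idem u # x @ [idem v]))))"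
  by (simp_all add: descend_def)

text \<open>The last clause is for words of length below two: \<open>wrap\<close> sends them to
  zero, and it must still do so after \<open>T\<close> has been applied.\<close>

definition equivariant :: "(chain \<Rightarrow> chain) \<Rightarrow> bool" where
  "equivariant T \<longleftrightarrow> linear_op T \<and> (\<forall>a z. T (lact a z) = lact a (T z)) \<and> (\<forall>b z. T (ract b z) = ract b (T z))
     \<and> (\<forall>m w. length w < 2 \<longrightarrow> wrap m (T (gen w)) = 0)"

text \<open>The word \<open>a # x @ [b]\<close> arises from \<open>(1, x, 1)\<close> by the actions
  of \<open>a\<close> and \<open>b\<close>. These pass through \<open>T\<close> and are then
  absorbed into the coefficient \<open>m\<close> by \<open>wrap_act\<close>.\<close>

lemma descend_wrap:
  assumes "equivariant T"
  shows "descend T (wrap m z) = wrap m (T z)"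
proof -
  have lin: "linear_op T" and act: "T (lact a z) = lact a (T z)" "T (ract b z) = ract b (T z)"
    and short: "length w < 2 \<Longrightarrow> wrap m (T (gen w)) = 0" for a b z m w
    using assms by (simp_all add: equivariant_def del: split_paired_All)
  show ?thesis
  proof (rule linear_op_eqI[where x = z])
    fix w :: word
    show "descend T (wrap m (gen w)) = wrap m (T (gen w))"
    proof (cases "length w < 2")
      case True
      then show ?thesis by (simp add: wrap_short short)
    next
      case False
      then obtain a x b where w: "w = a # x @ [b]" by (rule long_word_cases)
      let ?S = "\<Sum>u\<in>UNIV. \<Sum>v\<in>UNIV. T (gen (idem u # x @ [idem v]))"
      have "T (gen w) = T (lact a (ract b (\<Sum>u\<in>UNIV. \<Sum>v\<in>UNIV. gen (idem u # x @ [idem v]))))"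
      proof -
        have "ract b (\<Sum>v\<in>UNIV. gen (idem u # x @ [idem v])) = gen (idem u # x @ [b])" for u
          using ract_sum_idem[of b "idem u # x"] by simp
        then show ?thesis
          using lact_sum_idem[of a "x @ [b]"] by (simp add: w del: lact_gen ract_gen)
      qed
      also have "\<dots> = lact a (ract b ?S)"
        by (simp add: act linear_op_sum[OF lin] del: ract_simps lact_simps)
      finally have "wrap m (T (gen w)) = (case triple b m a of None \<Rightarrow> 0 | Some c \<Rightarrow> wrap c ?S)"
        by (simp only: wrap_act)
      also have "\<dots> = descend T (wrap m (gen w))"
        by (simp add: w wrap_gen descend_gen split: option.splits)
      finally show ?thesis ..
    qed
  qed (use lin in \<open>auto intro!: lin_intros intro: linear_op_compose\<close>)
qed

lemma descend_comp:
  assumes "equivariant S"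
  shows "descend S (descend T z) = descend (\<lambda>x. S (T x)) z"
proof (rule linear_op_eqI[where x = z])
  show "descend S (descend T (gen w)) = descend (\<lambda>x. S (T x)) (gen w)" for w
    by (cases w) (simp_all add: descend_Nil descend_gen descend_wrap[OF assms])
qed (auto intro!: lin_intros)

lemma descend_id: "[] \<notin> supp z \<Longrightarrow> descend (\<lambda>x. x) z = z"
proof (rule linear_op_eqI[where x = z])
  fix w assume "[] \<notin> supp z" "w \<in> supp z"
  then obtain m x where w: "w = m # x" by (cases w) auto
  have "descend (\<lambda>x. x) (gen w) = (\<Sum>u\<in>UNIV. \<Sum>v\<in>UNIV. if v = src m then (if u = tgt m then gen w else 0) else 0)"
    unfolding w descend_gen
    by (intro sum.cong refl) (auto simp: wrap_gen triple_idem)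
  then show "descend (\<lambda>x. x) (gen w) = gen w" by simp
qed (auto intro!: lin_intros)

lemma descend_add: "descend (\<lambda>x. S x + T x) z = descend S z + descend T z"
proof (rule linear_op_eqI[where x = z])
  show "descend (\<lambda>x. S x + T x) (gen w) = descend S (gen w) + descend T (gen w)" for w
    by (cases w) (simp_all add: descend_Nil descend_gen sum.distrib)
qed (auto intro!: lin_intros)

lemma descend_diff: "descend (\<lambda>x. S x - T x) z = descend S z - descend T z"
proof (rule linear_op_eqI[where x = z])
  show "descend (\<lambda>x. S x - T x) (gen w) = descend S (gen w) - descend T (gen w)" for w
    by (cases w) (simp_all add: descend_Nil descend_gen sum_subtractf)
qed (auto intro!: lin_intros)

lemma equivariant_bd: "equivariant bd"
  unfolding equivariant_def by (simp add: bd_lact bd_ract bd_word_short)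

lemma equivariant_phi: "equivariant phi"
  by (auto simp: equivariant_def phi_lact phi_ract wrap_short)

lemma equivariant_htp: "equivariant htp"
proof -
  have "wrap m (htp (gen w)) = 0" if "length w < 2" for m w
  proof (cases w)
    case (Cons a v)
    then show ?thesis using that by (simp add: htp_single)
  qed simp
  then show ?thesis by (auto simp: equivariant_def htp_lact htp_ract)
qed

section \<open>Differential, homotopy and projection on Hochschild chains\<close>

definition hoch :: "chain \<Rightarrow> chain" where "hoch = descend bd"
definition hhtp :: "chain \<Rightarrow> chain" where "hhtp = descend htp"
definition hphi :: "chain \<Rightarrow> chain" where "hphi = descend phi"

lemma linear_hoch [intro, simp]: "linear_op hoch"
  and linear_hhtp [intro, simp]: "linear_op hhtp"
  and linear_hphi [intro, simp]: "linear_op hphi"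
  by (simp_all add: hoch_def hhtp_def hphi_def)
lemmas linear_hoch_comp [lin_intros] = linear_op_compose[OF linear_hoch]
  and linear_hhtp_comp [lin_intros] = linear_op_compose[OF linear_hhtp]
  and linear_hphi_comp [lin_intros] = linear_op_compose[OF linear_hphi]
lemmas hoch_simps [simp] = linear_opD[OF linear_hoch] linear_op_sum[OF linear_hoch]
lemmas hhtp_simps [simp] = linear_opD[OF linear_hhtp] linear_op_sum[OF linear_hhtp]
lemmas hphi_simps [simp] = linear_opD[OF linear_hphi] linear_op_sum[OF linear_hphi]

lemma hoch_wrap: "hoch (wrap m z) = wrap m (bd z)"
  unfolding hoch_def by (rule descend_wrap) (rule equivariant_bd)

lemma hoch_hoch: "hoch (hoch z) = 0"
proof (rule linear_op_eqI[where x = z])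
  show "hoch (hoch (gen w)) = 0" for w
    unfolding hoch_def descend_comp[OF equivariant_bd] bd_bd by (cases w) (simp_all add: descend_Nil descend_gen)
qed (auto intro!: lin_intros)

lemma hphi_hoch: "hphi (hoch z) = hoch (hphi z)"
  unfolding hoch_def hphi_def descend_comp[OF equivariant_bd] descend_comp[OF equivariant_phi] phi_bd ..

text \<open>\<open>htp_homotopy\<close> descends term by term. The empty word is excluded since even
  the identity descends to zero on it.\<close>

lemma hoch_homotopy:
  assumes "[] \<notin> supp z"
  shows "z = hphi z + hoch (hhtp z) + hhtp (hoch z)"
proof -
  have "hoch (hhtp z) + hhtp (hoch z) = descend (\<lambda>x. bd (htp x) + htp (bd x)) z"
    unfolding hoch_def hhtp_def descend_comp[OF equivariant_bd] descend_comp[OF equivariant_htp] descend_add ..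
  also have "\<dots> = z - hphi z"
    unfolding htp_homotopy descend_diff hphi_def descend_id[OF assms] ..
  finally show ?thesis by (simp add: algebra_simps)
qed

text \<open>As \<open>wset\<close>, but with an integer degree, because graded pieces are indexed by
  integers.\<close>

definition words :: "nat \<Rightarrow> int \<Rightarrow> word set" where
  "words n d = {w. length w = n \<and> int (length (filter arrow w)) = d}"

lemma keys_wrap_wset:
  assumes "supp z \<subseteq> wset n d" "0 < n"
  shows "supp (wrap m z) \<subseteq> wset (n - 1) (d + (if arrow m then 1 else 0))"
proof (rule keys_linear_op[OF linear_wrap])
  fix w assume "w \<in> supp z"
  then have w: "length w = n" "length (filter arrow w) = d" using assms by (auto simp: wset_def)
  show "supp (wrap m (gen w)) \<subseteq> wset (n - 1) (d + (if arrow m then 1 else 0))"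
  proof (cases "length w < 2")
    case False
    then obtain a x b where *: "w = a # x @ [b]" by (rule long_word_cases)
    show ?thesis
    proof (cases "triple b m a")
      case None
      then show ?thesis by (simp add: * wrap_gen)
    next
      case (Some c)
      then have "(if arrow c then 1 else 0::nat) = (if arrow a then 1 else 0) + (if arrow b then 1 else 0) + (if arrow m then 1 else 0)"
        by (auto simp: triple_def bind_eq_Some_conv lmult_def split: if_splits)
      then have "length (filter arrow (c # x)) = d + (if arrow m then 1 else 0)" "length (c # x) = n - 1"
        using w by (simp_all add: * split: if_splits)
      moreover have "supp (wrap m (gen w)) = {c # x}"
        using Some by (simp add: * wrap_gen)
      ultimately show ?thesis by (simp add: wset_def)
    qed
  qed (simp add: wrap_short)
qed

text \<open>\<open>f\<close> records the effect of \<open>T\<close> on lengths. Trading the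
  coefficient \<open>m\<close> for two end letters lengthens the word by one, and
  \<open>wrap\<close> shortens the result by one; this accounts for
  \<open>f (Suc n) - 1\<close>.\<close>

lemma keys_descend:
  assumes "\<And>w. supp (T (gen w)) \<subseteq> wset (f (length w)) (length (filter arrow w))"
    and "0 < f (Suc n)"
    and "supp z \<subseteq> words n d"
  shows "supp (descend T z) \<subseteq> words (f (Suc n) - 1) d"
proof (rule keys_linear_op[OF linear_descend])
  fix w assume "w \<in> supp z"
  then have w: "length w = n" "int (length (filter arrow w)) = d" using assms by (auto simp: words_def)
  show "supp (descend T (gen w)) \<subseteq> words (f (Suc n) - 1) d"
  proof (cases w)
    case (Cons m x)
    have "supp (wrap m (T (gen (idem u # x @ [idem v])))) \<subseteq> words (f (Suc n) - 1) d" for u v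
    proof -
      have "supp (T (gen (idem u # x @ [idem v]))) \<subseteq> wset (f (Suc n)) (length (filter arrow x))"
        using assms(1)[of "idem u # x @ [idem v]"] w by (simp add: Cons)
      from keys_wrap_wset[OF this assms(2), of m] show ?thesis using w
        by (force simp: wset_def words_def Cons split: if_splits)
    qed
    then show ?thesis unfolding Cons descend_gen by (intro keys_sum_subset)
  qed (simp add: descend_Nil)
qed

lemma keys_hoch:
  "supp z \<subseteq> words (Suc n) d \<Longrightarrow> supp (hoch z) \<subseteq> words n d"
  unfolding hoch_def using keys_descend[of bd "\<lambda>n. n - 1" "Suc n" z d] keys_bd_word by simp

lemma keys_hhtp:
  "supp z \<subseteq> words n d \<Longrightarrow> supp (hhtp z) \<subseteq> words (Suc n) d"
  unfolding hhtp_def using keys_descend[of htp Suc n z d] keys_htp by simp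

text \<open>The boundary of the representing words of length two lies in the augmentation, on which
  \<open>wrap\<close> vanishes.\<close>

lemma hoch_short:
  assumes "supp z \<subseteq> words (Suc 0) d" shows "hoch z = 0"
proof (rule linear_op_eqI[where x = z])
  fix w assume "w \<in> supp z"
  then obtain m where w: "w = [m]" using assms by (auto simp: words_def length_Suc_conv)
  have "wrap m (bd_word [idem u, idem v]) = 0" for u v
    by (auto simp: wrap_short split: option.splits)
  then show "hoch (gen w) = 0"
    unfolding w hoch_def descend_gen by (simp del: bd_word.simps)
qed (auto intro!: lin_intros)

subsection \<open>Critical words\<close>

primrec arrows :: "3 \<Rightarrow> nat \<Rightarrow> word" where
  "arrows i 0 = []"
| "arrows i (Suc n) = (i, True) # arrows (i + 1) n"

lemma length_arrows [simp]: "length (arrows i n) = n"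
  and filter_arrows [simp]: "filter arrow (arrows i n) = arrows i n"
  by (induction n arbitrary: i) auto

lemma arrows_snoc: "arrows i (Suc n) = arrows i n @ [(i + of_nat n, True)]"
proof (induction n arbitrary: i)
  case (Suc n)
  have "arrows i (Suc (Suc n)) = (i, True) # arrows (i + 1) (Suc n)" by simp
  also have "\<dots> = (i, True) # arrows (i + 1) n @ [(i + 1 + of_nat n, True)]" unfolding Suc.IH ..
  finally show ?case by (simp add: add.assoc)
qed simp

text \<open>Every vertex of the 3-cycle has a single outgoing arrow, so the first letter and the
  length force all inner letters.\<close>

lemma good_arrows_iff:
  "good ((i, b) # x @ [idem j]) \<longleftrightarrow>
     x = arrows (tgt (i, b)) (length x) \<and> j = tgt (i, b) + of_nat (length x)"
proof (induction x arbitrary: i b)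
  case (Cons y x)
  obtain k c where y: "y = (k, c)" by (cases y)
  show ?case using Cons[of k c] by (auto simp: y tgt_def algebra_simps)
qed auto

text \<open>Among the representatives \<open>(u, x, v)\<close> of \<open>m # x\<close> only the one
  with \<open>u = tgt m\<close> and \<open>v = src m\<close> survives \<open>wrap m\<close>; the
  word is kept by \<open>hphi\<close> exactly if this representative is good.\<close>

definition critical :: "word \<Rightarrow> bool" where
  "critical w \<longleftrightarrow> w \<noteq> [] \<and> good (idem (tgt (hd w)) # tl w @ [idem (src (hd w))])"

lemma hphi_gen: "hphi (gen w) = (if critical w then gen w else 0)"
proof (cases w)
  case (Cons m x)
  have "hphi (gen w) = (\<Sum>u\<in>UNIV. \<Sum>v\<in>UNIV. if v = src m then (if u = tgt m then (if critical w then gen w else 0) else 0) else 0)"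
    unfolding Cons hphi_def descend_gen
    by (intro sum.cong refl) (auto simp: wrap_gen triple_idem critical_def)
  then show ?thesis by simp
qed (simp add: hphi_def descend_Nil critical_def)

lemma of_nat_3_eq_0_iff: "(of_nat n :: 3) = 0 \<longleftrightarrow> 3 dvd n"
proof -
  have "(of_nat n :: 3) = of_nat (n mod 3 + 3 * (n div 3))" by simp
  also have "\<dots> = of_nat (n mod 3) + of_nat 3 * of_nat (n div 3)"
    by (simp only: of_nat_add of_nat_mult)
  also have "(of_nat 3 :: 3) = 0" by simp
  also have "of_nat (n mod 3) + 0 * of_nat (n div 3) = (of_nat (n mod 3) :: 3)" by simp
  finally have "(of_nat n :: 3) = of_nat (n mod 3)" .
  moreover have "n mod 3 = 0 \<or> n mod 3 = 1 \<or> n mod 3 = 2" by linarith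
  ultimately show ?thesis by (auto simp: dvd_eq_mod_eq_0)
qed

text \<open>The critical words span a deformation retract of the Hochschild complex: the closed paths with a
  chosen starting point, either marked by an idempotent or by their first arrow.\<close>

definition cw0 :: "nat \<Rightarrow> 3 \<Rightarrow> word" where "cw0 n i = idem i # arrows i n"
definition cw1 :: "nat \<Rightarrow> 3 \<Rightarrow> word" where "cw1 n i = arrows i (Suc n)"

text \<open>Behind the first letter all letters are arrows, and the word closes up to a cycle. The
  number of arrows, \<open>n\<close> or \<open>Suc n\<close> according to the first letter, is
  therefore a multiple of three.\<close>

lemma critical_cases:
  assumes "critical w" "length w = Suc n" "int (length (filter arrow w)) = d"
  shows "(d = int n \<and> 3 dvd n \<and> w = cw0 n (src (hd w))) \<or> (d = int (Suc n) \<and> 3 dvd Suc n \<and> w = cw1 n (src (hd w)))"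
proof -
  obtain i b x where w: "w = (i, b) # x" using assms(1) by (cases w) (auto simp: critical_def)
  let ?j = "tgt (i, b)"
  have l: "length x = n" using assms by (simp add: w)
  have x: "x = arrows ?j n" and i: "i = ?j + of_nat n"
    using assms(1) good_arrows_iff[of ?j False x i] unfolding critical_def w l by auto
  have e: "filter arrow x = x" by (subst (1 2) x) (rule filter_arrows)
  have d: "d = (if b then 1 else 0) + int n" using assms(3) by (auto simp: w e l split: if_splits)
  show ?thesis
  proof (cases b)
    case True
    then have "i = i + (1 + of_nat n)" using i by (simp add: tgt_def add.assoc)
    then have "(of_nat (Suc n) :: 3) = 0" by simp
    then have "3 dvd Suc n" by (simp only: of_nat_3_eq_0_iff)
    moreover have "w = cw1 n (src (hd w))" using x True by (simp add: w cw1_def tgt_def)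
    ultimately show ?thesis using d True by simp
  next
    case False
    then have "i = i + of_nat n" using i by (simp add: tgt_def)
    then have "(of_nat n :: 3) = 0" by simp
    then have "3 dvd n" by (simp only: of_nat_3_eq_0_iff)
    moreover have "w = cw0 n (src (hd w))" using x False by (simp add: w cw0_def tgt_def)
    ultimately show ?thesis using d False by simp
  qed
qed

lemma critical_cw0: "3 dvd n \<Longrightarrow> critical (cw0 n i)"
  using good_arrows_iff[of i False "arrows i n" i]
  by (simp add: critical_def cw0_def of_nat_3_eq_0_iff[symmetric])

lemma critical_cw1: "3 dvd Suc n \<Longrightarrow> critical (cw1 n i)"
  using good_arrows_iff[of "i + 1" False "arrows (i + 1) n" i] of_nat_3_eq_0_iff[of "Suc n"]
  by (simp add: critical_def cw1_def tgt_def add.assoc del: of_nat_Suc) (simp add: add.commute)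

lemma cw0_in_words: "cw0 n i \<in> words (Suc n) (int n)"
  and cw1_in_words: "cw1 n i \<in> words (Suc n) (int (Suc n))"
  by (simp_all add: words_def cw0_def cw1_def)

lemma cw0_eq_iff [simp]: "cw0 n i = cw0 n j \<longleftrightarrow> i = j"
  and cw1_eq_iff [simp]: "cw1 n i = cw1 n j \<longleftrightarrow> i = j"
  by (auto simp: cw0_def cw1_def)

lemma lookup_hphi:
  "coef (hphi z) w = (if critical w then coef z w else 0)"
proof -
  have "coef (hphi z) w =
      (\<Sum>k\<in>supp z. coef z k * coef (hphi (gen k)) w)"
    by (subst linear_op_expand[OF linear_hphi]) (simp add: lookup_sum)
  also have "\<dots> = (\<Sum>k\<in>supp z. if k = w then if critical w then coef z w else 0 else 0)"
    by (rule sum.cong) (auto simp: hphi_gen lookup_single when_def)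
  also have "\<dots> = (if critical w then coef z w else 0)"
    by (auto simp: in_keys_iff)
  finally show ?thesis .
qed

text \<open>For given length and degree at most one of the two families of critical words
  occurs.\<close>

lemma hphi_eq:
  assumes "supp z \<subseteq> words (Suc n) d"
  shows "hphi z =
    (if d = int n \<and> 3 dvd n then \<Sum>i\<in>UNIV. scale (coef z (cw0 n i)) (gen (cw0 n i))
     else if d = int (Suc n) \<and> 3 dvd Suc n then \<Sum>i\<in>UNIV. scale (coef z (cw1 n i)) (gen (cw1 n i))
     else 0)" (is "_ = ?R")
proof -
  note l = lookup_hphi
  have s: "(\<Sum>i\<in>UNIV. coef z (c i) * coef (gen (c i)) w)
      = (if w \<in> range c then coef z w else 0)" if "inj c" for c :: "3 \<Rightarrow> word" and w
  proof (cases "w \<in> range c")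
    case True
    then obtain i where i: "w = c i" by auto
    have "(\<Sum>i\<in>UNIV. coef z (c i) * coef (gen (c i)) w)
      = (\<Sum>j\<in>UNIV. if j = i then coef z w else 0)"
      by (rule sum.cong) (use that in \<open>auto simp: i lookup_single when_def inj_eq\<close>)
    then show ?thesis using True by simp
  next
    case False
    then have "coef (gen (c i)) w = 0" for i by (auto simp: lookup_single when_def)
    then show ?thesis using False by simp
  qed
  have i0: "inj (cw0 n)" and i1: "inj (cw1 n)" by (auto simp: inj_def)
  show ?thesis
  proof (rule poly_mapping_eqI)
    fix w
    show "coef (hphi z) w = coef ?R w"
    proof (cases "w \<in> words (Suc n) d")
      case True
      show ?thesis
      proof (cases "critical w")
        case crit: True
        from critical_cases[OF crit, of n d] True
        have "(d = int n \<and> 3 dvd n \<and> w \<in> range (cw0 n)) \<or> (d = int (Suc n) \<and> 3 dvd Suc n \<and> w \<in> range (cw1 n))"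
          by (auto simp: words_def)
        then show ?thesis
          using s[OF i0, of w] s[OF i1, of w] by (auto simp: l crit lookup_sum)
      next
        case False
        then have "3 dvd n \<Longrightarrow> w \<notin> range (cw0 n)" "3 dvd Suc n \<Longrightarrow> w \<notin> range (cw1 n)"
          using critical_cw0 critical_cw1 by auto
        then show ?thesis
          using s[OF i0, of w] s[OF i1, of w] False by (auto simp: l lookup_sum)
      qed
    next
      case False
      then have "coef z w = 0" using assms by (meson in_keys_iff subsetD)
      then show ?thesis
        using s[OF i0, of w] s[OF i1, of w] by (simp add: l lookup_sum)
    qed
  qed
qed

text \<open>Faces that merge two arrows vanish; the last face, which absorbs the idempotent, is the
  only one left.\<close>

lemma bd_word_arrows_idem:
  "0 < n \<Longrightarrow> bd_word (arrows i n @ [idem (i + of_nat n)]) = scale ((-1) ^ (n - 1)) (gen (arrows i n))"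
proof (induction n arbitrary: i)
  case (Suc n)
  show ?case
  proof (cases n)
    case 0
    then show ?thesis by (simp add: lmult_idem_right tgt_def)
  next
    case (Suc k)
    have "lact (i, True) (gen (arrows (i + 1) n @ [idem (i + 1 + of_nat n)])) = 0"
      by (simp add: Suc lmult_def)
    moreover have "bd_word (arrows (i + 1) n @ [idem (i + 1 + of_nat n)])
        = scale ((-1) ^ k) (gen (arrows (i + 1) n))"
      using Suc.IH[of "i + 1"] Suc by simp
    ultimately show ?thesis by (simp add: Suc scale_uminus_left algebra_simps)
  qed
qed simp

text \<open>The first face makes the first arrow the coefficient, the last one moves the last arrow
  to the front. This arrow starts at \<open>i - 1\<close> because the path closes up at
  \<open>i\<close> after \<open>Suc n\<close> steps.\<close>

lemma hoch_cw0:
  assumes "3 dvd Suc n"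
  shows "hoch (gen (cw0 (Suc n) i)) = gen (cw1 n i) + scale ((-1) ^ Suc n) (gen (cw1 n (i - 1)))"
proof -
  have i: "i + of_nat (Suc n) = i" using assms by (simp only: of_nat_3_eq_0_iff[symmetric] add_0_right)
  have t: "triple (idem i) (idem i) (idem i) = Some (idem i)" by (simp add: triple_idem)
  have g: "gen (cw0 (Suc n) i) = wrap (idem i) (gen (idem i # arrows i (Suc n) @ [idem i]))"
    unfolding wrap_gen t by (simp add: cw0_def)
  have b: "bd_word (arrows i (Suc n) @ [idem i]) = scale ((-1) ^ n) (gen (arrows i (Suc n)))"
    using bd_word_arrows_idem[of "Suc n" i] unfolding i by simp
  have n: "i + of_nat n = i - 1"
    using i by (simp add: algebra_simps eq_diff_eq)
  have 1: "wrap (idem i) (gen (arrows i (Suc n) @ [idem i])) = gen (cw1 n i)"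
    using wrap_gen[of "idem i" "(i, True)" "arrows (i + 1) n" "idem i"]
    by (simp add: triple_def lmult_idem_left cw1_def)
  have 2: "wrap (idem i) (gen (idem i # arrows i (Suc n))) = gen (cw1 n (i - 1))"
  proof -
    have p: "arrows i (Suc n) = arrows i n @ [(i - 1, True)]"
      unfolding arrows_snoc n ..
    show ?thesis
      unfolding p wrap_gen by (simp add: triple_def lmult_idem_right tgt_def cw1_def)
  qed
  have "hoch (gen (cw0 (Suc n) i)) = wrap (idem i) (gen (arrows i (Suc n) @ [idem i]))
     - scale ((-1) ^ n) (wrap (idem i) (gen (idem i # arrows i (Suc n))))"
    unfolding g hoch_wrap bd_gen bd_word.simps(2)[of "idem i" "arrows i (Suc n) @ [idem i]"] b
    by (simp add: lmult_idem_left)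
  then show ?thesis unfolding 1 2 by (simp add: scale_uminus_left)
qed

subsection \<open>Hochschild homology of the words\<close>

lemma UNIV_three: "(UNIV :: 3 set) = {0, 1, 2}"
proof -
  have "card {0, 1, 2 :: 3} = CARD(3)" by simp
  then show ?thesis by (metis card_subset_eq finite_UNIV subset_UNIV finite)
qed

lemma three_eq_zero: "(3 :: 3) = 0" by simp

lemma two_add_one: "(2 :: 3) + 1 = 0" by simp

lemma sum_three: "(\<Sum>i\<in>UNIV. f (i :: 3)) = f 0 + f 1 + f 2"
  unfolding UNIV_three by (simp add: add.assoc)

lemma all_three: "(\<forall>i::3. P i) \<longleftrightarrow> P 0 \<and> P 1 \<and> P 2"
  using UNIV_three by (metis UNIV_I empty_iff insert_iff)

lemma sum_shift_three: "(\<Sum>i\<in>UNIV. f (i + 1 :: 3)) = (\<Sum>i\<in>UNIV. f i)"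
  unfolding sum_three by (simp add: three_eq_zero ac_simps)

definition hcycles :: "nat \<Rightarrow> int \<Rightarrow> chain set" where
  "hcycles n d = {z. supp z \<subseteq> words (Suc n) d \<and> hoch z = 0}"

definition hboundaries :: "nat \<Rightarrow> int \<Rightarrow> chain set" where
  "hboundaries n d = hoch ` {y. supp y \<subseteq> words (Suc (Suc n)) d}"

text \<open>A linear map whose kernel on cycles consists of the boundaries. For
  \<open>n mod 6 = 2\<close> the homology is the cokernel of \<open>1 - r\<close>, detected by the
  sum of the coefficients; for \<open>n mod 6 = 3\<close> it is the kernel of \<open>1 - r\<close>,
  the constant families, detected by one coefficient. Values on a line are repeated at all
  \<open>i\<close>, so that dimensions 0, 1 and 3 fit into one type.\<close>

definition hfun :: "nat \<Rightarrow> int \<Rightarrow> chain \<Rightarrow> 3 \<Rightarrow> complex" where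
  "hfun n d z i =
    (if n = 0 \<and> d = 0 then coef z (cw0 0 i)
     else if n mod 6 = 2 \<and> d = int (Suc n) then \<Sum>i\<in>UNIV. coef z (cw1 n i)
     else if n mod 6 = 3 \<and> d = int n then coef z (cw0 n 0)
     else 0)"

definition hval :: "nat \<Rightarrow> int \<Rightarrow> (3 \<Rightarrow> complex) set" where
  "hval n d =
    (if n = 0 \<and> d = 0 then UNIV
     else if (n mod 6 = 2 \<and> d = int (Suc n)) \<or> (n mod 6 = 3 \<and> d = int n) then range (\<lambda>c _. c)
     else {\<lambda>_. 0})"

lemma hfun_add: "hfun n d (x + y) = (\<lambda>i. hfun n d x i + hfun n d y i)"
  and hfun_scale: "hfun n d (scale c x) = (\<lambda>i. c * hfun n d x i)"
  by (auto simp: hfun_def fun_eq_iff lookup_add sum.distrib sum_distrib_left)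

lemma hboundaries_add: "x \<in> hboundaries n d \<Longrightarrow> y \<in> hboundaries n d \<Longrightarrow> x + y \<in> hboundaries n d"
proof -
  assume "x \<in> hboundaries n d" "y \<in> hboundaries n d"
  then obtain u v where "x = hoch u" "y = hoch v"
    "supp u \<subseteq> words (Suc (Suc n)) d" "supp v \<subseteq> words (Suc (Suc n)) d"
    by (auto simp: hboundaries_def)
  then show ?thesis unfolding hboundaries_def
    by (intro image_eqI[where x = "u + v"]) (simp_all add: keys_add_subset)
qed

lemma hboundaries_scale: "x \<in> hboundaries n d \<Longrightarrow> scale c x \<in> hboundaries n d"
proof -
  assume "x \<in> hboundaries n d"
  then obtain u where "x = hoch u" "supp u \<subseteq> words (Suc (Suc n)) d"
    by (auto simp: hboundaries_def)
  then show ?thesis unfolding hboundaries_def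
    by (intro image_eqI[where x = "scale c u"]) (simp_all add: keys_scale_subset)
qed

lemma hboundaries_subset: "hboundaries n d \<subseteq> hcycles n d"
  by (auto simp: hboundaries_def hcycles_def hoch_hoch dest: keys_hoch)

lemma zero_in_hboundaries: "0 \<in> hboundaries n d"
  unfolding hboundaries_def by (auto intro!: image_eqI[where x = 0])

lemma Nil_notin_words: "supp z \<subseteq> words (Suc n) d \<Longrightarrow> [] \<notin> supp z"
  by (auto simp: words_def)

lemma hcycle_decomp:
  assumes "z \<in> hcycles n d"
  shows "z - hphi z \<in> hboundaries n d"
proof -
  have "z = hphi z + hoch (hhtp z)"
    using hoch_homotopy[OF Nil_notin_words, of z n d] assms by (simp add: hcycles_def)
  then have "z - hphi z = hoch (hhtp z)" by (simp add: algebra_simps)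
  moreover have "supp (hhtp z) \<subseteq> words (Suc (Suc n)) d"
    using assms by (intro keys_hhtp) (simp add: hcycles_def)
  ultimately show ?thesis by (auto simp: hboundaries_def)
qed

text \<open>The second term of \<open>hoch_cw0\<close> lowers the vertex by one, so the word at
  \<open>i\<close> also receives the coefficient of \<open>i + 1\<close>.\<close>

lemma hoch_sum_cw0:
  assumes "3 dvd Suc n"
  shows "hoch (\<Sum>i\<in>UNIV. scale (c i) (gen (cw0 (Suc n) i))) =
    (\<Sum>i\<in>UNIV. scale (c i + (-1) ^ Suc n * c (i + 1)) (gen (cw1 n i)))"
proof -
  have "hoch (\<Sum>i\<in>UNIV. scale (c i) (gen (cw0 (Suc n) i))) =
      (\<Sum>i\<in>UNIV. scale (c i) (gen (cw1 n i)) + scale (c i * (-1) ^ Suc n) (gen (cw1 n (i - 1))))"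
    by (simp only: hoch_simps hoch_cw0[OF assms] scale_add scale_scale)
  also have "\<dots> = (\<Sum>i\<in>UNIV. scale (c i) (gen (cw1 n i)))
      + (\<Sum>i\<in>UNIV. scale (c (i + 1) * (-1) ^ Suc n) (gen (cw1 n i)))"
    unfolding sum.distrib
    using sum_shift_three[of "\<lambda>i. scale (c i * (-1) ^ Suc n) (gen (cw1 n (i - 1)))"]
    by (simp only: add_diff_cancel_right')
  finally show ?thesis by (simp only: scale_add_left sum.distrib mult.commute)
qed

lemma lookup_sum_cw:
  "coef (\<Sum>i\<in>UNIV. scale (c i) (gen (cw0 n i))) (cw0 n j) = c j"
  "coef (\<Sum>i\<in>UNIV. scale (c i) (gen (cw1 n i))) (cw1 n j) = c j"
proof -
  have "(\<Sum>i\<in>UNIV. c i * coef (gen (cw0 n i)) (cw0 n j)) = (\<Sum>i\<in>UNIV. if i = j then c j else 0)"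
    by (rule sum.cong) (auto simp: lookup_single when_def)
  then show "coef (\<Sum>i\<in>UNIV. scale (c i) (gen (cw0 n i))) (cw0 n j) = c j"
    by (simp add: lookup_sum)
  have "(\<Sum>i\<in>UNIV. c i * coef (gen (cw1 n i)) (cw1 n j)) = (\<Sum>i\<in>UNIV. if i = j then c j else 0)"
    by (rule sum.cong) (auto simp: lookup_single when_def)
  then show "coef (\<Sum>i\<in>UNIV. scale (c i) (gen (cw1 n i))) (cw1 n j) = c j"
    by (simp add: lookup_sum)
qed

lemma keys_sum_cw:
  "supp (\<Sum>i\<in>UNIV. scale (c i) (gen (cw0 n i))) \<subseteq> words (Suc n) (int n)"
  "supp (\<Sum>i\<in>UNIV. scale (c i) (gen (cw1 n i))) \<subseteq> words (Suc n) (int (Suc n))"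
  using cw0_in_words cw1_in_words by (intro keys_sum_subset keys_scale_subset; simp)+

text \<open>\<open>hfun\<close> reads coefficients at critical words only, so \<open>z\<close> may
  be replaced by \<open>hphi z\<close>, the boundary of \<open>hphi y\<close>. For
  \<open>n mod 6 = 2\<close> its coefficients are differences \<open>c i - c (i + 1)\<close>, whose
  sum is zero; in the other relevant cases \<open>y\<close> has no critical words for reasons of
  degree.\<close>

lemma hfun_boundary:
  assumes "z \<in> hboundaries n d" shows "hfun n d z = (\<lambda>_. 0)"
proof -
  obtain y where y: "supp y \<subseteq> words (Suc (Suc n)) d" "z = hoch y"
    using assms by (auto simp: hboundaries_def)
  have z: "hphi z = hoch (hphi y)" by (simp add: y hphi_hoch)
  have l: "coef z w = coef (hoch (hphi y)) w" if "critical w" for w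
    using that lookup_hphi[of z w] unfolding z by simp
  consider "n = 0" "d = 0" | "n mod 6 = 2" "d = int (Suc n)" | "n mod 6 = 3" "d = int n"
    | "\<not> (n = 0 \<and> d = 0)" "\<not> (n mod 6 = 2 \<and> d = int (Suc n))" "\<not> (n mod 6 = 3 \<and> d = int n)" by blast
  then show ?thesis
  proof cases
    case 1
    then have "hphi y = 0" using hphi_eq[OF y(1)] by simp
    then show ?thesis using 1 l[OF critical_cw0] by (simp add: hfun_def fun_eq_iff)
  next
    case 2
    then have dv: "3 dvd Suc n" and "even n" by presburger+
    define c where "c i = coef y (cw0 (Suc n) i)" for i
    have "hphi y = (\<Sum>i\<in>UNIV. scale (c i) (gen (cw0 (Suc n) i)))"
      using hphi_eq[OF y(1)] 2 dv by (simp add: c_def)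
    then have "coef z (cw1 n i) = c i - c (i + 1)" for i
      unfolding l[OF critical_cw1[OF dv]] \<open>hphi y = _\<close> hoch_sum_cw0[OF dv] lookup_sum_cw
      using \<open>even n\<close> by simp
    then show ?thesis using 2 sum_shift_three[of c] by (auto simp: hfun_def fun_eq_iff sum_subtractf)
  next
    case 3
    then have dv: "3 dvd n" by presburger
    have "hphi y = 0" using hphi_eq[OF y(1)] 3 by simp
    then show ?thesis using 3 l[OF critical_cw0[OF dv]] by (simp add: hfun_def fun_eq_iff)
  next
    case 4
    then show ?thesis by (auto simp: hfun_def fun_eq_iff)
  qed
qed

text \<open>Linear algebra on three coefficients: the families \<open>cw1\<close> require preimages
  under \<open>1 + r\<close> or \<open>1 - r\<close>, the families \<open>cw0\<close> the kernels of
  these maps.\<close>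

lemma hphi_boundary:
  assumes "z \<in> hcycles n d" "hfun n d z = (\<lambda>_. 0)"
  shows "hphi z \<in> hboundaries n d"
proof -
  have k: "supp z \<subseteq> words (Suc n) d" and h: "hoch (hphi z) = 0"
    using assms(1) by (auto simp: hcycles_def hphi_hoch[symmetric])
  define c0 where "c0 i = coef z (cw0 n i)" for i
  define c1 where "c1 i = coef z (cw1 n i)" for i
  \<comment> \<open>For the words \<open>cw1\<close> it suffices to solve a linear system for the
    coefficients \<open>k\<close> of a chain of words \<open>cw0\<close>.\<close>
  have b: "hphi z \<in> hboundaries n d"
    if "3 dvd Suc n" "d = int (Suc n)" "\<And>i. c1 i = k i + (-1) ^ Suc n * k (i + 1)" for k
  proof -
    have "hphi z = hoch (\<Sum>i\<in>UNIV. scale (k i) (gen (cw0 (Suc n) i)))"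
      unfolding hoch_sum_cw0[OF that(1)] that(3)[symmetric] using hphi_eq[OF k] that(1,2) by (simp add: c1_def)
    then show ?thesis unfolding hboundaries_def that(2) using keys_sum_cw(1)[of k "Suc n"] by blast
  qed
  have "3 dvd Suc n \<longleftrightarrow> n mod 6 = 2 \<or> n mod 6 = 5" "3 dvd n \<longleftrightarrow> n mod 6 = 0 \<or> n mod 6 = 3"
    by presburger+
  then consider "n = 0" "d = 0" | "n mod 6 = 2" "d = int (Suc n)" | "n mod 6 = 3" "d = int n"
    | "n mod 6 = 5" "d = int (Suc n)" | "n mod 6 = 0" "d = int n" "0 < n"
    | "\<not> (3 dvd Suc n \<and> d = int (Suc n))" "\<not> (3 dvd n \<and> d = int n)"
    by (cases "n = 0") auto
  then show ?thesis
  proof cases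
    case 1
    then have "c0 i = 0" for i using assms(2) by (simp add: hfun_def c0_def fun_eq_iff)
    then have "hphi z = 0" using hphi_eq[OF k] 1 by (simp add: c0_def)
    then show ?thesis using zero_in_hboundaries by simp
  next
    case 2
    then have dv: "3 dvd Suc n" and "even n" by presburger+
    have s: "c1 0 + c1 1 + c1 2 = 0"
      using assms(2) 2 by (auto simp: hfun_def fun_eq_iff c1_def sum_three)
    \<comment> \<open>Negated partial sums of \<open>c1\<close>, starting with 0; that the total is
      zero makes the equation hold at the last vertex as well.\<close>
    define k where "k i = (if i = 0 then 0 else if i = 1 then - c1 0 else - c1 0 - c1 1)" for i :: 3
    have "\<forall>i. c1 i = k i - k (i + 1)" unfolding all_three using s by (simp add: k_def three_eq_zero add_eq_0_iff)
    then show ?thesis using b[OF dv 2(2), of k] \<open>even n\<close> by simp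
  next
    case 3
    then obtain m where n: "n = Suc m" by (cases n) auto
    then have dv: "3 dvd Suc m" and "even m" using 3 by presburger+
    have "(\<Sum>i\<in>UNIV. scale (c0 i - c0 (i + 1)) (gen (cw1 m i))) = 0"
      using h hphi_eq[OF k] 3 dv hoch_sum_cw0[OF dv, of c0] \<open>even m\<close> by (simp add: c0_def n)
    then have e: "c0 i - c0 (i + 1) = 0" for i
      using lookup_sum_cw(2)[of "\<lambda>i. c0 i - c0 (i + 1)" m i] by simp
    \<comment> \<open>The kernel of \<open>1 - r\<close> consists of constant families, and
      \<open>hfun\<close> reads off the constant.\<close>
    have "c0 1 = c0 0" "c0 2 = c0 1"
      using e[of 0] e[of 1] by (simp_all only: add_0 one_add_one right_minus_eq)
    moreover have "c0 0 = hfun n d z 0" using 3 unfolding hfun_def c0_def by (cases "n = 0") simp_all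
    ultimately have "c0 0 = 0" "c0 1 = 0" "c0 2 = 0" unfolding assms(2) by metis+
    then have "\<forall>i. c0 i = 0" by (simp only: all_three)
    then have "hphi z = 0" using hphi_eq[OF k] 3 dv by (simp add: c0_def n)
    then show ?thesis using zero_in_hboundaries by simp
  next
    case 4
    then have dv: "3 dvd Suc n" and "odd n" by presburger+
    \<comment> \<open>The inverse of \<open>1 + r\<close> is \<open>(1 - r + r^2) / 2\<close>, since
      \<open>r^3 = 1\<close>.\<close>
    define k where "k i = (if i = 0 then c1 0 - c1 1 + c1 2 else if i = 1 then c1 0 + c1 1 - c1 2
      else c1 1 + c1 2 - c1 0) / 2" for i :: 3
    have "\<forall>i. c1 i = k i + k (i + 1)" unfolding all_three by (simp add: k_def three_eq_zero field_simps)
    then show ?thesis using b[OF dv 4(2), of k] \<open>odd n\<close> by simp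
  next
    case 5
    then obtain m where n: "n = Suc m" by (cases n) auto
    then have dv: "3 dvd Suc m" and "odd m" using 5 by presburger+
    have "(\<Sum>i\<in>UNIV. scale (c0 i + c0 (i + 1)) (gen (cw1 m i))) = 0"
      using h hphi_eq[OF k] 5 dv hoch_sum_cw0[OF dv, of c0] \<open>odd m\<close> by (simp add: c0_def n)
    then have e: "c0 i + c0 (i + 1) = 0" for i
      using lookup_sum_cw(2)[of "\<lambda>i. c0 i + c0 (i + 1)" m i] by simp
    have "c0 0 + c0 1 = 0" using e[of 0] by (simp only: add_0)
    moreover have "c0 1 + c0 2 = 0" using e[of 1] by (simp only: one_add_one)
    moreover have "c0 2 + c0 0 = 0" using e[of 2] by (simp only: two_add_one)
    \<comment> \<open>The identity \<open>(1 - r + r^2) (1 + r) = 2\<close> again, now giving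
      injectivity.\<close>
    moreover have "2 * c0 0 = (c0 0 + c0 1) - (c0 1 + c0 2) + (c0 2 + c0 0)"
      by (simp add: algebra_simps)
    ultimately have "c0 0 = 0" "c0 1 = 0" "c0 2 = 0"
      by (metis add_0 add_0_right diff_0_right mult_eq_0_iff zero_neq_numeral)+
    then have "\<forall>i. c0 i = 0" by (simp only: all_three)
    then have "hphi z = 0" using hphi_eq[OF k] 5 dv by (simp add: c0_def n)
    then show ?thesis using zero_in_hboundaries by simp
  next
    case 6
    then have "hphi z = 0" using hphi_eq[OF k] by auto
    then show ?thesis using zero_in_hboundaries by simp
  qed
qed

lemma hfun_eq_0_iff:
  assumes "z \<in> hcycles n d"
  shows "hfun n d z = (\<lambda>_. 0) \<longleftrightarrow> z \<in> hboundaries n d"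
proof
  assume "hfun n d z = (\<lambda>_. 0)"
  then have "(z - hphi z) + hphi z \<in> hboundaries n d"
    by (intro hboundaries_add hcycle_decomp hphi_boundary assms)
  then show "z \<in> hboundaries n d" by simp
qed (rule hfun_boundary)

text \<open>\<open>hphi\<close> fixes the word, hence also its boundary; but that boundary has
  length \<open>n\<close> and degree \<open>Suc n\<close>, where no word is critical.\<close>

lemma cw1_cycle: "0 < n \<Longrightarrow> 3 dvd Suc n \<Longrightarrow> gen (cw1 n i) \<in> hcycles n (int (Suc n))"
proof -
  assume "0 < n" "3 dvd Suc n"
  then obtain m where m: "n = Suc m" by (cases n) auto
  have "hphi (gen (cw1 n i)) = gen (cw1 n i)" using \<open>3 dvd Suc n\<close> by (simp add: hphi_gen critical_cw1)
  then have "hoch (gen (cw1 n i)) = hphi (hoch (gen (cw1 n i)))" by (simp add: hphi_hoch)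
  also have "\<dots> = 0"
    using hphi_eq[of "hoch (gen (cw1 n i))" m "int (Suc n)"] keys_hoch[of "gen (cw1 n i)" n "int (Suc n)"] cw1_in_words[of n i]
    by (simp add: m)
  finally show ?thesis using cw1_in_words by (simp add: hcycles_def)
qed

lemma hfun_image: "hfun n d ` hcycles n d = hval n d"
proof
  show "hfun n d ` hcycles n d \<subseteq> hval n d" by (auto simp: hfun_def[abs_def] hval_def)
  show "hval n d \<subseteq> hfun n d ` hcycles n d"
  proof
    fix f assume f: "f \<in> hval n d"
    consider "n = 0" "d = 0" | "n mod 6 = 2" "d = int (Suc n)" | "n mod 6 = 3" "d = int n"
      | "\<not> (n = 0 \<and> d = 0)" "\<not> (n mod 6 = 2 \<and> d = int (Suc n))" "\<not> (n mod 6 = 3 \<and> d = int n)" by blast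
    then have "\<exists>z\<in>hcycles n d. hfun n d z = f"
    proof cases
      case 1
      let ?z = "\<Sum>i\<in>UNIV. scale (f i) (gen (cw0 0 i))"
      have k: "supp ?z \<subseteq> words (Suc 0) 0" using keys_sum_cw(1)[of f 0] by simp
      then have "?z \<in> hcycles n d" using hoch_short[OF k] 1 by (simp add: hcycles_def)
      moreover have "hfun n d ?z = f" using 1 lookup_sum_cw(1)[of f 0] by (simp add: hfun_def fun_eq_iff)
      ultimately show ?thesis by blast
    next
      case 2
      then obtain c where c: "f = (\<lambda>_. c)" using f by (auto simp: hval_def)
      have "3 dvd Suc n" "0 < n" using 2 by presburger+
      then have "scale c (gen (cw1 n 0)) \<in> hcycles n d"
        using cw1_cycle[of n 0] 2 keys_scale_subset[of "gen (cw1 n 0)" "words (Suc n) d" c]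
        by (simp add: hcycles_def)
      moreover have "hfun n d (scale c (gen (cw1 n 0))) = f"
        using 2 by (auto simp: hfun_def c lookup_single when_def fun_eq_iff sum_three)
      ultimately show ?thesis by blast
    next
      case 3
      then obtain c where c: "f = (\<lambda>_. c)" using f 3 by (cases "n = 0") (auto simp: hval_def)
      obtain m where n: "n = Suc m" using 3 by (cases n) auto
      then have dv: "3 dvd Suc m" and "even m" using 3 by presburger+
      \<comment> \<open>The constant family spans the kernel of \<open>1 - r\<close>.\<close>
      let ?z = "\<Sum>i\<in>UNIV. scale c (gen (cw0 n i))"
      have "?z \<in> hcycles n d"
        using keys_sum_cw(1)[of "\<lambda>_. c" n] hoch_sum_cw0[OF dv, of "\<lambda>_. c"] 3 \<open>even m\<close>
        by (simp add: hcycles_def n)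
      moreover have "hfun n d ?z = f"
        using 3 lookup_sum_cw(1)[of "\<lambda>_. c" n 0] by (auto simp: hfun_def c fun_eq_iff)
      ultimately show ?thesis by blast
    next
      case 4
      then have "f = (\<lambda>_. 0)" using f by (auto simp: hval_def split: if_splits)
      moreover have "hfun n d 0 = (\<lambda>_. 0)" using 4 by (auto simp: hfun_def fun_eq_iff)
      moreover have "0 \<in> hcycles n d" by (simp add: hcycles_def)
      ultimately show ?thesis by blast
    qed
    then show "f \<in> hfun n d ` hcycles n d" by blast
  qed
qed

subsection \<open>The Connes differential on words\<close>

text \<open>\<open>rotr\<close> is the signed cyclic operator \<open>t\<close> and \<open>rotl\<close> its inverse, so that the Connes differential is
  \<open>(1 - t) s N\<close> with \<open>s\<close> = \<open>unit_pre\<close> and \<open>N\<close> = \<open>nrm\<close>.\<close>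

definition rotl :: "chain \<Rightarrow> chain" where
  "rotl = lin_ext (\<lambda>w. scale ((-1) ^ (length w - 1)) (gen (rotate1 w)))"

definition rotr :: "chain \<Rightarrow> chain" where
  "rotr = lin_ext (\<lambda>w. if w = [] then gen [] else scale ((-1) ^ (length w - 1)) (gen (last w # butlast w)))"

text \<open>All other faces are conjugates of this one by rotations, see \<open>rotated_face\<close>
  and \<open>hoch_rot\<close>.\<close>

definition face0 :: "chain \<Rightarrow> chain" where
  "face0 = lin_ext (\<lambda>w. case w of x # y # v \<Rightarrow> opt_chain (map_option (\<lambda>z. z # v) (lmult x y)) | _ \<Rightarrow> 0)"

definition nrm :: "chain \<Rightarrow> chain" where
  "nrm = lin_ext (\<lambda>w. \<Sum>i<length w. (rotl ^^ i) (gen w))"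

definition unit_pre :: "chain \<Rightarrow> chain" where
  "unit_pre z = (\<Sum>u\<in>UNIV. pre (idem u) z)"

definition connes :: "chain \<Rightarrow> chain" where
  "connes z = unit_pre (nrm z) - rotr (unit_pre (nrm z))"

lemma linear_rotl [intro, simp]: "linear_op rotl"
  and linear_rotr [intro, simp]: "linear_op rotr"
  and linear_face0 [intro, simp]: "linear_op face0"
  and linear_nrm [intro, simp]: "linear_op nrm"
  by (simp_all add: rotl_def rotr_def face0_def nrm_def)

lemmas linear_rotl_comp [lin_intros] = linear_op_compose[OF linear_rotl]
  and linear_rotr_comp [lin_intros] = linear_op_compose[OF linear_rotr]
  and linear_face0_comp [lin_intros] = linear_op_compose[OF linear_face0]
  and linear_nrm_comp [lin_intros] = linear_op_compose[OF linear_nrm]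
lemmas rotl_simps [simp] = linear_opD[OF linear_rotl] linear_op_sum[OF linear_rotl]
lemmas rotr_simps [simp] = linear_opD[OF linear_rotr] linear_op_sum[OF linear_rotr]
lemmas face0_simps [simp] = linear_opD[OF linear_face0] linear_op_sum[OF linear_face0]
lemmas nrm_simps [simp] = linear_opD[OF linear_nrm] linear_op_sum[OF linear_nrm]

lemma linear_unit_pre [intro, simp]: "linear_op unit_pre"
  unfolding unit_pre_def by (intro lin_intros)
lemmas linear_unit_pre_comp [lin_intros] = linear_op_compose[OF linear_unit_pre]
lemmas unit_pre_simps [simp] = linear_opD[OF linear_unit_pre] linear_op_sum[OF linear_unit_pre]

lemma linear_connes [intro, simp]: "linear_op connes"
  unfolding connes_def by (intro lin_intros)
lemmas connes_simps [simp] = linear_opD[OF linear_connes] linear_op_sum[OF linear_connes]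

lemma linear_rotl_pow [simp, intro]: "linear_op (rotl ^^ i)"
  and linear_rotr_pow [simp, intro]: "linear_op (rotr ^^ i)"
  by (intro lin_intros linear_rotl linear_rotr)+
lemmas linear_rotl_pow_comp [lin_intros] = linear_op_compose[OF linear_rotl_pow]
  and linear_rotr_pow_comp [lin_intros] = linear_op_compose[OF linear_rotr_pow]
lemmas rotl_pow_simps [simp] = linear_opD[OF linear_rotl_pow] linear_op_sum[OF linear_rotl_pow]
lemmas rotr_pow_simps [simp] = linear_opD[OF linear_rotr_pow] linear_op_sum[OF linear_rotr_pow]

lemma rotl_gen: "rotl (gen w) = scale ((-1) ^ (length w - 1)) (gen (rotate1 w))"
  and rotr_gen: "rotr (gen (v @ [x])) = scale ((-1) ^ length v) (gen (x # v))"
  and rotr_Nil: "rotr (gen []) = gen []"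
  and nrm_gen: "nrm (gen w) = (\<Sum>i<length w. (rotl ^^ i) (gen w))"
  and face0_gen: "face0 (gen (x # y # v)) = opt_chain (map_option (\<lambda>z. z # v) (lmult x y))"
  by (simp_all add: rotl_def rotr_def nrm_def face0_def)

lemma face0_short: "length w < 2 \<Longrightarrow> face0 (gen w) = 0"
  by (auto simp: face0_def split: list.splits)

lemma rotr_rotl [simp]: "rotr (rotl z) = z"
proof (rule linear_op_eqI[where x = z])
  show "rotr (rotl (gen w)) = gen w" for w
    by (cases w) (simp_all add: rotl_gen rotr_gen rotr_Nil)
qed (auto intro!: lin_intros)

lemma rotl_rotr [simp]: "rotl (rotr z) = z"
proof (rule linear_op_eqI[where x = z])
  show "rotl (rotr (gen w)) = gen w" for w
    by (cases w rule: rev_cases) (simp_all add: rotl_gen rotr_gen rotr_Nil)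
qed (auto intro!: lin_intros)

lemma rotr_pow_rotl_pow [simp]: "(rotr ^^ i) ((rotl ^^ i) z) = z"
  by (induction i arbitrary: z) (simp_all add: funpow_swap1)

lemma rotl_pow_gen: "(rotl ^^ i) (gen w) = scale ((-1) ^ ((length w - 1) * i)) (gen (rotate i w))"
  by (induction i) (simp_all add: rotl_gen power_add mult.commute)

lemma rotr_pow_gen: "(rotr ^^ length u) (gen (v @ u)) = scale ((-1) ^ ((length u + length v - 1) * length u)) (gen (u @ v))"
proof -
  have "(rotl ^^ length u) (gen (u @ v))
      = scale ((-1) ^ ((length u + length v - 1) * length u)) (gen (v @ u))"
    by (simp add: rotl_pow_gen rotate_append)
  then have "gen (u @ v) = (rotr ^^ length u) (scale ((-1) ^ ((length u + length v - 1) * length u)) (gen (v @ u)))"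
    using rotr_pow_rotl_pow by metis
  then show ?thesis by simp
qed

section \<open>Rotations of chains of a fixed length\<close>

definition of_length :: "nat \<Rightarrow> chain \<Rightarrow> bool" where
  "of_length L z \<longleftrightarrow> supp z \<subseteq> {w. length w = L}"

lemma of_length_linear:
  assumes "linear_op T" "of_length L z" "\<And>w. length w = L \<Longrightarrow> of_length M (T (gen w))"
  shows "of_length M (T z)"
  unfolding of_length_def
  by (rule keys_linear_op[OF assms(1)]) (use assms(2,3) in \<open>auto simp: of_length_def\<close>)

lemma of_length_scale_gen: "length w = L \<Longrightarrow> of_length L (scale c (gen w))"
  unfolding of_length_def by (rule keys_scale_subset) simp

lemma of_length_gen: "of_length (length w) (gen w)"
  by (simp add: of_length_def)

lemma of_length_rotl_pow: "of_length L z \<Longrightarrow> of_length L ((rotl ^^ i) z)"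
  by (rule of_length_linear[OF linear_rotl_pow]) (auto simp: rotl_pow_gen intro: of_length_scale_gen)

lemma of_length_rotr: "of_length L z \<Longrightarrow> of_length L (rotr z)"
proof (rule of_length_linear[OF linear_rotr])
  show "of_length L (rotr (gen w))" if "length w = L" for w
    using that by (cases w rule: rev_cases) (auto simp: rotr_gen rotr_Nil intro: of_length_scale_gen, simp add: of_length_def)
qed auto

lemma of_length_sum: "(\<And>a. a \<in> A \<Longrightarrow> of_length L (f a)) \<Longrightarrow> of_length L (\<Sum>a\<in>A. f a)"
  unfolding of_length_def by (rule keys_sum_subset)

lemma of_length_nrm: "of_length L z \<Longrightarrow> of_length L (nrm z)"
  by (rule of_length_linear[OF linear_nrm]) (auto simp: nrm_gen of_length_gen intro!: of_length_sum of_length_rotl_pow)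

lemma of_length_face0: "of_length (Suc L) z \<Longrightarrow> of_length L (face0 z)"
proof (rule of_length_linear[OF linear_face0])
  show "of_length L (face0 (gen w))" if "length w = Suc L" for w
    using that
    by (cases w rule: good.cases) (auto simp: face0_def of_length_def split: option.splits)
qed auto

text \<open>The signs of a full turn multiply to 1, their total exponent being a product of two
  consecutive integers.\<close>

lemma rotl_pow_full: "of_length L z \<Longrightarrow> (rotl ^^ L) z = z"
proof (rule linear_op_eqI[where x = z])
  fix w assume "of_length L z" "w \<in> supp z"
  then have L: "L = length w" by (auto simp: of_length_def)
  have "even ((length w - 1) * length w)" by (cases "length w") auto
  then show "(rotl ^^ L) (gen w) = gen w" by (simp add: rotl_pow_gen L)
qed (auto intro!: lin_intros)

lemma rotr_pow_full: "of_length L z \<Longrightarrow> (rotr ^^ L) z = z"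
  by (metis rotl_pow_full rotr_pow_rotl_pow)

subsection \<open>The differentials in terms of rotations\<close>

definition mface :: "nat \<Rightarrow> word \<Rightarrow> chain" where
  "mface i w = opt_chain (map_option (\<lambda>z. take i w @ z # drop (i + 2) w) (lmult (w ! i) (w ! Suc i)))"

lemma bd_word_mface: "bd_word w = (\<Sum>i<length w - 1. scale ((-1) ^ i) (mface i w))"
proof (induction w)
  case (Cons x w)
  show ?case
  proof (cases w)
    case (Cons y v)
    have s: "mface (Suc i) (x # w) = pre x (mface i w)" for i
      by (auto simp: mface_def split: option.splits)
    have "(\<Sum>i<length (x # w) - 1. scale ((-1) ^ i) (mface i (x # w)))
        = mface 0 (x # w) + (\<Sum>i<length v. scale ((-1) ^ Suc i) (mface (Suc i) (x # w)))"
      by (simp only: Cons length_Cons diff_Suc_1 sum.lessThan_Suc_shift) simp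
    also have "\<dots> = lact x (gen w) - pre x (bd_word w)"
      unfolding s Cons.IH by (simp add: Cons mface_def scale_uminus_left sum_negf)
    finally show ?thesis by simp
  qed simp
qed simp

text \<open>Letter \<open>i\<close> is rotated to the front, merged with its successor and rotated
  back, now in a word shorter by one. With \<open>L\<close> the length of \<open>w\<close>, the two
  rotations contribute the sign exponents \<open>(L - 1) i\<close> and \<open>(L - 2) i\<close>,
  whose sum has the parity of \<open>i\<close>.\<close>

lemma rotated_face:
  assumes "i < length w - 1"
  shows "(rotr ^^ i) (face0 ((rotl ^^ i) (gen w))) = scale ((-1) ^ i) (mface i w)"
proof -
  let ?x = "w ! i" and ?y = "w ! Suc i" and ?u = "take i w" and ?v = "drop (i + 2) w"
  have w: "w = ?u @ ?x # ?y # ?v"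
    using assms by (metis Cons_nth_drop_Suc Suc_lessD add_2_eq_Suc' id_take_nth_drop less_diff_conv Suc_eq_plus1)
  have r: "rotate i w = ?x # ?y # ?v @ ?u"
  proof -
    have "rotate i w = drop (i mod length w) w @ take (i mod length w) w" by (rule rotate_drop_take)
    also have "\<dots> = drop i w @ take i w" using assms by simp
    finally show ?thesis using assms
      by (metis Cons_nth_drop_Suc Suc_lessD add_2_eq_Suc' append_Cons less_diff_conv Suc_eq_plus1)
  qed
  show ?thesis
  proof (cases "lmult ?x ?y")
    case None
    then show ?thesis by (simp add: rotl_pow_gen r face0_gen mface_def)
  next
    case (Some z)
    have l: "length ?u = i" "length (z # ?v) = length w - i - 1" using assms by auto
    have "(rotr ^^ i) (gen ((z # ?v) @ ?u)) = scale ((-1) ^ ((length w - 2) * i)) (gen (?u @ z # ?v))"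
      using rotr_pow_gen[of ?u "z # ?v"] assms unfolding l by (simp add: numeral_2_eq_2)
    moreover have "(-1 :: complex) ^ ((length w - 1) * i) * (-1) ^ ((length w - 2) * i) = (-1) ^ i"
    proof -
      have "i + 2 \<le> length w" using assms by simp
      then obtain k where "length w = i + 2 + k" using le_Suc_ex by blast
      then have "(length w - 1) * i + (length w - 2) * i = 2 * ((i + k) * i) + i"
        by (simp add: algebra_simps)
      then show ?thesis by (simp flip: power_add) (simp add: power_add power_mult)
    qed
    ultimately show ?thesis
      by (simp add: rotl_pow_gen r face0_gen mface_def Some)
  qed
qed

lemma bd_rot:
  assumes "of_length L z"
  shows "bd z = (\<Sum>i<L - 1. (rotr ^^ i) (face0 ((rotl ^^ i) z)))"
proof (rule linear_op_eqI[where x = z])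
  fix w assume "w \<in> supp z"
  then have "length w = L" using assms by (auto simp: of_length_def)
  then show "bd (gen w) = (\<Sum>i<L - 1. (rotr ^^ i) (face0 ((rotl ^^ i) (gen w))))"
    by (simp add: bd_word_mface rotated_face)
qed (auto intro!: lin_intros)

section \<open>The cyclic operator and the two differentials\<close>

definition post :: "letter \<Rightarrow> chain \<Rightarrow> chain" where
  "post y = lin_ext (\<lambda>w. gen (w @ [y]))"

lemma linear_post [intro, simp]: "linear_op (post y)" by (simp add: post_def)
lemmas linear_post_comp [lin_intros] = linear_op_compose[OF linear_post]
lemmas post_simps [simp] = linear_opD[OF linear_post] linear_op_sum[OF linear_post]
lemma post_gen [simp]: "post y (gen w) = gen (w @ [y])" by (simp add: post_def)

lemma pre_post: "pre x (post y z) = post y (pre x z)"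
  by (rule linear_op_eqI[where x = z]) (auto intro!: lin_intros)

text \<open>Compared with \<open>bd_word x\<close> there is one new face, which merges
  \<open>y\<close> with the last letter of \<open>x\<close>.\<close>

lemma bd_word_snoc:
  "x \<noteq> [] \<Longrightarrow> bd_word (x @ [y]) = post y (bd_word x) + scale ((-1) ^ (length x - 1)) (ract y (gen x))"
proof (induction x)
  case (Cons a x)
  show ?case
  proof (cases "x = []")
    case True
    then show ?thesis by (simp add: ract_single)
  next
    case False
    have "lact a (gen (x @ [y])) = post y (lact a (gen x))"
      using False by (cases x) (auto split: option.splits)
    moreover have "ract y (gen (a # x)) = pre a (ract y (gen x))"
      using ract_pre[of "gen x" y a] False by simp
    moreover have "(-1 :: complex) ^ length x = - ((-1) ^ (length x - 1))"
      using False by (cases x) auto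
    ultimately show ?thesis using Cons.IH[OF False]
      by (simp add: pre_post scale_uminus_left)
  qed
qed simp

text \<open>The usual \<open>b = b' + (last cyclic face)\<close>, with \<open>bd\<close> as
  \<open>b'\<close>; the sign of the cyclic face is contained in \<open>rotr\<close>.\<close>

lemma hoch_rot:
  assumes "[] \<notin> supp z"
  shows "hoch z = bd z + face0 (rotr z)"
proof (rule linear_op_eqI[where x = z])
  fix w assume "w \<in> supp z"
  then obtain m x where w: "w = m # x" using assms by (cases w) auto
  show "hoch (gen w) = bd (gen w) + face0 (rotr (gen w))"
  proof (cases "x = []")
    case True
    have "hoch (gen w) = 0"
      by (rule hoch_short[of _ "if arrow m then 1 else 0"]) (simp add: words_def w True)
    then show ?thesis using rotr_gen[of "[]" m] by (simp add: w True face0_short)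
  next
    case False
    let ?e = "idem (tgt m)" and ?e' = "idem (src m)"
    have g: "gen w = wrap m (gen (?e # x @ [?e']))"
      by (simp add: wrap_gen triple_idem w)
    have 1: "wrap m (lact ?e (gen (x @ [?e']))) = lact m (gen x)"
    proof -
      obtain a v where x: "x = a # v" using False by (cases x) auto
      have "triple ?e' m a = lmult m a" by (simp add: triple_def lmult_idem_left)
      then show ?thesis
        by (cases "src a = tgt m") (simp_all add: x lmult_idem_left wrap_gen, simp add: lmult_def)
    qed
    have 2: "wrap m (pre ?e (post ?e' y)) = pre m y" for y
      by (rule linear_op_eqI[where x = y]) (auto simp: wrap_gen triple_idem intro!: lin_intros)
    have 3: "wrap m (pre ?e (ract ?e' (gen x))) = scale ((-1) ^ length x) (face0 (rotr (gen w)))"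
    proof -
      obtain v y where x: "x = v @ [y]" using False by (metis rev_exhaust)
      have "triple y m ?e = lmult y m" by (auto simp: triple_def lmult_idem_right split: bind_splits dest: lmult_SomeD)
      then show ?thesis using rotr_gen[of "m # v" y]
        by (cases "tgt y = src m")
          (simp_all add: x w lmult_idem_right wrap_gen face0_gen, simp add: lmult_def)
    qed
    have s: "(-1 :: complex) ^ length x = - ((-1) ^ (length x - 1))"
      using False by (cases x) auto
    have "hoch (gen w) = lact m (gen x) - pre m (bd_word x)
        - scale ((-1) ^ (length x - 1)) (wrap m (pre ?e (ract ?e' (gen x))))"
      unfolding g hoch_wrap bd_gen bd_word.simps bd_word_snoc[OF False]
      by (simp add: 1 2 del: lact_gen)
    then show ?thesis unfolding 3 by (simp add: w s scale_uminus_left)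
  qed
qed (auto intro!: lin_intros)

lemma rotl_rotl_pow_comm: "rotl ((rotl ^^ i) z) = (rotl ^^ i) (rotl z)"
  by (induction i) simp_all

lemma face0_of_length: "of_length L z \<Longrightarrow> L < 2 \<Longrightarrow> face0 z = 0"
proof (rule linear_op_eqI[where x = z and T = "\<lambda>_. 0"])
  show "face0 (gen w) = 0" if "of_length L z" "L < 2" "w \<in> supp z" for w
    using that by (intro face0_short) (auto simp: of_length_def)
qed auto

text \<open>The identity \<open>b (1 - t) = (1 - t) b'\<close> of the cyclic bicomplex. The sums for
  \<open>rotr (bd z)\<close> and \<open>bd (rotr z)\<close> share the conjugated faces
  \<open>H i\<close> for \<open>i < k\<close>, and the cyclic faces supply the rest.\<close>

lemma bd_rotr:
  assumes "of_length L z" "0 < L"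
  shows "hoch z - hoch (rotr z) = bd z - rotr (bd z)"
proof -
  have ne: "[] \<notin> supp y" if "of_length L y" for y
    using that assms(2) by (auto simp: of_length_def)
  have z': "of_length L (rotr z)" using assms by (intro of_length_rotr)
  show ?thesis
  proof (cases "L = 1")
    case True
    have s: "face0 y = 0" "bd y = 0" if "of_length L y" for y
    proof -
      show "face0 y = 0" by (rule face0_of_length[OF that]) (simp add: True)
      show "bd y = 0" using bd_rot[OF that] by (simp add: True)
    qed
    show ?thesis
      unfolding hoch_rot[OF ne[OF assms(1)]] hoch_rot[OF ne[OF z']]
      using s assms(1) z' of_length_rotr by simp
  next
    case False
    then obtain k where L: "L = Suc (Suc k)" using assms(2) not0_implies_Suc[of "L - 1"] by (cases L) auto
    define H where "H i = (rotr ^^ Suc i) (face0 ((rotl ^^ i) z))" for i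
    have b: "rotr (bd z) = (\<Sum>i<Suc k. H i)"
      unfolding bd_rot[OF assms(1)] L H_def by simp
    have "bd (rotr z) = face0 (rotr z) + (\<Sum>i<k. (rotr ^^ Suc i) (face0 ((rotl ^^ Suc i) (rotr z))))"
      unfolding bd_rot[OF z'] L diff_Suc_1 sum.lessThan_Suc_shift by simp
    also have "(\<Sum>i<k. (rotr ^^ Suc i) (face0 ((rotl ^^ Suc i) (rotr z)))) = (\<Sum>i<k. H i)"
      by (rule sum.cong) (simp_all add: H_def funpow_Suc_right del: funpow.simps)
    finally have b': "bd (rotr z) = face0 (rotr z) + (\<Sum>i<k. H i)" .
    \<comment> \<open>\<open>face0\<close> leaves length \<open>Suc k\<close>, on which
      \<open>rotr ^^ Suc k\<close> is a full turn.\<close>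
    have "H k = face0 ((rotl ^^ k) z)"
      unfolding H_def
      by (rule rotr_pow_full) (intro of_length_face0 of_length_rotl_pow, use assms L in simp)
    also have "(rotl ^^ k) z = rotr (rotr z)"
    proof -
      have "rotr (rotr ((rotl ^^ Suc (Suc k)) z)) = rotr (rotr z)"
        using rotl_pow_full[OF assms(1)] L by simp
      then show ?thesis by simp
    qed
    finally have h: "H k = face0 (rotr (rotr z))" .
    show ?thesis
      unfolding hoch_rot[OF ne[OF assms(1)]] hoch_rot[OF ne[OF z']] b b' sum.lessThan_Suc h
      by simp
  qed
qed

section \<open>The norm operator and the construction of B\<close>

lemma rotr_eq_rotl_pow:
  assumes "of_length (Suc M) z" shows "rotr z = (rotl ^^ M) z"
proof -
  have "rotr ((rotl ^^ Suc M) z) = (rotl ^^ M) z" by simp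
  then show ?thesis unfolding rotl_pow_full[OF assms] .
qed

lemma nrm_eq: "of_length L z \<Longrightarrow> nrm z = (\<Sum>i<L. (rotl ^^ i) z)"
proof (rule linear_op_eqI[where x = z])
  fix w assume "of_length L z" "w \<in> supp z"
  then show "nrm (gen w) = (\<Sum>i<L. (rotl ^^ i) (gen w))" by (auto simp: of_length_def nrm_gen)
qed (auto intro!: lin_intros)

lemma nrm_rotl: "of_length L z \<Longrightarrow> nrm (rotl z) = nrm z"
proof -
  assume z: "of_length L z"
  have z': "of_length L (rotl z)" using of_length_rotl_pow[OF z, of 1] by simp
  have "(\<Sum>i<L. (rotl ^^ Suc i) z) + z = (\<Sum>i<L. (rotl ^^ i) z) + (rotl ^^ L) z"
    using sum.lessThan_Suc_shift[of "\<lambda>i. (rotl ^^ i) z" L] by (simp add: add.commute)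
  then show ?thesis
    unfolding nrm_eq[OF z] nrm_eq[OF z'] rotl_pow_full[OF z]
    by (simp add: funpow_Suc_right del: funpow.simps)
qed

lemma rotl_nrm: "of_length L z \<Longrightarrow> rotl (nrm z) = nrm z"
proof -
  assume z: "of_length L z"
  have z': "of_length L (rotl z)" using of_length_rotl_pow[OF z, of 1] by simp
  have "rotl (nrm z) = nrm (rotl z)"
    unfolding nrm_eq[OF z] nrm_eq[OF z'] by (simp add: rotl_rotl_pow_comm)
  then show ?thesis using nrm_rotl[OF z] by simp
qed

lemma rotl_pow_nrm: "of_length L z \<Longrightarrow> (rotl ^^ i) (nrm z) = nrm z"
  by (induction i) (simp_all add: rotl_nrm)

lemma rotr_nrm: "of_length L z \<Longrightarrow> rotr (nrm z) = nrm z"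
  using rotl_nrm by (metis rotr_rotl)

lemma nrm_rotr: "of_length L z \<Longrightarrow> nrm (rotr z) = nrm z"
  using nrm_rotl[of L "rotr z"] of_length_rotr[of L z] by simp

lemma of_length_rotr_pow: "of_length L z \<Longrightarrow> of_length L ((rotr ^^ i) z)"
  by (induction i) (simp_all add: of_length_rotr)

lemma nrm_rotr_pow: "of_length L z \<Longrightarrow> nrm ((rotr ^^ i) z) = nrm z"
  by (induction i) (simp_all add: nrm_rotr[OF of_length_rotr_pow])

lemma nrm_eq_rotr: "of_length L z \<Longrightarrow> nrm z = (\<Sum>i<L. (rotr ^^ i) z)"
proof -
  assume z: "of_length L z"
  have "(\<Sum>i<L. (rotr ^^ i) z) = (\<Sum>i<L. (rotr ^^ (L - Suc i)) z)"
    by (rule sum.nat_diff_reindex[symmetric])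
  also have "\<dots> = (\<Sum>i<L. (rotl ^^ Suc i) z)"
  proof (rule sum.cong)
    fix i assume "i \<in> {..<L}"
    then have L: "L = (L - Suc i) + Suc i" by simp
    have "(rotl ^^ (L - Suc i)) ((rotl ^^ Suc i) z) = (rotl ^^ (L - Suc i + Suc i)) z"
      unfolding funpow_add comp_apply ..
    also have "\<dots> = z" unfolding L[symmetric] by (rule rotl_pow_full[OF z])
    finally have "(rotr ^^ (L - Suc i)) z = (rotr ^^ (L - Suc i)) ((rotl ^^ (L - Suc i)) ((rotl ^^ Suc i) z))"
      by (simp only:)
    then show "(rotr ^^ (L - Suc i)) z = (rotl ^^ Suc i) z"
      unfolding rotr_pow_rotl_pow .
  qed simp
  also have "\<dots> = nrm (rotl z)"
    using nrm_eq[of L "rotl z"] of_length_rotl_pow[OF z, of 1]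
    by (simp add: funpow_Suc_right del: funpow.simps)
  finally show ?thesis using nrm_rotl[OF z] by simp
qed

text \<open>The identity \<open>b' N = N b\<close>. All faces of \<open>hoch z\<close>, including
  the cyclic one, are conjugates of \<open>face0\<close> by rotations, and the norm absorbs the
  outer rotations.\<close>

lemma bd_nrm:
  assumes "of_length L z"
  shows "bd (nrm z) = nrm (hoch z)"
proof (cases "L < 2")
  case True
  have "face0 (rotr z) = 0" by (rule face0_of_length[OF of_length_rotr[OF assms] True])
  moreover have "bd z = 0" "bd (nrm z) = 0"
    using bd_rot[OF assms] bd_rot[OF of_length_nrm[OF assms]] True by simp_all
  moreover have "nrm (hoch z) = 0"
  proof (cases "L = 0")
    case True
    have "hoch z = 0"
    proof (rule linear_op_eqI[where x = z and T = "\<lambda>_. 0"])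
      fix w assume "w \<in> supp z"
      then have "w = []" using assms by (auto simp: of_length_def True)
      then show "hoch (gen w) = 0" by (simp add: hoch_def descend_Nil)
    qed auto
    then show ?thesis by simp
  next
    case False
    then have "[] \<notin> supp z" using assms by (auto simp: of_length_def)
    then show ?thesis using calculation by (simp add: hoch_rot)
  qed
  ultimately show ?thesis by simp
next
  case False
  then obtain M where L: "L = Suc M" "0 < M" by (cases L) auto
  have ne: "[] \<notin> supp z" using assms L by (auto simp: of_length_def)
  have len: "of_length M (face0 ((rotl ^^ i) z))" for i
    by (intro of_length_face0 of_length_rotl_pow) (use assms L in simp)
  have "rotr z = (rotl ^^ M) z"
    using assms unfolding L by (rule rotr_eq_rotl_pow)
  \<comment> \<open>The cyclic face is the conjugate with exponent \<open>M\<close>, since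
    \<open>rotr ^^ M\<close> is the identity on chains of length \<open>M\<close>.\<close>
  then have "hoch z = (\<Sum>i<M. (rotr ^^ i) (face0 ((rotl ^^ i) z))) + (rotr ^^ M) (face0 ((rotl ^^ M) z))"
    unfolding hoch_rot[OF ne] bd_rot[OF assms] L rotr_pow_full[OF len] by simp
  then have "nrm (hoch z) = (\<Sum>i<Suc M. nrm ((rotr ^^ i) (face0 ((rotl ^^ i) z))))"
    by simp
  also have "\<dots> = nrm (face0 (nrm z))"
    unfolding nrm_rotr_pow[OF len] nrm_eq[OF assms] L by simp
  also have "\<dots> = bd (nrm z)"
    unfolding bd_rot[OF of_length_nrm[OF assms]] rotl_pow_nrm[OF assms] L diff_Suc_1
    by (rule nrm_eq_rotr) (intro of_length_face0 of_length_nrm, use assms L in simp)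
  finally show ?thesis ..
qed

lemma bd_unit_pre:
  assumes "[] \<notin> supp z"
  shows "bd (unit_pre z) = z - unit_pre (bd z)"
  unfolding unit_pre_def by (simp add: bd_pre sum_subtractf sum_lact_idem[OF assms])

lemma of_length_pre: "of_length L z \<Longrightarrow> of_length (Suc L) (pre x z)"
  using keys_pre[of x z] by (fastforce simp: of_length_def)

lemma of_length_unit_pre: "of_length L z \<Longrightarrow> of_length (Suc L) (unit_pre z)"
  unfolding unit_pre_def
  by (intro of_length_sum of_length_pre)

text \<open>\<open>b (1 - t) s N = (1 - t) b' s N = (1 - t) (1 - s b') N = - (1 - t) s N b\<close>,
  where the last step uses \<open>(1 - t) N = 0\<close> and \<open>b' N = N b\<close>.\<close>

lemma hoch_connes:
  assumes "of_length L z" "0 < L"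
  shows "hoch (connes z) = - connes (hoch z)"
proof -
  have ne: "[] \<notin> supp (nrm z)"
    using of_length_nrm[OF assms(1)] assms(2) by (auto simp: of_length_def)
  have "hoch (connes z) = bd (unit_pre (nrm z)) - rotr (bd (unit_pre (nrm z)))"
    unfolding connes_def hoch_simps
    by (rule bd_rotr[of "Suc L"]) (simp_all add: of_length_unit_pre of_length_nrm assms)
  also have "\<dots> = - connes (hoch z)"
    unfolding bd_unit_pre[OF ne] bd_nrm[OF assms(1)] connes_def
    using rotr_nrm[OF assms(1)] by simp
  finally show ?thesis .
qed

section \<open>The Connes differential on cycles and its kernel in homology\<close>

lemma keys_rotl_pow: "supp z \<subseteq> words n d \<Longrightarrow> supp ((rotl ^^ i) z) \<subseteq> words n d"
proof (rule keys_linear_op[OF linear_rotl_pow])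
  fix w assume "supp z \<subseteq> words n d" "w \<in> supp z"
  then have w: "length w = n" "int (length (filter arrow w)) = d" by (auto simp: words_def)
  have "length (filter arrow (rotate i w)) = length (filter arrow w)"
  proof -
    have "length (filter arrow (rotate i w)) = length (filter arrow (take (i mod length w) w @ drop (i mod length w) w))"
      unfolding rotate_drop_take filter_append by simp
    then show ?thesis by simp
  qed
  then show "supp ((rotl ^^ i) (gen w)) \<subseteq> words n d"
    unfolding rotl_pow_gen by (intro keys_scale_subset) (simp add: words_def w)
qed

lemma keys_connes: "supp z \<subseteq> words n d \<Longrightarrow> supp (connes z) \<subseteq> words (Suc n) d"
proof -
  assume z: "supp z \<subseteq> words n d"
  then have "of_length n z" by (auto simp: of_length_def words_def)
  then have "supp (nrm z) \<subseteq> words n d"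
    unfolding nrm_eq[OF \<open>of_length n z\<close>] by (intro keys_sum_subset keys_rotl_pow z)
  then have u: "supp (unit_pre (nrm z)) \<subseteq> words (Suc n) d"
    unfolding unit_pre_def
    by (intro keys_sum_subset order.trans[OF keys_pre]) (use \<open>supp (nrm z) \<subseteq> words n d\<close> in \<open>auto simp: words_def\<close>)
  then have l: "of_length (Suc n) (unit_pre (nrm z))" by (auto simp: of_length_def words_def)
  then have "rotr (unit_pre (nrm z)) = (rotl ^^ n) (unit_pre (nrm z))"
    by (rule rotr_eq_rotl_pow)
  then show ?thesis unfolding connes_def using u keys_rotl_pow[OF u] by (simp add: keys_diff_subset)
qed

lemma connes_cycle: "z \<in> hcycles n d \<Longrightarrow> connes z \<in> hcycles (Suc n) d"
  using hoch_connes[of "Suc n" z] keys_connes[of z "Suc n" d]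
  by (auto simp: hcycles_def of_length_def words_def)

lemma connes_boundary:
  assumes "z \<in> hboundaries n d" shows "connes z \<in> hboundaries (Suc n) d"
proof -
  obtain y where y: "supp y \<subseteq> words (Suc (Suc n)) d" "z = hoch y"
    using assms by (auto simp: hboundaries_def)
  then have "of_length (Suc (Suc n)) y" by (auto simp: of_length_def words_def)
  then have "connes z = hoch (- connes y)" using hoch_connes by (simp add: y)
  moreover have "supp (- connes y) \<subseteq> words (Suc (Suc (Suc n))) d"
    using keys_connes[OF y(1)] by simp
  ultimately show ?thesis unfolding hboundaries_def by blast
qed

text \<open>As \<open>n\<close> is even all signs in the norm are positive, so the coefficient
  counts the rotations that fix the path. The trivial rotation is one of them.\<close>

lemma lookup_connes_cw1:
  assumes "even n"
  shows "coef (connes (gen (cw1 n 0))) (cw0 (Suc n) 0) \<noteq> 0"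
proof -
  let ?p = "arrows 0 (Suc n)" and ?z = "nrm (gen (cw1 n 0))"
  have z: "of_length (Suc n) ?z" by (rule of_length_nrm) (simp add: of_length_def cw1_def)
  have "coef ?z ?p = (\<Sum>i<Suc n. if rotate i ?p = ?p then 1 else 0)"
    unfolding nrm_gen lookup_sum rotl_pow_gen cw1_def
    using assms by (intro sum.cong) (auto simp: lookup_single when_def simp del: arrows.simps)
  also have "\<dots> = of_nat (card {i. i < Suc n \<and> rotate i ?p = ?p})"
    by (simp add: sum.If_cases Int_def del: arrows.simps lessThan_Suc sum.lessThan_Suc)
  finally have "coef ?z ?p = of_nat (card {i. i < Suc n \<and> rotate i ?p = ?p})" .
  moreover have "card {i. i < Suc n \<and> rotate i ?p = ?p} \<noteq> 0"
  proof -
    have "0 \<in> {i. i < Suc n \<and> rotate i ?p = ?p}" by simp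
    moreover have "finite {i. i < Suc n \<and> rotate i ?p = ?p}"
      by (rule finite_subset[of _ "{..<Suc n}"]) blast+
    ultimately show ?thesis using card_gt_0_iff by blast
  qed
  ultimately have nz: "coef ?z ?p \<noteq> 0" by simp
  have pre: "coef (pre x y) (x' # w) = (if x = x' then coef y w else 0)" for x x' y w
  proof -
    have "coef (pre x y) (x' # w)
        = (\<Sum>k\<in>supp y. coef y k * coef (gen (x # k)) (x' # w))"
      by (subst linear_op_expand[OF linear_pre]) (simp add: lookup_sum)
    also have "\<dots> = (\<Sum>k\<in>supp y. if k = w then (if x = x' then coef y w else 0) else 0)"
      by (rule sum.cong) (auto simp: lookup_single when_def)
    also have "\<dots> = (if x = x' then coef y w else 0)" by (simp add: in_keys_iff)
    finally show ?thesis .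
  qed
  have 1: "coef (unit_pre ?z) (cw0 (Suc n) 0) = coef ?z ?p"
    unfolding unit_pre_def cw0_def lookup_sum pre by simp
  have 2: "cw0 (Suc n) 0 \<notin> supp (rotr (unit_pre ?z))"
  proof -
    \<comment> \<open>The rotation moves the inserted idempotent to position 1, where
      \<open>cw0\<close> has an arrow; the summand with \<open>rotr\<close> therefore contributes
      nothing.\<close>
    have "supp (rotr (unit_pre ?z)) \<subseteq> {w. \<not> arrow (w ! 1)}"
    proof (rule keys_linear_op[OF linear_rotr])
      fix w assume w: "w \<in> supp (unit_pre ?z)"
      have "supp (unit_pre ?z) \<subseteq> {w. length w = Suc (Suc n) \<and> \<not> arrow (hd w)}"
        unfolding unit_pre_def
        by (intro keys_sum_subset order.trans[OF keys_pre]) (use z in \<open>auto simp: of_length_def\<close>)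
      then have "length w = Suc (Suc n)" "\<not> arrow (hd w)" using w by auto
      then obtain x v y where "w = x # v @ [y]" "\<not> arrow x"
        using long_word_cases[of w] by (metis Suc_less_eq list.sel(1) not_less_zero numeral_2_eq_2)
      then show "supp (rotr (gen w)) \<subseteq> {w. \<not> arrow (w ! 1)}"
        using rotr_gen[of "x # v" y] by (auto simp: in_keys_iff lookup_single when_def split: if_splits)
    qed
    then show ?thesis by (auto simp: cw0_def)
  qed
  show ?thesis using nz 1 2 by (simp add: connes_def lookup_minus in_keys_iff)
qed

text \<open>The index is the Hochschild degree: \<open>hcval n\<close> describes cyclic homology in
  degree \<open>n - 1\<close>.\<close>

definition hcval :: "nat \<Rightarrow> int \<Rightarrow> (3 \<Rightarrow> complex) set" where
  "hcval n d = (if n mod 6 = 3 \<and> d = int n then range (\<lambda>c _. c) else {\<lambda>_. 0})"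

lemma hfun_diff: "hfun n d (x - y) = (\<lambda>i. hfun n d x i - hfun n d y i)"
  by (auto simp: hfun_def fun_eq_iff lookup_minus sum_subtractf)

lemma hcycles_diff: "x \<in> hcycles n d \<Longrightarrow> y \<in> hcycles n d \<Longrightarrow> x - y \<in> hcycles n d"
  unfolding hcycles_def by (simp add: keys_diff_subset)

lemma hcycles_scale: "x \<in> hcycles n d \<Longrightarrow> scale c x \<in> hcycles n d"
  by (simp add: hcycles_def keys_scale_subset)

text \<open>For \<open>n mod 6 = 3\<close> the target of B is zero in this degree. For
  \<open>n mod 6 = 2\<close> the source is a line spanned by the class of \<open>cw1 n 0\<close>,
  which B does not kill.\<close>

lemma hfun_connes_kernel:
  assumes "0 < n"
  shows "hfun n d ` {z \<in> hcycles n d. connes z \<in> hboundaries (Suc n) d} = hcval n d"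
proof -
  consider "n mod 6 = 3" "d = int n" | "n mod 6 = 2" "d = int (Suc n)"
    | "\<not> (n mod 6 = 2 \<and> d = int (Suc n))" "\<not> (n mod 6 = 3 \<and> d = int n)" by blast
  then show ?thesis
  proof cases
    case 1
    then have "Suc n mod 6 = 4" by presburger
    then have "hval (Suc n) d = {\<lambda>_. 0}" using 1 by (simp add: hval_def)
    then have "connes z \<in> hboundaries (Suc n) d" if "z \<in> hcycles n d" for z
      using hfun_image[of "Suc n" d] connes_cycle[OF that] hfun_eq_0_iff by blast
    then have "{z \<in> hcycles n d. connes z \<in> hboundaries (Suc n) d} = hcycles n d" by blast
    then show ?thesis using hfun_image[of n d] 1 assms by (simp add: hval_def hcval_def)
  next
    case 2
    then have dv: "3 dvd Suc n" and n: "even n" "Suc n mod 6 = 3" by presburger+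
    have "hfun n d z = (\<lambda>_. 0)" if z: "z \<in> hcycles n d" "connes z \<in> hboundaries (Suc n) d" for z
    proof -
      define c where "c = hfun n d z 0"
      let ?v = "gen (cw1 n 0)"
      have v: "?v \<in> hcycles n d" using cw1_cycle[OF assms dv, of 0] 2 by simp
      have c: "hfun n d z = (\<lambda>_. c)" unfolding c_def using 2 assms by (simp add: hfun_def fun_eq_iff)
      have "hfun n d ?v = (\<lambda>_. 1)"
        using 2 assms by (simp add: hfun_def fun_eq_iff lookup_single when_def sum_three)
      \<comment> \<open>Modulo boundaries \<open>z\<close> is the multiple \<open>c\<close> of the
        generator, so the vanishing of its image forces \<open>c = 0\<close>.\<close>
      then have "hfun n d (z - scale c ?v) = (\<lambda>_. 0)"
        by (simp add: hfun_diff hfun_scale c)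
      then have "z - scale c ?v \<in> hboundaries n d"
        using hfun_eq_0_iff[of "z - scale c ?v" n d] hcycles_diff hcycles_scale z v by blast
      then have "connes z - scale c (connes ?v) \<in> hboundaries (Suc n) d"
        using connes_boundary by fastforce
      then have "hfun (Suc n) d (connes z - scale c (connes ?v)) = (\<lambda>_. 0)" by (rule hfun_boundary)
      moreover have "hfun (Suc n) d (connes z) = (\<lambda>_. 0)" using z(2) by (rule hfun_boundary)
      ultimately have "c * hfun (Suc n) d (connes ?v) 0 = 0"
        by (auto simp add: hfun_diff hfun_scale fun_eq_iff)
      moreover have "hfun (Suc n) d (connes ?v) 0 \<noteq> 0"
        using lookup_connes_cw1[OF n(1)] n 2 by (simp add: hfun_def)
      ultimately show ?thesis by (simp add: c)
    qed
    moreover have "0 \<in> {z \<in> hcycles n d. connes z \<in> hboundaries (Suc n) d}"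
      using zero_in_hboundaries by (simp add: hcycles_def)
    moreover have "hcval n d = {\<lambda>_. 0}" using 2 by (simp add: hcval_def)
    ultimately show ?thesis by auto
  next
    case 3
    moreover have "0 \<in> {z \<in> hcycles n d. connes z \<in> hboundaries (Suc n) d}"
      using zero_in_hboundaries by (simp add: hcycles_def)
    moreover have "hfun n d z = (\<lambda>_. 0)" for z
      using 3 assms by (auto simp: hfun_def fun_eq_iff)
    ultimately show ?thesis by (auto simp: hcval_def)
  qed
qed

subsection \<open>Linear coordinates\<close>

definition subsp :: "('k \<Rightarrow>\<^sub>0 complex) set \<Rightarrow> bool" where
  "subsp U \<longleftrightarrow> 0 \<in> U \<and> (\<forall>x\<in>U. \<forall>y\<in>U. x + y \<in> U) \<and> (\<forall>c. \<forall>x\<in>U. scale c x \<in> U)"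

lemma subspD:
  assumes "subsp U"
  shows "0 \<in> U" "x \<in> U \<Longrightarrow> y \<in> U \<Longrightarrow> x + y \<in> U" "x \<in> U \<Longrightarrow> scale c x \<in> U"
    and "x \<in> U \<Longrightarrow> - x \<in> U" "x \<in> U \<Longrightarrow> y \<in> U \<Longrightarrow> x - y \<in> U"
proof -
  show 1: "0 \<in> U" "x \<in> U \<Longrightarrow> y \<in> U \<Longrightarrow> x + y \<in> U" "x \<in> U \<Longrightarrow> scale c x \<in> U" for x y c
    using assms by (auto simp: subsp_def)
  have m: "x \<in> U \<Longrightarrow> - x \<in> U" for x using 1(3)[of x "-1"] by (simp add: scale_uminus_left)
  show "x \<in> U \<Longrightarrow> - x \<in> U" by (rule m)
  show "x \<in> U \<Longrightarrow> y \<in> U \<Longrightarrow> x - y \<in> U" using 1(2)[of x "- y"] m[of y] by simp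
qed

lemma subsp_sum: "subsp U \<Longrightarrow> (\<And>a. a \<in> A \<Longrightarrow> f a \<in> U) \<Longrightarrow> sum f A \<in> U"
  by (induction A rule: infinite_finite_induct) (auto intro: subspD)

lemma subsp_keys: "subsp {x. supp x \<subseteq> K}"
  by (simp add: subsp_def keys_add_subset keys_scale_subset)

text \<open>The map \<open>h\<close> identifies \<open>M\<close> with a set \<open>V\<close> of formal linear combinations. Closure is demanded because the
  structures of HOL-Algebra do not provide it.\<close>

definition lin_coord ::
  "(complex, 'a, 'm) module_scheme \<Rightarrow> ('k \<Rightarrow>\<^sub>0 complex) set \<Rightarrow> ('a \<Rightarrow> ('k \<Rightarrow>\<^sub>0 complex)) \<Rightarrow> bool" where
  "lin_coord M V h \<longleftrightarrow> bij_betw h (carrier M) V \<and> \<zero>\<^bsub>M\<^esub> \<in> carrier M \<and> h \<zero>\<^bsub>M\<^esub> = 0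
     \<and> (\<forall>x\<in>carrier M. \<forall>y\<in>carrier M. x \<oplus>\<^bsub>M\<^esub> y \<in> carrier M \<and> h (x \<oplus>\<^bsub>M\<^esub> y) = h x + h y)
     \<and> (\<forall>c. \<forall>x\<in>carrier M. c \<odot>\<^bsub>M\<^esub> x \<in> carrier M \<and> h (c \<odot>\<^bsub>M\<^esub> x) = scale c (h x))"

lemma lin_coordD:
  assumes "lin_coord M V h"
  shows "bij_betw h (carrier M) V" "inj_on h (carrier M)" "h ` carrier M = V"
    and "\<zero>\<^bsub>M\<^esub> \<in> carrier M" "h \<zero>\<^bsub>M\<^esub> = 0"
    and "x \<in> carrier M \<Longrightarrow> y \<in> carrier M \<Longrightarrow> x \<oplus>\<^bsub>M\<^esub> y \<in> carrier M"
    and "x \<in> carrier M \<Longrightarrow> y \<in> carrier M \<Longrightarrow> h (x \<oplus>\<^bsub>M\<^esub> y) = h x + h y"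
    and "x \<in> carrier M \<Longrightarrow> c \<odot>\<^bsub>M\<^esub> x \<in> carrier M"
    and "x \<in> carrier M \<Longrightarrow> h (c \<odot>\<^bsub>M\<^esub> x) = scale c (h x)"
  using assms unfolding lin_coord_def by (auto simp: bij_betw_def)

lemma lin_coord_eqI:
  "lin_coord M V h \<Longrightarrow> x \<in> carrier M \<Longrightarrow> y \<in> carrier M \<Longrightarrow> h x = h y \<Longrightarrow> x = y"
  by (meson inj_onD lin_coordD(2))

text \<open>The source of all isomorphisms of the theorem: both sides are given coordinates with the
  same set \<open>V\<close>.\<close>

lemma linear_iso_coord:
  assumes M: "lin_coord M V h" and N: "lin_coord N V g"
  shows "linear_iso M N"
proof -
  note M = lin_coordD[OF M] and N' = lin_coordD[OF N]
  define f where "f x = the_inv_into (carrier N) g (h x)" for x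
  have hV: "h x \<in> V" if "x \<in> carrier M" for x using that M(3) by auto
  have f: "f x \<in> carrier N" "g (f x) = h x" if "x \<in> carrier M" for x
    unfolding f_def using hV[OF that] N'(1) N'(2,3)
    by (auto simp: f_the_inv_into_f intro: the_inv_into_into)
  have "bij_betw f (carrier M) (carrier N)"
    using bij_betw_trans[OF M(1) bij_betw_the_inv_into[OF N'(1)]]
    by (rule bij_betw_cong[THEN iffD1, rotated]) (simp add: f_def)
  moreover have "f (x \<oplus>\<^bsub>M\<^esub> y) = f x \<oplus>\<^bsub>N\<^esub> f y" if "x \<in> carrier M" "y \<in> carrier M" for x y
    by (rule lin_coord_eqI[OF N]) (use that in \<open>simp_all add: f M N'\<close>)
  moreover have "f (c \<odot>\<^bsub>M\<^esub> x) = c \<odot>\<^bsub>N\<^esub> f x" if "x \<in> carrier M" for c x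
    by (rule lin_coord_eqI[OF N]) (use that in \<open>simp_all add: f M N'\<close>)
  ultimately show ?thesis unfolding linear_iso_def by blast
qed

lemma lin_coord_zero_space:
  assumes "lin_coord M {0} h" shows "carrier M = {\<zero>\<^bsub>M\<^esub>}"
proof -
  note M = lin_coordD[OF assms]
  have "x = \<zero>\<^bsub>M\<^esub>" if "x \<in> carrier M" for x
  proof (rule lin_coord_eqI[OF assms that M(4)])
    have "h x \<in> {0}" using that M(3) by blast
    then show "h x = h \<zero>\<^bsub>M\<^esub>" using M(5) by simp
  qed
  then show ?thesis using M(4) by blast
qed

section \<open>Modules, submodules and spans in coordinates\<close>

lemma cring_complex_field: "cring complex_field"
proof (rule cringI)
  show "abelian_group complex_field"
  proof (rule abelian_groupI)
    show "\<exists>y\<in>carrier complex_field. y \<oplus>\<^bsub>complex_field\<^esub> x = \<zero>\<^bsub>complex_field\<^esub>" for x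
      by (intro bexI[of _ "- x"]) (simp_all add: complex_field_def)
  qed (simp_all add: complex_field_def)
  show "comm_monoid complex_field"
    by (rule comm_monoidI) (simp_all add: complex_field_def)
qed (simp_all add: complex_field_def algebra_simps)

lemma lin_coord_abelian_group:
  assumes "lin_coord M V h" shows "abelian_group M"
proof (rule abelian_groupI)
  note M = lin_coordD[OF assms]
  show "x \<oplus>\<^bsub>M\<^esub> y \<in> carrier M" if "x \<in> carrier M" "y \<in> carrier M" for x y using that M by auto
  show "\<zero>\<^bsub>M\<^esub> \<in> carrier M" by (rule M)
  show "x \<oplus>\<^bsub>M\<^esub> y \<oplus>\<^bsub>M\<^esub> z = x \<oplus>\<^bsub>M\<^esub> (y \<oplus>\<^bsub>M\<^esub> z)" if "x \<in> carrier M" "y \<in> carrier M" "z \<in> carrier M" for x y z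
    by (rule lin_coord_eqI[OF assms]) (use that in \<open>simp_all add: M add_ac\<close>)
  show "x \<oplus>\<^bsub>M\<^esub> y = y \<oplus>\<^bsub>M\<^esub> x" if "x \<in> carrier M" "y \<in> carrier M" for x y
    by (rule lin_coord_eqI[OF assms]) (use that in \<open>simp_all add: M add_ac\<close>)
  show "\<zero>\<^bsub>M\<^esub> \<oplus>\<^bsub>M\<^esub> x = x" if "x \<in> carrier M" for x
    by (rule lin_coord_eqI[OF assms]) (use that in \<open>simp_all add: M\<close>)
  show "\<exists>y\<in>carrier M. y \<oplus>\<^bsub>M\<^esub> x = \<zero>\<^bsub>M\<^esub>" if "x \<in> carrier M" for x
  proof
    show "(-1) \<odot>\<^bsub>M\<^esub> x \<oplus>\<^bsub>M\<^esub> x = \<zero>\<^bsub>M\<^esub>"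
      by (rule lin_coord_eqI[OF assms]) (use that in \<open>simp_all add: M scale_uminus_left\<close>)
  qed (use that M in auto)
qed

lemma lin_coord_module:
  assumes "lin_coord M V h" shows "Module.module complex_field M"
proof (rule moduleI)
  note M = lin_coordD[OF assms]
  show "cring complex_field" by (rule cring_complex_field)
  show "abelian_group M" by (rule lin_coord_abelian_group[OF assms])
  show "a \<odot>\<^bsub>M\<^esub> x \<in> carrier M" if "x \<in> carrier M" for a x using that M by auto
  show "(a \<oplus>\<^bsub>complex_field\<^esub> b) \<odot>\<^bsub>M\<^esub> x = a \<odot>\<^bsub>M\<^esub> x \<oplus>\<^bsub>M\<^esub> b \<odot>\<^bsub>M\<^esub> x" if "x \<in> carrier M" for a b x
    by (rule lin_coord_eqI[OF assms]) (use that in \<open>simp_all add: M complex_field_def scale_add_left\<close>)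
  show "a \<odot>\<^bsub>M\<^esub> (x \<oplus>\<^bsub>M\<^esub> y) = a \<odot>\<^bsub>M\<^esub> x \<oplus>\<^bsub>M\<^esub> a \<odot>\<^bsub>M\<^esub> y" if "x \<in> carrier M" "y \<in> carrier M" for a x y
    by (rule lin_coord_eqI[OF assms]) (use that in \<open>simp_all add: M scale_add\<close>)
  show "(a \<otimes>\<^bsub>complex_field\<^esub> b) \<odot>\<^bsub>M\<^esub> x = a \<odot>\<^bsub>M\<^esub> (b \<odot>\<^bsub>M\<^esub> x)" if "x \<in> carrier M" for a b x
    by (rule lin_coord_eqI[OF assms]) (use that in \<open>simp_all add: M complex_field_def\<close>)
  show "\<one>\<^bsub>complex_field\<^esub> \<odot>\<^bsub>M\<^esub> x = x" if "x \<in> carrier M" for x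
    by (rule lin_coord_eqI[OF assms]) (use that in \<open>simp_all add: M complex_field_def\<close>)
qed

lemma lin_coord_submodule_iff:
  assumes "lin_coord M V h"
  shows "submodule H complex_field M \<longleftrightarrow> H \<subseteq> carrier M \<and> subsp (h ` H)"
proof -
  interpret Module.module complex_field M by (rule lin_coord_module[OF assms])
  note M' = lin_coordD[OF assms]
  have C: "carrier complex_field = UNIV" by (simp add: complex_field_def)
  show ?thesis
  proof
    assume H: "submodule H complex_field M"
    note E = submoduleE[OF H]
    have sub: "H \<subseteq> carrier M" by (rule E(1))
    have cl: "x \<oplus>\<^bsub>M\<^esub> y \<in> H" "c \<odot>\<^bsub>M\<^esub> x \<in> H" if "x \<in> H" "y \<in> H" for x y c
      using that E C by auto
    obtain x where x: "x \<in> H" using E(2) by auto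
    have "0 = h (0 \<odot>\<^bsub>M\<^esub> x)" using x sub M' by auto
    then have "0 \<in> h ` H" using cl(2)[OF x x] by auto
    moreover have "h x + h y \<in> h ` H" "scale c (h x) \<in> h ` H" if "x \<in> H" "y \<in> H" for x y c
      using that cl[OF that] M'(7)[of x y] M'(9)[of x c] sub by (metis image_eqI subsetD)+
    ultimately show "H \<subseteq> carrier M \<and> subsp (h ` H)" using sub by (auto simp: subsp_def)
  next
    assume H: "H \<subseteq> carrier M \<and> subsp (h ` H)"
    have mem: "x \<in> H" if "x \<in> carrier M" "h x \<in> h ` H" for x
      using that H lin_coord_eqI[OF assms] by (metis image_iff subsetD)
    show "submodule H complex_field M"
    proof (rule submoduleI)
      show "H \<subseteq> carrier M" using H by simp
      show "\<zero>\<^bsub>M\<^esub> \<in> H" by (rule mem) (use H M' in \<open>auto simp: subsp_def\<close>)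
      have sH: "subsp (h ` H)" using H by simp
      show "x \<oplus>\<^bsub>M\<^esub> y \<in> H" if "x \<in> H" "y \<in> H" for x y
      proof (rule mem)
        have xy: "x \<in> carrier M" "y \<in> carrier M" using that H by auto
        then show "x \<oplus>\<^bsub>M\<^esub> y \<in> carrier M" by (rule M')
        show "h (x \<oplus>\<^bsub>M\<^esub> y) \<in> h ` H" unfolding M'(7)[OF xy] using that subspD(2)[OF sH] by blast
      qed
      show sm: "c \<odot>\<^bsub>M\<^esub> x \<in> H" if "c \<in> carrier complex_field" "x \<in> H" for c x
      proof (rule mem)
        have x: "x \<in> carrier M" using that H by auto
        then show "c \<odot>\<^bsub>M\<^esub> x \<in> carrier M" by (rule M')
        show "h (c \<odot>\<^bsub>M\<^esub> x) \<in> h ` H" unfolding M'(9)[OF x] using that subspD(3)[OF sH] by blast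
      qed
      show "\<ominus>\<^bsub>M\<^esub> x \<in> H" if "x \<in> H" for x
      proof -
        have x: "x \<in> carrier M" using that H by auto
        have "(-1) \<odot>\<^bsub>M\<^esub> x \<oplus>\<^bsub>M\<^esub> x = \<zero>\<^bsub>M\<^esub>"
          by (rule lin_coord_eqI[OF assms]) (use x in \<open>simp_all add: M' scale_uminus_left\<close>)
        then have "\<ominus>\<^bsub>M\<^esub> x = (-1) \<odot>\<^bsub>M\<^esub> x" using x M' by (intro M.minus_equality) auto
        then show ?thesis using sm[of "-1" x] that C by simp
      qed
    qed
  qed
qed

text \<open>The span is a hull, that is an intersection of submodules. In coordinates these are
  subspaces, so it is enough to know the least subspace containing the image of
  \<open>S\<close>.\<close>

lemma span_of_coord:
  assumes M: "lin_coord M V h" and S: "S \<subseteq> carrier M" and U: "subsp U" "h ` S \<subseteq> U" "U \<subseteq> V"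
    and min: "\<And>U'. subsp U' \<Longrightarrow> h ` S \<subseteq> U' \<Longrightarrow> U \<subseteq> U'"
  shows "span_of M S = {x \<in> carrier M. h x \<in> U}"
proof
  note M' = lin_coordD[OF M]
  have "h ` {x \<in> carrier M. h x \<in> U} = U" using M'(3) U(3) by auto
  then have "submodule {x \<in> carrier M. h x \<in> U} complex_field M"
    unfolding lin_coord_submodule_iff[OF M] using U by simp
  then show "span_of M S \<subseteq> {x \<in> carrier M. h x \<in> U}"
    unfolding span_of_def using S U(2) by (intro hull_minimal) auto
  show "{x \<in> carrier M. h x \<in> U} \<subseteq> span_of M S"
    unfolding span_of_def hull_def
  proof (clarsimp)
    fix x H assume x: "x \<in> carrier M" "h x \<in> U" and H: "submodule H complex_field M" "S \<subseteq> H"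
    then have "h x \<in> h ` H"
      using min[of "h ` H"] H lin_coord_submodule_iff[OF M, of H] by blast
    then show "x \<in> H"
      using x(1) H(1) lin_coord_submodule_iff[OF M, of H] lin_coord_eqI[OF M] by (metis image_iff subsetD)
  qed
qed

lemma lin_coord_restrict:
  assumes M: "lin_coord M V h" and "Z \<subseteq> carrier M" "subsp (h ` Z)"
  shows "lin_coord (M\<lparr>carrier := Z\<rparr>) (h ` Z) h"
proof -
  note M' = lin_coordD[OF M]
  have mem: "x \<in> Z" if "x \<in> carrier M" "h x \<in> h ` Z" for x
    using that assms(2) lin_coord_eqI[OF M] by (metis image_iff subsetD)
  have "inj_on h Z" using M'(2) assms(2) inj_on_subset by blast
  moreover have "\<zero>\<^bsub>M\<^esub> \<in> Z"
    by (rule mem) (use M'(4,5) subspD(1)[OF assms(3)] in simp_all)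
  moreover have "x \<oplus>\<^bsub>M\<^esub> y \<in> Z" if "x \<in> Z" "y \<in> Z" for x y
  proof (rule mem)
    have xy: "x \<in> carrier M" "y \<in> carrier M" using that assms(2) by auto
    then show "x \<oplus>\<^bsub>M\<^esub> y \<in> carrier M" by (rule M')
    show "h (x \<oplus>\<^bsub>M\<^esub> y) \<in> h ` Z" unfolding M'(7)[OF xy] using that subspD(2)[OF assms(3)] by blast
  qed
  moreover have "c \<odot>\<^bsub>M\<^esub> x \<in> Z" if "x \<in> Z" for x c
  proof (rule mem)
    have x: "x \<in> carrier M" using that assms(2) by auto
    then show "c \<odot>\<^bsub>M\<^esub> x \<in> carrier M" by (rule M')
    show "h (c \<odot>\<^bsub>M\<^esub> x) \<in> h ` Z" unfolding M'(9)[OF x] using that subspD(3)[OF assms(3)] by blast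
  qed
  ultimately show ?thesis
    using M'(5,7,9) assms(2) by (auto simp: lin_coord_def bij_betw_def subset_iff)
qed

lemma lin_coord_free_space: "lin_coord (free_space K) {x. supp x \<subseteq> K} (\<lambda>x. x)"
  by (auto simp: lin_coord_def free_space_def bij_betw_def keys_add_subset keys_scale_subset)

subsection \<open>Quotients\<close>

lemma quotient_simps:
  "carrier (quotient M N) = a_rcosets\<^bsub>M\<^esub> N"
  "\<zero>\<^bsub>quotient M N\<^esub> = N"
  "Y \<oplus>\<^bsub>quotient M N\<^esub> Z = Y <+>\<^bsub>M\<^esub> Z"
  "c \<odot>\<^bsub>quotient M N\<^esub> Y = (\<Union>x\<in>Y. N +>\<^bsub>M\<^esub> (c \<odot>\<^bsub>M\<^esub> x))"
  "\<one>\<^bsub>quotient M N\<^esub> = N +>\<^bsub>M\<^esub> \<one>\<^bsub>M\<^esub>"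
  "Y \<otimes>\<^bsub>quotient M N\<^esub> Z = rcoset_mult M N Y Z"
  by (simp_all add: quotient_def FactRing_def ring.defs module.defs)

text \<open>Cosets of a kernel are fibres; equality of cosets thus becomes an equation between
  coordinates.\<close>

lemma coset_coord:
  assumes M: "lin_coord M V h" and f: "linear_op f"
    and x: "x \<in> carrier M"
  shows "{y \<in> carrier M. f (h y) = 0} +>\<^bsub>M\<^esub> x = {y \<in> carrier M. f (h y) = f (h x)}"
proof -
  note M' = lin_coordD[OF M]
  have "y \<in> (\<lambda>b. b \<oplus>\<^bsub>M\<^esub> x) ` {y \<in> carrier M. f (h y) = 0}" if y: "y \<in> carrier M" "f (h y) = f (h x)" for y
  proof (rule image_eqI)
    let ?b = "y \<oplus>\<^bsub>M\<^esub> ((-1) \<odot>\<^bsub>M\<^esub> x)"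
    show "y = ?b \<oplus>\<^bsub>M\<^esub> x"
      by (rule lin_coord_eqI[OF M]) (use x y in \<open>simp_all add: M' scale_uminus_left\<close>)
    show "?b \<in> {y \<in> carrier M. f (h y) = 0}"
      using x y by (simp add: M' scale_uminus_left linear_opD[OF f])
  qed
  then show ?thesis
    using x by (auto simp: a_r_coset_def r_coset_def M' linear_opD[OF f])
qed

text \<open>The first isomorphism theorem. The choice in \<open>g\<close> is harmless because
  \<open>f\<close> after \<open>h\<close> is constant on each coset of its kernel.\<close>

lemma lin_coord_quotient:
  assumes M: "lin_coord M V h" and f: "linear_op f"
    and N: "N = {y \<in> carrier M. f (h y) = 0}"
  defines "g \<equiv> (\<lambda>Y. f (h (SOME y. y \<in> Y)))"
  shows "lin_coord (quotient M N) (f ` V) g"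
    and "x \<in> carrier M \<Longrightarrow> g (N +>\<^bsub>M\<^esub> x) = f (h x)"
    and "carrier (quotient M N) = (\<lambda>x. N +>\<^bsub>M\<^esub> x) ` carrier M"
proof -
  note M' = lin_coordD[OF M]
  note cos = coset_coord[OF M f, folded N]
  have g: "g (N +>\<^bsub>M\<^esub> x) = f (h x)" if "x \<in> carrier M" for x
    unfolding g_def cos[OF that] using someI[of "\<lambda>y. y \<in> carrier M \<and> f (h y) = f (h x)" x] that by simp
  then show "x \<in> carrier M \<Longrightarrow> g (N +>\<^bsub>M\<^esub> x) = f (h x)" .
  have car: "carrier (quotient M N) = (\<lambda>x. N +>\<^bsub>M\<^esub> x) ` carrier M"
    by (auto simp: quotient_simps A_RCOSETS_def RCOSETS_def a_r_coset_def)
  then show "carrier (quotient M N) = (\<lambda>x. N +>\<^bsub>M\<^esub> x) ` carrier M" .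
  have add: "(N +>\<^bsub>M\<^esub> x) \<oplus>\<^bsub>quotient M N\<^esub> (N +>\<^bsub>M\<^esub> y) = N +>\<^bsub>M\<^esub> (x \<oplus>\<^bsub>M\<^esub> y)"
    if x: "x \<in> carrier M" and y: "y \<in> carrier M" for x y
  proof -
    have "\<exists>a\<in>carrier M. \<exists>b\<in>carrier M. f (h a) = f (h x) \<and> f (h b) = f (h y) \<and> z = a \<oplus>\<^bsub>M\<^esub> b"
      if z: "z \<in> carrier M" "f (h z) = f (h x) + f (h y)" for z
    proof (intro bexI conjI)
      show "z = z \<oplus>\<^bsub>M\<^esub> ((-1) \<odot>\<^bsub>M\<^esub> y) \<oplus>\<^bsub>M\<^esub> y"
        by (rule lin_coord_eqI[OF M]) (use y z in \<open>simp_all add: M' scale_uminus_left\<close>)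
      show "f (h (z \<oplus>\<^bsub>M\<^esub> ((-1) \<odot>\<^bsub>M\<^esub> y))) = f (h x)"
        using y z by (simp add: M' scale_uminus_left linear_opD[OF f])
    qed (use y z M' in auto)
    note ex = this
    show ?thesis
      unfolding quotient_simps set_add_def set_mult_def cos[OF x] cos[OF y] cos[OF M'(6)[OF x y]]
    proof (intro equalityI subsetI)
      fix z assume "z \<in> {z \<in> carrier M. f (h z) = f (h (x \<oplus>\<^bsub>M\<^esub> y))}"
      then obtain a b where "a \<in> carrier M" "b \<in> carrier M" "f (h a) = f (h x)" "f (h b) = f (h y)" "z = a \<oplus>\<^bsub>M\<^esub> b"
        using ex[of z] M'(7)[OF x y] linear_op_add[OF f] by auto
      then show "z \<in> (\<Union>a\<in>{z \<in> carrier M. f (h z) = f (h x)}. \<Union>b\<in>{z \<in> carrier M. f (h z) = f (h y)}. {a \<otimes>\<^bsub>add_monoid M\<^esub> b})"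
        by auto
    qed (use x y in \<open>auto simp: M' linear_opD[OF f]\<close>)
  qed
  have sm: "c \<odot>\<^bsub>quotient M N\<^esub> (N +>\<^bsub>M\<^esub> x) = N +>\<^bsub>M\<^esub> (c \<odot>\<^bsub>M\<^esub> x)" if x: "x \<in> carrier M" for x c
  proof -
    have "N +>\<^bsub>M\<^esub> (c \<odot>\<^bsub>M\<^esub> y) = N +>\<^bsub>M\<^esub> (c \<odot>\<^bsub>M\<^esub> x)" if "y \<in> N +>\<^bsub>M\<^esub> x" for y
      using that unfolding cos[OF x] using x cos[OF M'(8), of y c] cos[OF M'(8), of x c]
      by (simp add: M' linear_opD[OF f])
    moreover have "x \<in> N +>\<^bsub>M\<^esub> x" unfolding cos[OF x] using x by simp
    ultimately show ?thesis unfolding quotient_simps by blast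
  qed
  have z: "N = N +>\<^bsub>M\<^esub> \<zero>\<^bsub>M\<^esub>" 
    using cos[OF M'(4)] unfolding M'(5) linear_op_zero[OF f] by (rule trans[OF N sym])
  have "inj_on g (carrier (quotient M N))"
  proof (rule inj_onI)
    fix Y Z assume "Y \<in> carrier (quotient M N)" "Z \<in> carrier (quotient M N)" "g Y = g Z"
    then obtain x y where "x \<in> carrier M" "y \<in> carrier M" "Y = N +>\<^bsub>M\<^esub> x" "Z = N +>\<^bsub>M\<^esub> y" "f (h x) = f (h y)"
      unfolding car using g by fastforce
    then show "Y = Z" by (simp add: cos)
  qed
  moreover have "g ` carrier (quotient M N) = f ` V"
    unfolding car image_image M'(3)[symmetric] by (rule image_cong) (simp_all add: g)
  moreover have "\<zero>\<^bsub>quotient M N\<^esub> \<in> carrier (quotient M N)" "g \<zero>\<^bsub>quotient M N\<^esub> = 0"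
    unfolding quotient_simps(2) car using z M'(4) g[OF M'(4)] M'(5) linear_op_zero[OF f] by auto
  ultimately show "lin_coord (quotient M N) (f ` V) g"
    unfolding lin_coord_def bij_betw_def
    by (auto simp: car add sm g M' linear_opD[OF f])
qed

lemma induced_map_eq:
  assumes "x \<in> Y" "\<And>y. y \<in> Y \<Longrightarrow> N +>\<^bsub>M\<^esub> f y = N +>\<^bsub>M\<^esub> f x"
  shows "induced_map M N f Y = N +>\<^bsub>M\<^esub> f x"
  using assms unfolding induced_map_def by blast

subsection \<open>Algebras with coordinates\<close>

text \<open>All that the homology sees of the quotient of the path algebra: coordinates with respect
  to the six letters, multiplied by \<open>lmult\<close> and graded by the number of arrows. The
  path algebra itself reappears only when the locale is interpreted.\<close>

locale cyclic_algebra =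
  fixes A :: "'a galgebra" (structure) and co :: "'a \<Rightarrow> letter \<Rightarrow> complex"
  assumes co_bij: "bij_betw co (carrier A) UNIV"
    and zero_closed: "\<zero> \<in> carrier A" and co_zero: "co \<zero> l = 0"
    and one_closed: "\<one> \<in> carrier A" and co_one: "co \<one> l = (if arrow l then 0 else 1)"
    and add_closed: "x \<in> carrier A \<Longrightarrow> y \<in> carrier A \<Longrightarrow> x \<oplus> y \<in> carrier A"
    and co_add: "x \<in> carrier A \<Longrightarrow> y \<in> carrier A \<Longrightarrow> co (x \<oplus> y) l = co x l + co y l"
    and smult_closed: "x \<in> carrier A \<Longrightarrow> c \<odot> x \<in> carrier A"
    and co_smult: "x \<in> carrier A \<Longrightarrow> co (c \<odot> x) l = c * co x l"
    and mult_closed: "x \<in> carrier A \<Longrightarrow> y \<in> carrier A \<Longrightarrow> x \<otimes> y \<in> carrier A"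
    and co_mult: "x \<in> carrier A \<Longrightarrow> y \<in> carrier A \<Longrightarrow>
      co (x \<otimes> y) l = (\<Sum>a\<in>UNIV. \<Sum>b\<in>UNIV. if lmult a b = Some l then co x a * co y b else 0)"
    and homog_iff: "homog A d = {x \<in> carrier A. \<forall>l. co x l \<noteq> 0 \<longrightarrow> (if arrow l then 1 else 0) = d}"
begin

lemma co_eqI: "x \<in> carrier A \<Longrightarrow> y \<in> carrier A \<Longrightarrow> (\<And>l. co x l = co y l) \<Longrightarrow> x = y"
  using co_bij inj_onD[of co "carrier A" x y] by (simp add: bij_betw_def fun_eq_iff)

lemmas closed = zero_closed one_closed add_closed smult_closed mult_closed

text \<open>Linear extension from the basis letters to \<open>x\<close>; multilinear expressions in
  several algebra elements become nested \<open>ext\<close>, which may be interchanged by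
  \<open>ext_swap\<close>.\<close>

definition ext :: "'a \<Rightarrow> (letter \<Rightarrow> chain) \<Rightarrow> chain" where
  "ext x f = (\<Sum>l\<in>UNIV. scale (co x l) (f l))"

lemma ext_add: "x \<in> carrier A \<Longrightarrow> y \<in> carrier A \<Longrightarrow> ext (x \<oplus> y) f = ext x f + ext y f"
  by (simp add: ext_def co_add scale_add_left sum.distrib)

lemma ext_smult: "x \<in> carrier A \<Longrightarrow> ext (c \<odot> x) f = scale c (ext x f)"
  by (simp add: ext_def co_smult scale_sum)

lemma ext_linear: "linear_op T \<Longrightarrow> T (ext x f) = ext x (\<lambda>l. T (f l))"
  by (simp add: ext_def linear_op_sum linear_op_scale)

lemma ext_fun_add: "ext x (\<lambda>l. f l + g l) = ext x f + ext x g"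
  and ext_fun_diff: "ext x (\<lambda>l. f l - g l) = ext x f - ext x g"
  and ext_fun_scale: "ext x (\<lambda>l. scale c (f l)) = scale c (ext x f)"
  and ext_fun_sum: "ext x (\<lambda>l. \<Sum>i\<in>I. h i l) = (\<Sum>i\<in>I. ext x (h i))"
  and ext_fun_zero: "ext x (\<lambda>l. 0) = 0"
  by (simp_all add: ext_def scale_add scale_diff scale_sum sum.distrib sum_subtractf mult.commute sum.swap[of _ I])

lemma ext_swap: "ext x (\<lambda>a. ext y (f a)) = ext y (\<lambda>b. ext x (\<lambda>a. f a b))"
  unfolding ext_def scale_sum by (subst sum.swap) (simp add: mult.commute)

lemma ext_one: "ext \<one> f = (\<Sum>u\<in>UNIV. f (idem u))"
proof -
  have "ext \<one> f = (\<Sum>l\<in>UNIV. if arrow l then 0 else f l)"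
    by (auto simp: ext_def co_one intro!: sum.cong)
  also have "\<dots> = sum f {l. \<not> arrow l}"
    by (simp add: sum.If_cases Compl_eq)
  also have "{l. \<not> arrow l} = idem ` UNIV" by force
  also have "sum f (idem ` UNIV) = (\<Sum>u\<in>UNIV. f (idem u))"
    by (subst sum.reindex) (auto simp: inj_on_def)
  finally show ?thesis .
qed

lemma ext_mult:
  assumes "x \<in> carrier A" "y \<in> carrier A"
  shows "ext (x \<otimes> y) f = ext x (\<lambda>a. ext y (\<lambda>b. case lmult a b of None \<Rightarrow> 0 | Some c \<Rightarrow> f c))"
proof -
  have "ext (x \<otimes> y) f = (\<Sum>l\<in>UNIV. \<Sum>a\<in>UNIV. \<Sum>b\<in>UNIV.
      if lmult a b = Some l then scale (co x a * co y b) (f l) else 0)"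
    unfolding ext_def co_mult[OF assms] scale_sum_left by (intro sum.cong refl) simp
  also have "\<dots> = (\<Sum>a\<in>UNIV. \<Sum>b\<in>UNIV. \<Sum>l\<in>UNIV.
      if lmult a b = Some l then scale (co x a * co y b) (f l) else 0)"
    by (subst sum.swap, rule sum.cong[OF refl], rule sum.swap)
  also have "\<dots> = (\<Sum>a\<in>UNIV. \<Sum>b\<in>UNIV. scale (co x a * co y b) (case lmult a b of None \<Rightarrow> 0 | Some c \<Rightarrow> f c))"
  proof (intro sum.cong refl)
    fix a b
    show "(\<Sum>l\<in>UNIV. if lmult a b = Some l then scale (co x a * co y b) (f l) else 0)
        = scale (co x a * co y b) (case lmult a b of None \<Rightarrow> 0 | Some c \<Rightarrow> f c)"
      by (cases "lmult a b") auto
  qed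
  finally show ?thesis by (simp add: ext_def scale_sum)
qed

definition bas :: "letter \<Rightarrow> 'a" where
  "bas l = the_inv_into (carrier A) co (\<lambda>k. if k = l then 1 else 0)"

lemma bas_closed: "bas l \<in> carrier A" and co_bas: "co (bas l) k = (if k = l then 1 else 0)"
proof -
  have "co (bas l) = (\<lambda>k. if k = l then 1 else 0)"
    unfolding bas_def by (rule f_the_inv_into_f) (use co_bij in \<open>auto simp: bij_betw_def\<close>)
  then show "co (bas l) k = (if k = l then 1 else 0)" by simp
  show "bas l \<in> carrier A"
    unfolding bas_def by (rule the_inv_into_into[OF _ _ order.refl]) (use co_bij in \<open>auto simp: bij_betw_def\<close>)
qed

lemma ext_bas: "ext (bas l) f = f l"
proof -
  have "ext (bas l) f = (\<Sum>k\<in>UNIV. if k = l then f l else 0)"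
    unfolding ext_def co_bas by (intro sum.cong) auto
  then show ?thesis by simp
qed

lemma mult_one: "x \<in> carrier A \<Longrightarrow> x \<otimes> \<one> = x" and one_mult: "x \<in> carrier A \<Longrightarrow> \<one> \<otimes> x = x"
proof -
  assume x: "x \<in> carrier A"
  show "x \<otimes> \<one> = x"
  proof (rule co_eqI)
    fix l
    have "co (x \<otimes> \<one>) l = (\<Sum>a\<in>UNIV. \<Sum>b\<in>UNIV. if b = idem (tgt l) then (if a = l then co x l else 0) else 0)"
      unfolding co_mult[OF x one_closed] co_one
      by (intro sum.cong refl, cases l) (auto simp: lmult_def tgt_def split: if_splits)
    then show "co (x \<otimes> \<one>) l = co x l" by simp
  qed (use x closed in auto)
  show "\<one> \<otimes> x = x"
  proof (rule co_eqI)
    fix l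
    have "co (\<one> \<otimes> x) l = (\<Sum>a\<in>UNIV. \<Sum>b\<in>UNIV. if b = l then (if a = idem (src l) then co x l else 0) else 0)"
      unfolding co_mult[OF one_closed x] co_one
      by (intro sum.cong refl, cases l) (auto simp: lmult_def tgt_def split: if_splits)
    then show "co (\<one> \<otimes> x) l = co x l" by simp
  qed (use x closed in auto)
qed

primrec tens :: "'a list \<Rightarrow> chain" where
  "tens [] = gen []"
| "tens (x # xs) = ext x (\<lambda>l. pre l (tens xs))"

lemma tens_snoc: "tens (xs @ [x]) = ext x (\<lambda>l. post l (tens xs))"
proof (induction xs)
  case (Cons y xs)
  show ?case
    by (simp add: Cons ext_linear[OF linear_pre] ext_linear[OF linear_post] pre_post ext_swap[of y])
qed simp

lemma of_length_tens: "of_length (length xs) (tens xs)"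
proof (induction xs)
  case Nil
  then show ?case by (simp add: of_length_def)
next
  case (Cons x xs)
  show ?case unfolding tens.simps ext_def length_Cons
    using of_length_pre[OF Cons] keys_scale_subset unfolding of_length_def
    by (intro keys_sum_subset keys_scale_subset) blast
qed

lemma tens_mult_Cons:
  assumes "x \<in> carrier A" "y \<in> carrier A"
  shows "tens ((x \<otimes> y) # xs) = ext x (\<lambda>a. lact a (tens (y # xs)))"
  by (simp add: ext_mult[OF assms] ext_linear[OF linear_lact] lact_pre)

lemma ract_post: "ract b (post x z) = (case lmult x b of None \<Rightarrow> 0 | Some c \<Rightarrow> post c z)"
proof (cases "lmult x b")
  case None
  show ?thesis unfolding None option.case
    by (rule linear_op_eqI[where x = z]) (auto simp: None intro!: lin_intros)
next
  case (Some c)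
  show ?thesis unfolding Some option.case
    by (rule linear_op_eqI[where x = z]) (auto simp: Some intro!: lin_intros)
qed

lemma tens_mult_snoc:
  assumes "x \<in> carrier A" "y \<in> carrier A"
  shows "tens (xs @ [x \<otimes> y]) = ext y (\<lambda>b. ract b (tens (xs @ [x])))"
  unfolding tens_snoc ext_mult[OF assms]
  by (simp add: ext_linear[OF linear_ract] ract_post ext_swap[of x])

text \<open>The class of a list in the tensor product over the enveloping algebra, expanded in the
  basis of words.\<close>

primrec Phi_list :: "'a list \<Rightarrow> chain" where
  "Phi_list [] = 0"
| "Phi_list (m # xs) = ext m (\<lambda>l. wrap l (tens xs))"

text \<open>\<open>wrap_act\<close> moves the letters of \<open>x\<close> and \<open>y\<close> from
  the coefficient to the ends of the tensor, where they are multiplied into \<open>v\<close> and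
  \<open>u\<close>.\<close>

lemma Phi_list_balanced:
  assumes "x \<in> carrier A" "y \<in> carrier A" "m \<in> carrier A" "u \<in> carrier A" "v \<in> carrier A"
  shows "Phi_list ((x \<otimes> m \<otimes> y) # u # us @ [v]) = Phi_list (m # (y \<otimes> u) # us @ [v \<otimes> x])"
proof -
  let ?t = "tens (u # us @ [v])"
  have "Phi_list ((x \<otimes> m \<otimes> y) # u # us @ [v])
      = ext x (\<lambda>a. ext m (\<lambda>b. ext y (\<lambda>d. case triple a b d of None \<Rightarrow> 0 | Some e \<Rightarrow> wrap e ?t)))"
  proof -
    have "(case lmult a b of None \<Rightarrow> 0 | Some c \<Rightarrow> ext y (\<lambda>d. case lmult c d of None \<Rightarrow> 0 | Some e \<Rightarrow> wrap e ?t))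
        = ext y (\<lambda>d. case triple a b d of None \<Rightarrow> 0 | Some e \<Rightarrow> wrap e ?t)" for a b
      by (cases "lmult a b") (simp_all add: triple_def ext_fun_zero)
    then show ?thesis
      unfolding Phi_list.simps ext_mult[OF mult_closed[OF assms(1,3)] assms(2)] ext_mult[OF assms(1,3)] by simp
  qed
  also have "\<dots> = ext m (\<lambda>b. wrap b (ext y (\<lambda>d. lact d (ext x (\<lambda>a. ract a ?t)))))"
    unfolding wrap_act[symmetric] ext_linear[OF linear_lact] ext_linear[OF linear_wrap]
    by (subst ext_swap[of x]) (simp add: ext_swap[of x y])
  also have "ext x (\<lambda>a. ract a ?t) = tens (u # us @ [v \<otimes> x])"
    using tens_mult_snoc[of v x "u # us"] assms by simp
  also have "ext y (\<lambda>d. lact d (tens (u # us @ [v \<otimes> x]))) = tens ((y \<otimes> u) # us @ [v \<otimes> x])"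
    using tens_mult_Cons[of y u] assms by simp
  finally show ?thesis by simp
qed

lemma wrap_ones: "wrap l (tens (\<one> # ys @ [\<one>])) = pre l (tens ys)"
proof -
  have *: "(\<Sum>u\<in>UNIV. \<Sum>v\<in>UNIV. wrap l (pre (idem u) (post (idem v) z))) = pre l z" for z
  proof (rule linear_op_eqI[where x = z])
    fix w
    have "(\<Sum>u\<in>UNIV. \<Sum>v\<in>UNIV. wrap l (pre (idem u) (post (idem v) (gen w))))
        = (\<Sum>u\<in>UNIV. \<Sum>v\<in>UNIV. if v = src l then if u = tgt l then gen (l # w) else 0 else 0)"
      by (intro sum.cong refl) (auto simp: wrap_gen triple_idem)
    then show "(\<Sum>u\<in>UNIV. \<Sum>v\<in>UNIV. wrap l (pre (idem u) (post (idem v) (gen w)))) = pre l (gen w)"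
      by simp
  qed (auto intro!: lin_intros)
  show ?thesis by (simp add: tens_snoc ext_one *)
qed

lemma Phi_from_hochschild: "Phi_list (from_hochschild A (y # ys)) = tens (y # ys)"
  using wrap_ones by (simp add: from_hochschild_def)

lemma list_cases3:
  assumes "length xs = n + 3"
  obtains m u us v where "xs = m # u # us @ [v]" "length us = n"
proof -
  obtain m ys where 1: "xs = m # ys" "length ys = n + 2" using assms by (cases xs) auto
  then obtain u zs where 2: "ys = u # zs" "length zs = n + 1" by (cases ys) auto
  then obtain us v where "zs = us @ [v]" "length us = n" by (cases zs rule: rev_cases) auto
  then show ?thesis using that 1 2 by simp
qed

lemma to_hochschild_simp: "to_hochschild A (m # u # us @ [v]) = (v \<otimes> m \<otimes> u) # us"
  by (simp add: to_hochschild_def)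

text \<open>Balancing with the end entries themselves moves both into the coefficient and leaves
  units behind.\<close>

lemma Phi_to_hochschild:
  assumes "length xs = n + 3" "set xs \<subseteq> carrier A"
  shows "Phi_list xs = tens (to_hochschild A xs)"
proof -
  obtain m u us v where xs: "xs = m # u # us @ [v]" using assms(1) by (rule list_cases3)
  have c: "m \<in> carrier A" "u \<in> carrier A" "v \<in> carrier A" using assms(2) by (auto simp: xs)
  have "Phi_list ((v \<otimes> m \<otimes> u) # \<one> # us @ [\<one>]) = Phi_list xs"
    using Phi_list_balanced[of v u m "\<one>" "\<one>" us] c closed by (simp add: xs mult_one one_mult)
  then show ?thesis using Phi_from_hochschild[of "v \<otimes> m \<otimes> u" us]
    by (simp add: from_hochschild_def to_hochschild_simp xs)
qed

section \<open>The coordinate map on formal combinations of lists\<close>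

definition Phi :: "('a list \<Rightarrow>\<^sub>0 complex) \<Rightarrow> chain" where
  "Phi = lin_ext Phi_list"

lemma linear_Phi [intro, simp]: "linear_op Phi" by (simp add: Phi_def)
lemmas linear_Phi_comp [lin_intros] = linear_op_compose[OF linear_Phi]
lemmas Phi_simps [simp] = linear_opD[OF linear_Phi] linear_op_sum[OF linear_Phi]
lemma Phi_gen [simp]: "Phi (gen xs) = Phi_list xs" by (simp add: Phi_def)

definition lists3 :: "nat \<Rightarrow> 'a list set" where
  "lists3 n = {xs. length xs = n + 3 \<and> set xs \<subseteq> carrier A}"

lemma bar_free_simps:
  "carrier (bar_free A n) = {x. supp x \<subseteq> lists3 n}"
  by (simp add: bar_free_def free_space_def lists3_def)

lemma lin_coord_bar_free: "lin_coord (bar_free A n) {x. supp x \<subseteq> lists3 n} (\<lambda>x. x)"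
  unfolding bar_free_def lists3_def by (rule lin_coord_free_space)

lemma tens_append_multilinear:
  "x \<in> carrier A \<Longrightarrow> y \<in> carrier A \<Longrightarrow> tens (us @ (x \<oplus> y) # vs) = tens (us @ x # vs) + tens (us @ y # vs)"
  "x \<in> carrier A \<Longrightarrow> tens (us @ (c \<odot> x) # vs) = scale c (tens (us @ x # vs))"
  by (induction us) (simp_all add: ext_add ext_smult ext_fun_add ext_fun_scale)

lemma Phi_list_multilinear:
  "x \<in> carrier A \<Longrightarrow> y \<in> carrier A \<Longrightarrow> Phi_list (us @ (x \<oplus> y) # vs) = Phi_list (us @ x # vs) + Phi_list (us @ y # vs)"
  "x \<in> carrier A \<Longrightarrow> Phi_list (us @ (c \<odot> x) # vs) = scale c (Phi_list (us @ x # vs))"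
  by (cases us; simp add: ext_add ext_smult ext_fun_add ext_fun_scale tens_append_multilinear)+

lemma Phi_rels:
  assumes "r \<in> multilinear_rels A \<union> balanced_rels A" shows "Phi r = 0"
  using assms unfolding multilinear_rels_def balanced_rels_def
  by (auto simp: Phi_list_multilinear Phi_list_balanced simp del: Phi_list.simps)

end

declare split_paired_All [simp del] split_paired_Ex [simp del]

context cyclic_algebra
begin

subsection \<open>The bar relations are the kernel of the coordinate map\<close>

text \<open>A section of the coordinate map on nonempty words, see \<open>Phi_lift\<close>.\<close>

definition lift :: "word \<Rightarrow> 'a list" where
  "lift w = from_hochschild A (map bas w)"

context
  fixes U :: "('a list \<Rightarrow>\<^sub>0 complex) set" and n :: nat
  assumes sub: "subsp U"
    and rels: "carrier (bar_free A n) \<inter> (multilinear_rels A \<union> balanced_rels A) \<subseteq> U"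
begin

text \<open>Here \<open>U\<close> is any subspace containing the relations, and membership of a
  difference in \<open>U\<close> serves as congruence. That \<open>U\<close> contains the kernel of
  \<open>Phi\<close> will show this kernel to be the least such subspace.\<close>

lemma rel_add:
  assumes "length us + length vs = n + 2" "set us \<union> {x, y} \<union> set vs \<subseteq> carrier A"
  shows "gen (us @ (x \<oplus> y) # vs) - gen (us @ x # vs) - gen (us @ y # vs) \<in> U"
proof -
  have "gen (us @ (x \<oplus> y) # vs) - gen (us @ x # vs) - gen (us @ y # vs) \<in> carrier (bar_free A n)"
    unfolding bar_free_simps mem_Collect_eq
    by (intro keys_diff_subset) (use assms closed in \<open>auto simp: lists3_def\<close>)
  moreover have "gen (us @ (x \<oplus> y) # vs) - gen (us @ x # vs) - gen (us @ y # vs) \<in> multilinear_rels A"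
    unfolding multilinear_rels_def using assms(2) by blast
  ultimately show ?thesis using rels by blast
qed

lemma rel_smult:
  assumes "length us + length vs = n + 2" "set us \<union> {x} \<union> set vs \<subseteq> carrier A"
  shows "gen (us @ (c \<odot> x) # vs) - scale c (gen (us @ x # vs)) \<in> U"
proof -
  have "gen (us @ (c \<odot> x) # vs) - scale c (gen (us @ x # vs)) \<in> carrier (bar_free A n)"
    unfolding bar_free_simps mem_Collect_eq
    by (intro keys_diff_subset keys_scale_subset) (use assms closed in \<open>auto simp: lists3_def\<close>)
  moreover have "gen (us @ (c \<odot> x) # vs) - scale c (gen (us @ x # vs)) \<in> multilinear_rels A"
    unfolding multilinear_rels_def using assms(2) by blast
  ultimately show ?thesis using rels by blast
qed

lemma rel_balanced:
  assumes "length us = n" "{m, u, v} \<union> set us \<subseteq> carrier A"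
  shows "gen (m # u # us @ [v]) - gen ((v \<otimes> m \<otimes> u) # \<one> # us @ [\<one>]) \<in> U"
proof -
  let ?g = "gen ((v \<otimes> m \<otimes> u) # \<one> # us @ [\<one>]) - gen (m # u # us @ [v])"
  have "?g = gen ((v \<otimes> m \<otimes> u) # \<one> # us @ [\<one>]) - gen (m # (u \<otimes> \<one>) # us @ [\<one> \<otimes> v])"
    using assms by (simp add: mult_one one_mult)
  then have "?g \<in> balanced_rels A"
    unfolding balanced_rels_def using assms(2) one_closed by blast
  moreover have "?g \<in> carrier (bar_free A n)"
    unfolding bar_free_simps mem_Collect_eq
    by (intro keys_diff_subset) (use assms closed in \<open>auto simp: lists3_def\<close>)
  ultimately have "- ?g \<in> U" using rels subspD(4)[OF sub] by blast
  then show ?thesis by simp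
qed

text \<open>Additivity is available only for two summands at a time, so the coordinates are split
  off one by one, by induction on a finite set containing the support of
  \<open>co x\<close>.\<close>

lemma rel_entry:
  assumes uv: "length us + length vs = n + 2" "set us \<union> set vs \<subseteq> carrier A" and x: "x \<in> carrier A"
  shows "gen (us @ x # vs) - (\<Sum>l\<in>UNIV. scale (co x l) (gen (us @ bas l # vs))) \<in> U"
proof -
  have "gen (us @ x # vs) - (\<Sum>l\<in>L. scale (co x l) (gen (us @ bas l # vs))) \<in> U"
    if "finite L" "x \<in> carrier A" "\<forall>l. l \<notin> L \<longrightarrow> co x l = 0" for L x
    using that
  proof (induction L arbitrary: x rule: finite_induct)
    case empty
    \<comment> \<open>Without nonzero coordinates \<open>x\<close> is its own zero multiple, and
      homogeneity with scalar 0 puts the list into \<open>U\<close>.\<close>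
    have "x = 0 \<odot> x" by (rule co_eqI) (use empty closed in \<open>auto simp: co_smult\<close>)
    then show ?case using rel_smult[of us vs x 0] uv empty by simp
  next
    case (insert k L)
    \<comment> \<open>Adding \<open>y\<close> deletes the coordinate at \<open>k\<close>, adding
      \<open>z\<close> restores it.\<close>
    define y where "y = (- co x k) \<odot> bas k"
    define z where "z = co x k \<odot> bas k"
    have yz: "y \<in> carrier A" "z \<in> carrier A" by (simp_all add: y_def z_def closed bas_closed)
    have co_yz: "co y l = (if l = k then - co x k else 0)" "co z l = (if l = k then co x k else 0)" for l
      by (simp_all add: y_def z_def co_smult bas_closed co_bas)
    let ?x = "x \<oplus> y"
    have x': "?x \<in> carrier A" using insert yz closed by auto
    have "x = ?x \<oplus> z" by (rule co_eqI) (use insert x' yz closed in \<open>auto simp: co_add co_yz\<close>)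
    then have a: "gen (us @ x # vs) - gen (us @ ?x # vs) - gen (us @ z # vs) \<in> U"
      using rel_add[of us vs ?x z] uv x' yz by simp
    have b: "gen (us @ z # vs) - scale (co x k) (gen (us @ bas k # vs)) \<in> U"
      unfolding z_def using rel_smult[of us vs "bas k"] uv bas_closed by simp
    have c: "gen (us @ ?x # vs) - (\<Sum>l\<in>L. scale (co ?x l) (gen (us @ bas l # vs))) \<in> U"
      by (rule insert.IH[OF x']) (use insert.prems yz in \<open>auto simp: co_add co_yz\<close>)
    have d: "(\<Sum>l\<in>L. scale (co ?x l) (gen (us @ bas l # vs))) = (\<Sum>l\<in>L. scale (co x l) (gen (us @ bas l # vs)))"
      by (rule sum.cong) (use insert yz in \<open>auto simp: co_add co_yz\<close>)
    from subspD(2)[OF sub subspD(2)[OF sub a b] c] show ?case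
      using insert.hyps by (simp add: d algebra_simps)
  qed
  from this[of UNIV x] x show ?thesis by simp
qed

text \<open>The prefix \<open>us\<close> collects the entries already replaced by basis elements and
  hence varies in the induction.\<close>

lemma rel_tens:
  assumes "length us + length ys + length vs = n + 3" "set us \<union> set ys \<union> set vs \<subseteq> carrier A"
  shows "gen (us @ ys @ vs) - lin_ext (\<lambda>w. gen (us @ map bas w @ vs)) (tens ys) \<in> U"
  using assms
proof (induction ys arbitrary: us)
  case Nil
  then show ?case using subspD(1)[OF sub] by simp
next
  case (Cons y ys)
  have e: "lin_ext (\<lambda>w. gen (us @ map bas w @ vs)) (pre l z) = lin_ext (\<lambda>w. gen ((us @ [bas l]) @ map bas w @ vs)) z" for l z
    by (rule linear_op_eqI[where x = z]) (auto intro!: lin_intros)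
  have "gen (us @ y # ys @ vs) - (\<Sum>l\<in>UNIV. scale (co y l) (gen (us @ bas l # ys @ vs))) \<in> U"
    using rel_entry[of us "ys @ vs" y] Cons.prems by simp
  moreover have "(\<Sum>l\<in>UNIV. scale (co y l) (gen ((us @ [bas l]) @ ys @ vs)
      - lin_ext (\<lambda>w. gen ((us @ [bas l]) @ map bas w @ vs)) (tens ys))) \<in> U"
    using Cons.prems bas_closed by (intro subsp_sum[OF sub] subspD(3)[OF sub] Cons.IH) auto
  ultimately have "(gen (us @ y # ys @ vs) - (\<Sum>l\<in>UNIV. scale (co y l) (gen (us @ bas l # ys @ vs)))) +
     (\<Sum>l\<in>UNIV. scale (co y l) (gen ((us @ [bas l]) @ ys @ vs)
      - lin_ext (\<lambda>w. gen ((us @ [bas l]) @ map bas w @ vs)) (tens ys))) \<in> U"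
    by (rule subspD(2)[OF sub])
  then show ?case
    by (simp add: ext_def lin_ext_sum e scale_diff sum_subtractf)
qed

lemma rel_lift:
  assumes xs: "xs \<in> lists3 n"
  shows "gen xs - lin_ext (\<lambda>w. gen (lift w)) (Phi_list xs) \<in> U"
proof -
  obtain m u us v where x: "xs = m # u # us @ [v]" "length us = n"
    using xs list_cases3 unfolding lists3_def by blast
  have c: "{m, u, v} \<union> set us \<subseteq> carrier A" using xs by (auto simp: lists3_def x)
  define y where "y = v \<otimes> m \<otimes> u"
  have y: "y \<in> carrier A" using c closed by (auto simp: y_def)
  have 1: "gen xs - gen (y # \<one> # us @ [\<one>]) \<in> U"
    unfolding x(1) y_def by (rule rel_balanced[OF x(2) c])
  have 2: "gen (y # \<one> # us @ [\<one>]) - (\<Sum>l\<in>UNIV. scale (co y l) (gen (bas l # \<one> # us @ [\<one>]))) \<in> U"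
    using rel_entry[of "[]" "\<one> # us @ [\<one>]" y] y x c closed by simp
  have 3: "(\<Sum>l\<in>UNIV. scale (co y l) (gen ([bas l, \<one>] @ us @ [\<one>])
      - lin_ext (\<lambda>w. gen ([bas l, \<one>] @ map bas w @ [\<one>])) (tens us))) \<in> U"
    using x c closed bas_closed by (intro subsp_sum[OF sub] subspD(3)[OF sub] rel_tens) auto
  have e: "lin_ext (\<lambda>w. gen (lift w)) (pre l z) = lin_ext (\<lambda>w. gen ([bas l, \<one>] @ map bas w @ [\<one>])) z" for l z
    by (rule linear_op_eqI[where x = z]) (auto simp: lift_def from_hochschild_def intro!: lin_intros)
  have P: "Phi_list xs = tens (y # us)"
    using Phi_to_hochschild[of xs n] xs by (simp add: lists3_def x(1) to_hochschild_simp y_def)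
  from subspD(2)[OF sub subspD(2)[OF sub 1 2] 3] show ?thesis
    unfolding P by (simp add: ext_def lin_ext_sum e scale_diff sum_subtractf)
qed

text \<open>By \<open>rel_lift\<close> every combination is congruent modulo \<open>U\<close> to the
  lift of its coordinates, which is zero here.\<close>

lemma kernel_subset:
  assumes "supp x \<subseteq> lists3 n" "Phi x = 0" shows "x \<in> U"
proof -
  let ?P = "\<lambda>x. lin_ext (\<lambda>w. gen (lift w)) (Phi x)"
  have "(\<Sum>k\<in>supp x. scale (coef x k) (gen k - ?P (gen k))) \<in> U"
    using assms(1) by (intro subsp_sum[OF sub] subspD(3)[OF sub]) (auto simp: rel_lift)
  moreover have "linear_op (\<lambda>x. x - ?P x)" by (intro lin_intros)
  ultimately have "x - ?P x \<in> U" using linear_op_expand[of "\<lambda>x. x - ?P x" x] by simp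
  then show ?thesis by (simp add: assms(2))
qed

end

lemma bar_rels_eq: "bar_rels A n = {x. supp x \<subseteq> lists3 n \<and> Phi x = 0}"
proof -
  have "bar_rels A n = {x \<in> carrier (bar_free A n). x \<in> {x. supp x \<subseteq> lists3 n \<and> Phi x = 0}}"
    unfolding bar_rels_def
  proof (rule span_of_coord[OF lin_coord_bar_free])
    show "subsp {x. supp x \<subseteq> lists3 n \<and> Phi x = 0}"
      by (simp add: subsp_def keys_add_subset keys_scale_subset)
  qed (use kernel_subset Phi_rels in \<open>auto simp: bar_free_simps\<close>)
  then show ?thesis by (auto simp: bar_free_simps)
qed

lemma set_lift: "w \<noteq> [] \<Longrightarrow> length w = Suc n \<Longrightarrow> lift w \<in> lists3 n"
  by (cases w) (auto simp: lift_def from_hochschild_def lists3_def bas_closed one_closed)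

lemma tens_map_bas: "tens (map bas w) = gen w"
  by (induction w) (simp_all add: ext_bas)

lemma Phi_lift: "w \<noteq> [] \<Longrightarrow> Phi_list (lift w) = gen w"
  by (cases w) (simp_all add: lift_def Phi_from_hochschild ext_bas tens_map_bas)

definition chains_of_length :: "nat \<Rightarrow> chain set" where
  "chains_of_length n = {x. supp x \<subseteq> {w. length w = n}}"

lemma keys_Phi_list: "xs \<in> lists3 n \<Longrightarrow> Phi_list xs \<in> chains_of_length (Suc n)"
proof -
  assume xs: "xs \<in> lists3 n"
  then have "length (to_hochschild A xs) = Suc n" by (simp add: lists3_def to_hochschild_def)
  then show ?thesis
    using Phi_to_hochschild[of xs n] xs of_length_tens[of "to_hochschild A xs"]
    by (simp add: lists3_def chains_of_length_def of_length_def)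
qed

lemma Phi_image: "Phi ` {x. supp x \<subseteq> lists3 n} = chains_of_length (Suc n)"
proof
  show "Phi ` {x. supp x \<subseteq> lists3 n} \<subseteq> chains_of_length (Suc n)"
  proof clarify
    fix x :: "'a list \<Rightarrow>\<^sub>0 complex" assume x: "supp x \<subseteq> lists3 n"
    have "supp (Phi x) \<subseteq> {w. length w = Suc n}"
      by (rule keys_linear_op[OF linear_Phi]) (use x keys_Phi_list in \<open>auto simp: chains_of_length_def\<close>)
    then show "Phi x \<in> chains_of_length (Suc n)" by (simp add: chains_of_length_def)
  qed
  show "chains_of_length (Suc n) \<subseteq> Phi ` {x. supp x \<subseteq> lists3 n}"
  proof
    fix z assume z: "z \<in> chains_of_length (Suc n)"
    let ?x = "lin_ext (\<lambda>w. gen (lift w)) z"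
    have ne: "w \<noteq> []" "length w = Suc n" if "w \<in> supp z" for w
      using that z by (auto simp: chains_of_length_def)
    have "Phi ?x = z"
      by (rule linear_op_eqI[where x = z]) (use ne in \<open>auto simp: Phi_lift intro!: lin_intros\<close>)
    moreover have "supp ?x \<subseteq> lists3 n"
      by (rule keys_lin_ext) (use ne set_lift in auto)
    ultimately show "z \<in> Phi ` {x. supp x \<subseteq> lists3 n}" by force
  qed
qed

definition F :: "('a list \<Rightarrow>\<^sub>0 complex) set \<Rightarrow> chain" where
  "F Y = Phi (SOME y. y \<in> Y)"

lemma lin_coord_bar_space: "lin_coord (bar_space A n) (chains_of_length (Suc n)) F"
  and F_coset: "supp x \<subseteq> lists3 n \<Longrightarrow> F (bar_rels A n +>\<^bsub>bar_free A n\<^esub> x) = Phi x"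
  and carrier_bar_space: "carrier (bar_space A n) =
     (\<lambda>x. bar_rels A n +>\<^bsub>bar_free A n\<^esub> x) ` {x. supp x \<subseteq> lists3 n}"
proof -
  have N: "bar_rels A n = {y \<in> carrier (bar_free A n). Phi y = 0}"
    by (auto simp: bar_rels_eq bar_free_simps)
  note L = lin_coord_quotient[OF lin_coord_bar_free linear_Phi N]
  show "lin_coord (bar_space A n) (chains_of_length (Suc n)) F"
    using L(1) unfolding bar_space_def Phi_image F_def[abs_def] .
  show "supp x \<subseteq> lists3 n \<Longrightarrow> F (bar_rels A n +>\<^bsub>bar_free A n\<^esub> x) = Phi x"
    using L(2)[of x] unfolding F_def bar_free_simps by simp
  show "carrier (bar_space A n) =
     (\<lambda>x. bar_rels A n +>\<^bsub>bar_free A n\<^esub> x) ` {x. supp x \<subseteq> lists3 n}"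
    using L(3) unfolding bar_space_def bar_free_simps .
qed

lemma bar_coset: "supp x \<subseteq> lists3 n \<Longrightarrow>
    bar_rels A n +>\<^bsub>bar_free A n\<^esub> x = {y. supp y \<subseteq> lists3 n \<and> Phi y = Phi x}"
  using coset_coord[OF lin_coord_bar_free linear_Phi, of x n]
  by (simp add: bar_rels_eq bar_free_simps)

subsection \<open>The grading\<close>

lemma homog_mult: "x \<in> homog A i \<Longrightarrow> y \<in> homog A j \<Longrightarrow> x \<otimes> y \<in> homog A (i + j)"
proof -
  assume x: "x \<in> homog A i" and y: "y \<in> homog A j"
  then have c: "x \<in> carrier A" "y \<in> carrier A" by (auto simp: homog_iff)
  have "(if arrow l then 1 else 0) = i + j" if "co (x \<otimes> y) l \<noteq> 0" for l
  proof -
    have "\<exists>a b. lmult a b = Some l \<and> co x a \<noteq> 0 \<and> co y b \<noteq> 0"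
    proof (rule ccontr)
      assume "\<not> ?thesis"
      then have "(if lmult a b = Some l then co x a * co y b else 0) = 0" for a b by auto
      then show False using that unfolding co_mult[OF c] by simp
    qed
    then obtain a b where ab: "lmult a b = Some l" "co x a \<noteq> 0" "co y b \<noteq> 0" by blast
    have "(if arrow a then 1 else 0) = i" using x ab(2) by (simp add: homog_iff)
    moreover have "(if arrow b then 1 else 0) = j" using y ab(3) by (simp add: homog_iff)
    ultimately show ?thesis using lmult_SomeD[OF ab(1)] by auto
  qed
  then show ?thesis using c closed by (auto simp: homog_iff)
qed

lemma keys_tens_homog:
  "list_all2 (\<lambda>x j. x \<in> homog A j) xs ds \<Longrightarrow> supp (tens xs) \<subseteq> words (length xs) (sum_list ds)"
proof (induction rule: list_all2_induct)
  case Nil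
  then show ?case by (simp add: words_def)
next
  case (Cons x xs d ds)
  show ?case unfolding tens.simps ext_def
  proof (intro keys_sum_subset)
    fix l
    show "supp (scale (co x l) (pre l (tens xs))) \<subseteq> words (length (x # xs)) (sum_list (d # ds))"
    proof (cases "co x l = 0")
      case False
      then have d: "(if arrow l then 1 else 0) = d" using Cons by (simp add: homog_iff)
      have "supp (pre l (tens xs)) \<subseteq> (#) l ` words (length xs) (sum_list ds)"
        using keys_pre[of l "tens xs"] Cons by blast
      also have "\<dots> \<subseteq> words (length (x # xs)) (sum_list (d # ds))"
        by (auto simp: words_def d[symmetric])
      finally show ?thesis by (rule keys_scale_subset)
    qed simp
  qed
qed

lemma homog_carrier: "x \<in> homog A j \<Longrightarrow> x \<in> carrier A"
  by (simp add: homog_iff)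

lemma bas_homog: "bas l \<in> homog A (if arrow l then 1 else 0)"
  by (simp add: homog_iff bas_closed co_bas split: if_splits)

lemma one_homog: "\<one> \<in> homog A 0"
  by (auto simp: homog_iff one_closed co_one)

lemma keys_Phi_list_homog:
  assumes "length xs = n + 3" "list_all2 (\<lambda>x j. x \<in> homog A j) xs ds"
  shows "supp (Phi_list xs) \<subseteq> words (Suc n) (sum_list ds)" "xs \<in> lists3 n"
proof -
  show l: "xs \<in> lists3 n"
  proof -
    have "x \<in> carrier A" if "x \<in> set xs" for x
      using that assms(2) homog_carrier by (metis in_set_conv_nth list_all2_conv_all_nth)
    then show ?thesis using assms(1) by (auto simp: lists3_def)
  qed
  obtain m u us v where xs: "xs = m # u # us @ [v]" "length us = n" using assms(1) by (rule list_cases3)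
  have "length ds = n + 3" using assms list_all2_lengthD by metis
  then obtain i j es k where ds: "ds = i # j # es @ [k]" "length es = n" by (rule list_cases3)
  have h: "m \<in> homog A i" "u \<in> homog A j" "v \<in> homog A k" "list_all2 (\<lambda>x j. x \<in> homog A j) us es"
    using assms(2) xs(2) ds(2) by (auto simp: xs ds list_all2_append)
  have "list_all2 (\<lambda>x j. x \<in> homog A j) ((v \<otimes> m \<otimes> u) # us) ((k + i + j) # es)"
    using h by (auto intro!: homog_mult)
  from keys_tens_homog[OF this] show "supp (Phi_list xs) \<subseteq> words (Suc n) (sum_list ds)"
    using Phi_to_hochschild[of xs n] l xs(2)
    by (simp add: lists3_def xs(1) to_hochschild_simp ds(1) add_ac)
qed

lemma words_subset_chains: "{x. supp x \<subseteq> words n d} \<subseteq> chains_of_length n"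
  by (auto simp: chains_of_length_def words_def)

text \<open>Homogeneous tensors have coordinates of the right degree; conversely each word of degree
  \<open>d\<close> is the coordinate of the homogeneous tensor \<open>lift w\<close>.\<close>

lemma carrier_bar_chains:
  "carrier (bar_chains A n d) = {Y \<in> carrier (bar_space A n). supp (F Y) \<subseteq> words (Suc n) d}"
proof -
  let ?T = "{bar_rels A n +>\<^bsub>bar_free A n\<^esub> gen xs | xs ds. length xs = n + 3 \<and>
          list_all2 (\<lambda>x j. x \<in> homog A j) xs ds \<and> sum_list ds = d}"
  let ?U = "{x :: chain. supp x \<subseteq> words (Suc n) d}"
  have "span_of (bar_space A n) ?T = {Y \<in> carrier (bar_space A n). F Y \<in> ?U}"
  proof (rule span_of_coord[OF lin_coord_bar_space])
    show "?T \<subseteq> carrier (bar_space A n)"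
      unfolding carrier_bar_space using keys_Phi_list_homog(2) by auto
    show "subsp ?U" by (rule subsp_keys)
    show "F ` ?T \<subseteq> ?U"
    proof clarify
      fix xs ds w assume xs: "length xs = n + 3" "list_all2 (\<lambda>x j. x \<in> homog A j) xs ds" "d = sum_list ds"
        and w: "w \<in> supp (F (bar_rels A n +>\<^bsub>bar_free A n\<^esub> gen xs))"
      then show "w \<in> words (Suc n) (sum_list ds)"
        using keys_Phi_list_homog[OF xs(1,2)] F_coset[of "gen xs" n] by auto
    qed
    show "?U \<subseteq> chains_of_length (Suc n)" by (rule words_subset_chains)
    show "?U \<subseteq> U'" if U': "subsp U'" "F ` ?T \<subseteq> U'" for U'
    proof
      have g: "gen w \<in> U'" if w: "w \<in> words (Suc n) d" for w
      proof -
        obtain l v where lv: "w = l # v" using w by (cases w) (auto simp: words_def)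
        let ?deg = "\<lambda>l. if arrow l then 1 else 0 :: int"
        have "list_all2 (\<lambda>x j. x \<in> homog A j) (map bas v) (map ?deg v)"
          using bas_homog by (auto simp: list_all2_conv_all_nth simp del: if_split)
        \<comment> \<open>The entries of degree 0 in the second and in the last place belong to the
          units inserted by \<open>lift\<close>.\<close>
        then have "list_all2 (\<lambda>x j. x \<in> homog A j) (lift w) (?deg l # 0 # map ?deg v @ [0])"
          using bas_homog[of l] one_homog
          by (simp add: lift_def lv from_hochschild_def list_all2_appendI)
        moreover have "sum_list (map ?deg v) = int (length (filter arrow v))"
          by (induction v) auto
        then have "sum_list (?deg l # 0 # map ?deg v @ [0]) = d" using w by (auto simp: lv words_def)
        moreover have "length (lift w) = n + 3" using w by (simp add: lift_def lv from_hochschild_def words_def)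
        ultimately have "bar_rels A n +>\<^bsub>bar_free A n\<^esub> gen (lift w) \<in> ?T" by blast
        then have "F (bar_rels A n +>\<^bsub>bar_free A n\<^esub> gen (lift w)) \<in> U'" using U'(2) by blast
        then show ?thesis
          using F_coset[of "gen (lift w)" n] set_lift[of w n] w Phi_lift[of w]
          by (simp add: words_def lv)
      qed
      fix z assume "z \<in> ?U"
      then have "(\<Sum>k\<in>supp z. scale (coef z k) (gen k)) \<in> U'"
        by (intro subsp_sum[OF U'(1)] subspD(3)[OF U'(1)] g) auto
      then show "z \<in> U'" using gen_expansion[of z] by simp
    qed
  qed
  then show ?thesis by (simp add: bar_chains_def)
qed

end

subsection \<open>Vectors of length three as formal linear combinations\<close>

text \<open>\<open>lin_coord\<close> takes values in finitely supported functions; on three vertices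
  every function is one.\<close>

definition pvec :: "(3 \<Rightarrow> complex) \<Rightarrow> (3 \<Rightarrow>\<^sub>0 complex)" where
  "pvec f = (\<Sum>i\<in>UNIV. scale (f i) (gen i))"

lemma lookup_pvec [simp]: "coef (pvec f) i = f i"
proof -
  have "coef (pvec f) i = (\<Sum>j\<in>UNIV. if j = i then f i else 0)"
    unfolding pvec_def lookup_sum by (rule sum.cong) (auto simp: lookup_single when_def)
  then show ?thesis by simp
qed

lemma pvec_eq_iff: "pvec f = pvec g \<longleftrightarrow> f = g"
  by (metis lookup_pvec ext)

lemma pvec_zero: "pvec (\<lambda>_. 0) = 0"
  by (rule poly_mapping_eqI) simp

lemma subsp_image: "linear_op f \<Longrightarrow> subsp U \<Longrightarrow> subsp (f ` U)"
  by (auto simp: subsp_def linear_op_add[symmetric] linear_op_scale[symmetric] intro!: image_eqI[where x = 0] linear_op_zero[symmetric])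

context cyclic_algebra
begin

subsection \<open>The differentials\<close>

lemma bd_tens:
  assumes "set ys \<subseteq> carrier A"
  shows "bd (tens ys) = (\<Sum>i<length ys - 1. scale ((-1) ^ i) (tens (merge_at A i ys)))"
  using assms
proof (induction ys)
  case (Cons y ys)
  show ?case
  proof (cases ys)
    case Nil
    then show ?thesis by (simp add: ext_linear[OF linear_bd] ext_fun_zero bd_pre)
  next
    case (Cons x xs)
    have s: "tens (merge_at A (Suc i) (y # ys)) = ext y (\<lambda>l. pre l (tens (merge_at A i ys)))" for i
      by (simp add: merge_at_def)
    have "(\<Sum>i<length (y # ys) - 1. scale ((-1) ^ i) (tens (merge_at A i (y # ys))))
        = tens (merge_at A 0 (y # ys)) + (\<Sum>i<length xs. scale ((-1) ^ Suc i) (tens (merge_at A (Suc i) (y # ys))))"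
      by (simp only: Cons length_Cons diff_Suc_1 sum.lessThan_Suc_shift) simp
    also have "tens (merge_at A 0 (y # ys)) = ext y (\<lambda>l. lact l (tens ys))"
      using tens_mult_Cons[of y x xs] Cons Cons.prems by (simp add: merge_at_def)
    also have "(\<Sum>i<length xs. scale ((-1) ^ Suc i) (tens (merge_at A (Suc i) (y # ys))))
        = - ext y (\<lambda>l. pre l (bd (tens ys)))"
      using Cons.IH Cons.prems unfolding s
      by (simp add: Cons scale_uminus_left sum_negf ext_fun_sum ext_fun_scale)
    finally show ?thesis
      by (simp add: ext_linear[OF linear_bd] bd_pre ext_fun_diff)
  qed
qed simp

lemma merge_at_Suc: "merge_at A (Suc i) (m # ys) = m # merge_at A i ys"
  by (simp add: merge_at_def)

lemma Phi_bar_diff: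
  assumes "xs \<in> lists3 (Suc n)"
  shows "Phi (bar_diff_list A xs) = hoch (Phi_list xs)"
    and "supp (bar_diff_list A xs) \<subseteq> lists3 n"
proof -
  obtain m ys where xs: "xs = m # ys" using assms by (cases xs) (auto simp: lists3_def)
  have ys: "length ys = n + 3" "set ys \<subseteq> carrier A" "m \<in> carrier A"
    using assms by (auto simp: lists3_def xs)
  have e: "length xs - 2 = length ys - 1" by (simp add: xs)
  show "Phi (bar_diff_list A xs) = hoch (Phi_list xs)"
    unfolding bar_diff_list_def e
    by (simp add: xs merge_at_Suc ext_linear[OF linear_hoch] hoch_wrap bd_tens[OF ys(2)]
        ext_fun_sum ext_fun_scale)
  have "merge_at A (i + 1) xs \<in> lists3 n" if "i < length ys - 1" for i
  proof -
    have "i < length ys" "Suc i < length ys" using that by simp_all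
    then have "ys ! i \<in> carrier A" "ys ! Suc i \<in> carrier A"
      using subsetD[OF ys(2) nth_mem] by blast+
    then have "ys ! i \<otimes> ys ! Suc i \<in> carrier A" by (rule mult_closed)
    then show ?thesis
      using that ys set_take_subset[of i ys] set_drop_subset[of "i + 2" ys]
      by (auto simp: lists3_def xs merge_at_Suc merge_at_def)
  qed
  then show "supp (bar_diff_list A xs) \<subseteq> lists3 n"
    unfolding bar_diff_list_def e
    by (intro keys_sum_subset keys_scale_subset) auto
qed

lemma rotl_pre: "of_length L t \<Longrightarrow> rotl (pre l t) = scale ((-1) ^ L) (post l t)"
  by (rule linear_op_eqI[where x = t]) (auto simp: rotl_gen of_length_def intro!: lin_intros)

lemma rotr_post: "of_length L t \<Longrightarrow> rotr (post l t) = scale ((-1) ^ L) (pre l t)"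
  by (rule linear_op_eqI[where x = t]) (auto simp: rotr_gen of_length_def intro!: lin_intros)

lemma rotl_tens: "rotl (tens (x # xs)) = scale ((-1) ^ length xs) (tens (xs @ [x]))"
  by (simp add: ext_linear[OF linear_rotl] rotl_pre[OF of_length_tens] tens_snoc ext_fun_scale)

lemma rotr_tens: "rotr (tens (xs @ [x])) = scale ((-1) ^ length xs) (tens (x # xs))"
  by (simp add: ext_linear[OF linear_rotr] rotr_post[OF of_length_tens] tens_snoc ext_fun_scale)

lemma rotl_pow_tens:
  "xs \<noteq> [] \<Longrightarrow> (rotl ^^ i) (tens xs) = scale ((-1) ^ ((length xs - 1) * i)) (tens (rotate i xs))"
proof (induction i)
  case (Suc i)
  obtain y ys where y: "rotate i xs = y # ys" using Suc.prems by (cases "rotate i xs") auto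
  then have "length ys = length xs - 1" by (metis length_Cons length_rotate diff_Suc_1)
  then have "rotl (tens (rotate i xs)) = scale ((-1) ^ (length xs - 1)) (tens (rotate (Suc i) xs))"
    using rotl_tens[of y ys] by (simp add: y)
  then show ?case using Suc by (simp add: power_add mult.commute)
qed simp

lemma unit_pre_tens: "unit_pre (tens xs) = tens (\<one> # xs)"
  by (simp add: unit_pre_def ext_one)

lemma Phi_connes:
  assumes "xs \<in> lists3 n"
  shows "Phi (connes_list A xs) = connes (Phi_list xs)"
    and "supp (connes_list A xs) \<subseteq> lists3 (Suc n)"
proof -
  define as where "as = to_hochschild A xs"
  obtain m u us v where xs: "xs = m # u # us @ [v]" "length us = n"
    using assms list_cases3 unfolding lists3_def by blast
  have c: "{m, u, v} \<union> set us \<subseteq> carrier A" using assms by (auto simp: lists3_def xs)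
  have as: "length as = Suc n" "set as \<subseteq> carrier A"
    using c closed by (auto simp: as_def xs to_hochschild_simp)
  let ?a = "\<lambda>i. from_hochschild A (\<one> # rotate i as)"
  let ?b = "\<lambda>i. from_hochschild A (last (rotate i as) # \<one> # butlast (rotate i as))"
  have C: "connes_list A xs = (\<Sum>i<Suc n. scale ((-1) ^ (n * i)) (gen (?a i) + scale ((-1) ^ n) (gen (?b i))))"
    by (simp only: connes_list_def as_def[symmetric] Let_def as(1) diff_Suc_1 lessThan_Suc_atMost)
  have bs: "\<exists>ys y. rotate i as = ys @ [y] \<and> length ys = n \<and> set ys \<subseteq> carrier A \<and> y \<in> carrier A" for i
  proof -
    have "rotate i as \<noteq> []" using as(1) by auto
    then obtain ys y where y: "rotate i as = ys @ [y]" by (metis rev_exhaust)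
    then have "length (ys @ [y]) = Suc n" "set (ys @ [y]) \<subseteq> carrier A"
      using as by (metis length_rotate, metis set_rotate)
    then show ?thesis using y by auto
  qed
  have P: "Phi (gen (?a i)) = unit_pre (tens (rotate i as))"
    "scale ((-1) ^ n) (Phi (gen (?b i))) = - rotr (unit_pre (tens (rotate i as)))" for i
  proof -
    obtain ys y where y: "rotate i as = ys @ [y]" "length ys = n" using bs by blast
    show "Phi (gen (?a i)) = unit_pre (tens (rotate i as))"
      by (simp only: Phi_gen Phi_from_hochschild unit_pre_tens)
    \<comment> \<open>Rotating a tensor of \<open>n + 2\<close> entries costs the sign of
      \<open>Suc n\<close>, so the second summand of the Connes map is minus the rotation of the
      first.\<close>
    have "rotr (tens ((\<one> # ys) @ [y])) = scale ((-1) ^ Suc n) (tens (y # \<one> # ys))"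
      unfolding rotr_tens using y by simp
    then show "scale ((-1) ^ n) (Phi (gen (?b i))) = - rotr (unit_pre (tens (rotate i as)))"
      unfolding Phi_gen Phi_from_hochschild unit_pre_tens y(1) by (simp add: scale_uminus_left)
  qed
  have "Phi (connes_list A xs) = (\<Sum>i<Suc n. scale ((-1) ^ (n * i))
      (unit_pre (tens (rotate i as)) - rotr (unit_pre (tens (rotate i as)))))"
    unfolding C Phi_simps scale_scale
    by (intro sum.cong refl) (simp only: P[unfolded Phi_gen] Phi_simps Phi_gen diff_conv_add_uminus)
  also have "\<dots> = connes (tens as)"
  proof -
    have "as \<noteq> []" using as(1) by auto
    have l: "of_length (Suc n) (tens as)" using of_length_tens[of as] as(1) by simp
    have "nrm (tens as) = (\<Sum>i<Suc n. scale ((-1) ^ (n * i)) (tens (rotate i as)))"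
      unfolding nrm_eq[OF l] rotl_pow_tens[OF \<open>as \<noteq> []\<close>] as(1) diff_Suc_1 ..
    then show ?thesis unfolding connes_def
      by (simp only: unit_pre_simps rotr_simps scale_diff sum_subtractf)
  qed
  finally show "Phi (connes_list A xs) = connes (Phi_list xs)"
    using Phi_to_hochschild[of xs n] assms by (simp add: lists3_def as_def)
  have "?a i \<in> lists3 (Suc n)" "?b i \<in> lists3 (Suc n)" for i
  proof -
    obtain ys y where y: "rotate i as = ys @ [y]" "length ys = n" "set ys \<subseteq> carrier A" "y \<in> carrier A"
      using bs by blast
    then show "?a i \<in> lists3 (Suc n)" "?b i \<in> lists3 (Suc n)"
      unfolding y(1) using one_closed by (auto simp: from_hochschild_def lists3_def)
  qed
  then show "supp (connes_list A xs) \<subseteq> lists3 (Suc n)"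
    unfolding C by (intro keys_sum_subset keys_scale_subset keys_add_subset) auto
qed

text \<open>Common to the differential and the Connes map: if a map on lists is \<open>T\<close> in
  coordinates, then the map it induces on classes is well defined and is again
  \<open>T\<close>.\<close>

lemma induced_map_bar:
  assumes D: "\<And>xs. xs \<in> lists3 k \<Longrightarrow> Phi (D xs) = T (Phi_list xs)"
      "\<And>xs. xs \<in> lists3 k \<Longrightarrow> supp (D xs) \<subseteq> lists3 n"
    and T: "linear_op T"
    and Y: "Y \<in> carrier (bar_space A k)"
  defines "I \<equiv> induced_map (bar_free A n) (bar_rels A n) (lin_ext D)"
  shows "I Y \<in> carrier (bar_space A n)" "F (I Y) = T (F Y)"
proof -
  have P: "Phi (lin_ext D x) = T (Phi x)" if "supp x \<subseteq> lists3 k" for x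
    by (rule linear_op_eqI[where x = x]) (use that D T in \<open>auto intro!: lin_intros intro: linear_op_compose\<close>)
  have K: "supp (lin_ext D x) \<subseteq> lists3 n" if "supp x \<subseteq> lists3 k" for x
    by (rule keys_lin_ext) (use that D in auto)
  obtain x where x: "supp x \<subseteq> lists3 k" "Y = bar_rels A k +>\<^bsub>bar_free A k\<^esub> x"
    using Y by (auto simp: carrier_bar_space)
  have "I Y = bar_rels A n +>\<^bsub>bar_free A n\<^esub> lin_ext D x"
    unfolding I_def
  proof (rule induced_map_eq)
    show "x \<in> Y" unfolding x(2) bar_coset[OF x(1)] using x(1) by simp
    fix y assume "y \<in> Y"
    then have y: "supp y \<subseteq> lists3 k" "Phi y = Phi x" unfolding x(2) bar_coset[OF x(1)] by auto
    show "bar_rels A n +>\<^bsub>bar_free A n\<^esub> lin_ext D y = bar_rels A n +>\<^bsub>bar_free A n\<^esub> lin_ext D x"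
      using P[OF x(1)] P[OF y(1)] by (simp add: bar_coset K x(1) y)
  qed
  then show "I Y \<in> carrier (bar_space A n)" "F (I Y) = T (F Y)"
    using K[OF x(1)] P[OF x(1)] x F_coset by (auto simp: carrier_bar_space)
qed

lemma bar_diff_coord:
  assumes "Y \<in> carrier (bar_space A (Suc n))"
  shows "bar_diff A n Y \<in> carrier (bar_space A n)" "F (bar_diff A n Y) = hoch (F Y)"
  unfolding bar_diff_def
  by (rule induced_map_bar[OF Phi_bar_diff linear_hoch assms], assumption+)+

lemma connes_chain_coord:
  assumes "Y \<in> carrier (bar_space A n)"
  shows "connes_chain A n Y \<in> carrier (bar_space A (Suc n))" "F (connes_chain A n Y) = connes (F Y)"
  unfolding connes_chain_def
  by (rule induced_map_bar[OF Phi_connes linear_connes assms], assumption+)+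

lemma bar_space_image: "F ` {Y \<in> carrier (bar_space A n). F Y \<in> U} = U \<inter> chains_of_length (Suc n)"
  using lin_coordD(3)[OF lin_coord_bar_space, of n] by auto

lemma hcycles_subset: "hcycles n d \<subseteq> chains_of_length (Suc n)"
  using words_subset_chains[of "Suc n" d] by (auto simp: hcycles_def)

lemma cycles_eq: "cycles A n d = {Y \<in> carrier (bar_space A n). F Y \<in> hcycles n d}"
proof (cases n)
  case 0
  then show ?thesis using hoch_short by (auto simp: cycles_def carrier_bar_chains hcycles_def)
next
  case (Suc m)
  have "bar_diff A m Y = \<zero>\<^bsub>bar_space A m\<^esub> \<longleftrightarrow> hoch (F Y) = 0" if "Y \<in> carrier (bar_space A n)" for Y
  proof -
    note Z = lin_coordD(4,5)[OF lin_coord_bar_space, of m]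
    note W = bar_diff_coord[OF that[unfolded Suc]]
    show ?thesis
      using lin_coord_eqI[OF lin_coord_bar_space W(1) Z(1)] W(2) Z(2) by auto
  qed
  then have "Y \<in> cycles A n d \<longleftrightarrow> Y \<in> {Y \<in> carrier (bar_space A n). F Y \<in> hcycles n d}" for Y
    unfolding cycles_def carrier_bar_chains hcycles_def mem_Collect_eq Suc nat.case by blast
  then show ?thesis by blast
qed

lemma boundaries_eq: "boundaries A n d = {Y \<in> carrier (bar_space A n). F Y \<in> hboundaries n d}"
proof (intro equalityI subsetI)
  fix Y assume "Y \<in> boundaries A n d"
  then obtain Z where Z: "Z \<in> carrier (bar_chains A (Suc n) d)" "Y = bar_diff A n Z"
    by (auto simp: boundaries_def)
  then show "Y \<in> {Y \<in> carrier (bar_space A n). F Y \<in> hboundaries n d}"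
    using bar_diff_coord[of Z n] by (auto simp: carrier_bar_chains hboundaries_def)
next
  fix Y assume Y: "Y \<in> {Y \<in> carrier (bar_space A n). F Y \<in> hboundaries n d}"
  then obtain y where y: "supp y \<subseteq> words (Suc (Suc n)) d" "F Y = hoch y"
    by (auto simp: hboundaries_def)
  have "y \<in> F ` carrier (bar_space A (Suc n))"
    using lin_coordD(3)[OF lin_coord_bar_space, of "Suc n"] words_subset_chains y(1) by blast
  then obtain Z where Z: "Z \<in> carrier (bar_space A (Suc n))" "y = F Z" by (rule imageE) simp
  have "F Y = F (bar_diff A n Z)" unfolding bar_diff_coord(2)[OF Z(1)] y(2) Z(2) ..
  moreover have "Y \<in> carrier (bar_space A n)" using Y by blast
  ultimately have "Y = bar_diff A n Z"
    using lin_coord_eqI[OF lin_coord_bar_space _ bar_diff_coord(1)[OF Z(1)]] by blast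
  then show "Y \<in> boundaries A n d"
    using Z y by (auto simp: boundaries_def carrier_bar_chains)
qed

subsection \<open>Hochschild and cyclic homology\<close>

definition hvec :: "nat \<Rightarrow> int \<Rightarrow> chain \<Rightarrow> (3 \<Rightarrow>\<^sub>0 complex)" where
  "hvec n d z = pvec (hfun n d z)"

lemma linear_hvec: "linear_op (hvec n d)"
  unfolding linear_op_def hvec_def hfun_add hfun_scale
  by (auto intro!: poly_mapping_eqI simp: lookup_add)

lemma hvec_eq_0_iff: "z \<in> hcycles n d \<Longrightarrow> hvec n d z = 0 \<longleftrightarrow> z \<in> hboundaries n d"
  unfolding hvec_def pvec_zero[symmetric] pvec_eq_iff by (rule hfun_eq_0_iff)

lemma subsp_hcycles: "subsp (hcycles n d)"
  by (simp add: subsp_def hcycles_def keys_add_subset keys_scale_subset)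

definition HHfun :: "nat \<Rightarrow> int \<Rightarrow> ('a list \<Rightarrow>\<^sub>0 complex) set set \<Rightarrow> (3 \<Rightarrow>\<^sub>0 complex)" where
  "HHfun n d Z = hvec n d (F (SOME y. y \<in> Z))"

lemma lin_coord_cycles: "lin_coord ((bar_space A n)\<lparr>carrier := cycles A n d\<rparr>) (hcycles n d) F"
proof -
  have "F ` cycles A n d = hcycles n d"
    unfolding cycles_eq bar_space_image using hcycles_subset by blast
  then show ?thesis
    using lin_coord_restrict[OF lin_coord_bar_space, of "cycles A n d" n] subsp_hcycles
    by (simp add: cycles_eq)
qed

text \<open>Boundaries as the kernel of a linear map on the cycles, the form in which
  \<open>lin_coord_quotient\<close> yields the homology.\<close>

lemma boundaries_eq_kernel:
  "boundaries A n d = {y \<in> carrier ((bar_space A n)\<lparr>carrier := cycles A n d\<rparr>). hvec n d (F y) = 0}"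
proof -
  have "F y \<in> hboundaries n d \<longleftrightarrow> F y \<in> hcycles n d \<and> hvec n d (F y) = 0" for y
    using hvec_eq_0_iff[of "F y" n d] hboundaries_subset[of n d] by blast
  then show ?thesis by (simp add: boundaries_eq cycles_eq conj_assoc)
qed

lemma coset_carrier_update: "B +>\<^bsub>M\<lparr>carrier := Z\<rparr>\<^esub> x = B +>\<^bsub>M\<^esub> x"
  by (simp add: a_r_coset_def r_coset_def)

lemma lin_coord_HH': "lin_coord (HH A n d) (hvec n d ` hcycles n d) (HHfun n d)"
  and HHfun_coset: "x \<in> cycles A n d \<Longrightarrow> HHfun n d (boundaries A n d +>\<^bsub>bar_space A n\<^esub> x) = hvec n d (F x)"
  and carrier_HH: "carrier (HH A n d) = (\<lambda>x. boundaries A n d +>\<^bsub>bar_space A n\<^esub> x) ` cycles A n d"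
  and HH_coset: "x \<in> cycles A n d \<Longrightarrow> boundaries A n d +>\<^bsub>bar_space A n\<^esub> x
      = {y \<in> cycles A n d. hvec n d (F y) = hvec n d (F x)}"
proof -
  note L = lin_coord_quotient[OF lin_coord_cycles[of n d] linear_hvec boundaries_eq_kernel]
  show "lin_coord (HH A n d) (hvec n d ` hcycles n d) (HHfun n d)"
    using L(1) unfolding HH_def HHfun_def[abs_def] .
  show "x \<in> cycles A n d \<Longrightarrow> HHfun n d (boundaries A n d +>\<^bsub>bar_space A n\<^esub> x) = hvec n d (F x)"
    using L(2)[of x] unfolding HHfun_def coset_carrier_update by simp
  show "carrier (HH A n d) = (\<lambda>x. boundaries A n d +>\<^bsub>bar_space A n\<^esub> x) ` cycles A n d"
    using L(3) unfolding HH_def coset_carrier_update by simp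
  show "x \<in> cycles A n d \<Longrightarrow> boundaries A n d +>\<^bsub>bar_space A n\<^esub> x
      = {y \<in> cycles A n d. hvec n d (F y) = hvec n d (F x)}"
    using coset_coord[OF lin_coord_cycles[of n d] linear_hvec[of n d], of x, folded boundaries_eq_kernel]
    unfolding coset_carrier_update by simp
qed

lemma lin_coord_HH: "lin_coord (HH A n d) (pvec ` hval n d) (HHfun n d)"
  using lin_coord_HH'[of n d] unfolding hvec_def image_image[symmetric] hfun_image[symmetric]
  by (simp add: image_image)

text \<open>The representatives of a class differ by boundaries, which \<open>connes\<close> sends
  to boundaries; so all of them give the same coset in the target.\<close>

lemma connes_B_eq_zero_iff:
  assumes x: "x \<in> cycles A n d"
  shows "connes_B A n d (boundaries A n d +>\<^bsub>bar_space A n\<^esub> x) = \<zero>\<^bsub>HH A (Suc n) d\<^esub>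
    \<longleftrightarrow> connes (F x) \<in> hboundaries (Suc n) d"
proof -
  let ?Y = "boundaries A n d +>\<^bsub>bar_space A n\<^esub> x"
  have cyc: "connes_chain A n y \<in> cycles A (Suc n) d" "F (connes_chain A n y) = connes (F y)"
    if "y \<in> cycles A n d" for y
    using that connes_chain_coord[of y n] connes_cycle by (auto simp: cycles_eq)
  have "connes_B A n d ?Y = boundaries A (Suc n) d +>\<^bsub>bar_space A (Suc n)\<^esub> connes_chain A n x"
    unfolding connes_B_def
  proof (rule induced_map_eq)
    show "x \<in> ?Y" unfolding HH_coset[OF x] using x by simp
    fix y assume "y \<in> ?Y"
    then have y: "y \<in> cycles A n d" "hvec n d (F y) = hvec n d (F x)" unfolding HH_coset[OF x] by auto
    have "F y - F x \<in> hcycles n d" using x y(1) by (intro hcycles_diff) (auto simp: cycles_eq)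
    moreover have "hvec n d (F y - F x) = 0" by (simp add: linear_op_diff[OF linear_hvec] y(2))
    ultimately have "connes (F y - F x) \<in> hboundaries (Suc n) d"
      using hvec_eq_0_iff connes_boundary by blast
    then have "hvec (Suc n) d (connes (F y - F x)) = 0"
      using hvec_eq_0_iff hboundaries_subset by blast
    then have "hvec (Suc n) d (connes (F y)) = hvec (Suc n) d (connes (F x))"
      by (simp add: linear_op_diff[OF linear_hvec])
    then show "boundaries A (Suc n) d +>\<^bsub>bar_space A (Suc n)\<^esub> connes_chain A n y
        = boundaries A (Suc n) d +>\<^bsub>bar_space A (Suc n)\<^esub> connes_chain A n x"
      unfolding HH_coset[OF cyc(1)[OF y(1)]] HH_coset[OF cyc(1)[OF x]] cyc(2)[OF x] cyc(2)[OF y(1)] by simp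
  qed
  moreover have "\<zero>\<^bsub>HH A (Suc n) d\<^esub> = boundaries A (Suc n) d"
    by (simp add: HH_def quotient_simps)
  moreover have "boundaries A (Suc n) d = {y \<in> cycles A (Suc n) d. hvec (Suc n) d (F y) = 0}"
    using boundaries_eq_kernel[of "Suc n" d] by simp
  moreover have "connes (F x) \<in> hboundaries (Suc n) d \<longleftrightarrow> hvec (Suc n) d (F (connes_chain A n x)) = 0"
    unfolding cyc(2)[OF x] using hvec_eq_0_iff[of "connes (F x)" "Suc n" d] x connes_cycle by (auto simp: cycles_eq)
  moreover have "connes_chain A n x \<in> boundaries A (Suc n) d +>\<^bsub>bar_space A (Suc n)\<^esub> connes_chain A n x"
    unfolding HH_coset[OF cyc(1)[OF x]] using cyc(1)[OF x] by blast
  ultimately show ?thesis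
    unfolding HH_coset[OF cyc(1)[OF x]] by auto
qed

lemma lin_coord_HC:
  assumes "0 < n" shows "lin_coord (HC A n d) (pvec ` hcval (Suc n) d) (HHfun (Suc n) d)"
proof -
  let ?K = "{z \<in> hcycles (Suc n) d. connes z \<in> hboundaries (Suc (Suc n)) d}"
  let ?Z = "{z \<in> carrier (HH A (Suc n) d). connes_B A (Suc n) d z = \<zero>\<^bsub>HH A (Suc (Suc n)) d\<^esub>}"
  have "HHfun (Suc n) d ` ?Z = hvec (Suc n) d ` ?K"
  proof (intro equalityI subsetI)
    fix p assume "p \<in> HHfun (Suc n) d ` ?Z"
    then obtain x where "x \<in> cycles A (Suc n) d" "connes (F x) \<in> hboundaries (Suc (Suc n)) d" "p = hvec (Suc n) d (F x)"
      unfolding carrier_HH using connes_B_eq_zero_iff HHfun_coset by auto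
    then show "p \<in> hvec (Suc n) d ` ?K" by (auto simp: cycles_eq)
  next
    fix p assume "p \<in> hvec (Suc n) d ` ?K"
    then obtain z where z: "z \<in> ?K" "p = hvec (Suc n) d z" by auto
    have "z \<in> F ` cycles A (Suc n) d"
      using lin_coordD(3)[OF lin_coord_cycles, of "Suc n" d] z(1) by simp
    then obtain x where x: "x \<in> cycles A (Suc n) d" "z = F x" by (rule imageE) simp
    then show "p \<in> HHfun (Suc n) d ` ?Z"
      using z connes_B_eq_zero_iff[OF x(1)] HHfun_coset[OF x(1)]
      by (intro image_eqI[where x = "boundaries A (Suc n) d +>\<^bsub>bar_space A (Suc n)\<^esub> x"]) (auto simp: carrier_HH)
  qed
  moreover have "subsp ?K"
    using subspD[OF subsp_hcycles] zero_in_hboundaries hboundaries_add hboundaries_scale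
    by (auto simp: subsp_def)
  moreover have "hvec (Suc n) d ` ?K = pvec ` hcval (Suc n) d"
    unfolding hfun_connes_kernel[OF zero_less_Suc, symmetric] image_image hvec_def ..
  moreover have "HC A n d = (HH A (Suc n) d)\<lparr>carrier := ?Z\<rparr>"
    using assms by (simp add: HC_def reduced_HC_def)
  ultimately show ?thesis
    using lin_coord_restrict[OF lin_coord_HH, of ?Z "Suc n" d] subsp_image[OF linear_hvec, of ?K "Suc n" d] by auto
qed

end

subsection \<open>Path algebras\<close>

lemma path_algebra_simps:
  "carrier (path_algebra G) = {x. supp x \<subseteq> paths G}"
  "x \<otimes>\<^bsub>path_algebra G\<^esub> y = lin_ext (\<lambda>p. lin_ext (path_mult p) y) x"
  "\<one>\<^bsub>path_algebra G\<^esub> = (\<Sum>v\<in>verts G. gen (v, [], v))"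
  "\<zero>\<^bsub>path_algebra G\<^esub> = 0"
  "x \<oplus>\<^bsub>path_algebra G\<^esub> y = x + y"
  "c \<odot>\<^bsub>path_algebra G\<^esub> x = scale c x"
  "homog (path_algebra G) d = {x. supp x \<subseteq> {(u, p, v) \<in> paths G. int (length p) = d}}"
  by (simp_all add: path_algebra_def)

lemma lin_coord_path_algebra:
  "lin_coord (path_algebra G) {x. supp x \<subseteq> paths G} (\<lambda>x. x)"
  by (auto simp: lin_coord_def path_algebra_simps bij_betw_def keys_add_subset keys_scale_subset)

text \<open>The product formula of the path algebra does not mention the graph. On all formal
  combinations it is bilinear and associative without carrier conditions.\<close>

definition pmult :: "(('v, 'e) path \<Rightarrow>\<^sub>0 complex) \<Rightarrow> (('v, 'e) path \<Rightarrow>\<^sub>0 complex) \<Rightarrow> (('v, 'e) path \<Rightarrow>\<^sub>0 complex)" where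
  "pmult x y = lin_ext (\<lambda>p. lin_ext (path_mult p) y) x"

lemma pmult_eq: "x \<otimes>\<^bsub>path_algebra G\<^esub> y = pmult x y"
  by (simp add: path_algebra_simps pmult_def)

lemma linear_pmult_left [simp]: "linear_op (\<lambda>x. pmult x y)"
  by (simp add: pmult_def)

lemma linear_pmult_right [simp]: "linear_op (pmult x)"
  unfolding pmult_def lin_ext_def[of _ x] by (intro lin_intros linear_op_lin_ext)

lemmas linear_pmult_left_comp [lin_intros] = linear_op_compose[OF linear_pmult_left]
  and linear_pmult_right_comp [lin_intros] = linear_op_compose[OF linear_pmult_right]
lemmas pmult_simps [simp] = linear_opD[OF linear_pmult_left] linear_op_sum[OF linear_pmult_left]
  linear_opD[OF linear_pmult_right] linear_op_sum[OF linear_pmult_right]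

lemma pmult_gen [simp]: "pmult (gen p) (gen q) = path_mult p q"
  by (simp add: pmult_def)

lemma path_mult_assoc: "pmult (path_mult p q) (gen r) = pmult (gen p) (path_mult q r)"
  by (cases p; cases q; cases r) auto

lemma pmult_assoc: "pmult (pmult x y) z = pmult x (pmult y z)"
proof (rule linear_op_eqI[where x = x])
  fix p
  show "pmult (pmult (gen p) y) z = pmult (gen p) (pmult y z)"
  proof (rule linear_op_eqI[where x = y])
    fix q
    show "pmult (pmult (gen p) (gen q)) z = pmult (gen p) (pmult (gen q) z)"
      by (rule linear_op_eqI[where x = z]) (auto simp: path_mult_assoc intro!: lin_intros)
  qed (auto intro!: lin_intros)
qed (auto intro!: lin_intros)

lemma keys_pmult:
  assumes "\<And>p q. p \<in> supp x \<Longrightarrow> q \<in> supp y \<Longrightarrow> supp (path_mult p q) \<subseteq> K"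
  shows "supp (pmult x y) \<subseteq> K"
  unfolding pmult_def by (intro keys_lin_ext) (use assms in auto)

context wf_digraph
begin

lemma keys_path_mult: "p \<in> paths G \<Longrightarrow> q \<in> paths G \<Longrightarrow> supp (path_mult p q) \<subseteq> paths G"
  by (cases p; cases q) (auto simp: paths_def)

lemma ring_path_algebra:
  assumes "finite (verts G)" shows "ring (path_algebra G)"
proof (rule ringI)
  show "abelian_group (path_algebra G)"
    by (rule lin_coord_abelian_group[OF lin_coord_path_algebra])
  have one: "pmult (\<Sum>v\<in>verts G. gen (v, [], v)) x = x" "pmult x (\<Sum>v\<in>verts G. gen (v, [], v)) = x"
    if x: "supp x \<subseteq> paths G" for x
  proof -
    have g: "pmult (\<Sum>v\<in>verts G. gen (v, [], v)) (gen k) = gen k" "pmult (gen k) (\<Sum>v\<in>verts G. gen (v, [], v)) = gen k"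
      if "k \<in> supp x" for k
    proof -
      obtain u p w where k: "k = (u, p, w)" by (cases k)
      have uw: "u \<in> verts G" "w \<in> verts G" using that x by (auto simp: k paths_def awalk_hd_in_verts)
      show "pmult (\<Sum>v\<in>verts G. gen (v, [], v)) (gen k) = gen k" "pmult (gen k) (\<Sum>v\<in>verts G. gen (v, [], v)) = gen k"
        using uw assms by (simp_all add: k)
    qed
    show "pmult (\<Sum>v\<in>verts G. gen (v, [], v)) x = x"
      by (rule linear_op_eqI[where x = x]) (use g in \<open>auto intro!: lin_intros simp del: pmult_simps\<close>)
    show "pmult x (\<Sum>v\<in>verts G. gen (v, [], v)) = x"
      by (rule linear_op_eqI[where x = x]) (use g in \<open>auto intro!: lin_intros simp del: pmult_simps\<close>)
  qed
  show "monoid (path_algebra G)"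
  proof (rule monoidI)
    show "\<one>\<^bsub>path_algebra G\<^esub> \<in> carrier (path_algebra G)"
      unfolding path_algebra_simps mem_Collect_eq
      by (rule keys_sum_subset) (auto simp: paths_def awalk_Nil_iff)
    show "x \<otimes>\<^bsub>path_algebra G\<^esub> y \<in> carrier (path_algebra G)"
      if "x \<in> carrier (path_algebra G)" "y \<in> carrier (path_algebra G)" for x y
      using that unfolding pmult_eq path_algebra_simps mem_Collect_eq
      by (intro keys_pmult) (use keys_path_mult in blast)
  qed (use one in \<open>simp_all only: pmult_eq pmult_assoc path_algebra_simps(1,3) mem_Collect_eq\<close>)
qed (simp_all only: pmult_eq path_algebra_simps(5) pmult_simps)

end

subsection \<open>The graph\<close>

text \<open>Numbered along the cycle, so that the arrows lead from \<open>i\<close> to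
  \<open>i + 1\<close>.\<close>

definition vx :: "3 \<Rightarrow> int \<times> int" where
  "vx i = (if i = 0 then (0, 0) else if i = 1 then (1, 0) else (0, 1))"

definition arc_from :: "3 \<Rightarrow> (int \<times> int) \<times> (int \<times> int)" where
  "arc_from i = (vx i, vx (i + 1))"

abbreviation G4 :: "(int \<times> int, (int \<times> int) \<times> (int \<times> int)) pre_digraph" where
  "G4 \<equiv> A_graph 4"

lemma vx_simps: "vx 0 = (0, 0)" "vx 1 = (1, 0)" "vx 2 = (0, 1)"
  by (simp_all add: vx_def)

lemma inj_vx [simp]: "vx i = vx j \<longleftrightarrow> i = j"
proof -
  have "\<forall>i j. vx i = vx j \<longrightarrow> i = j"
    unfolding all_three vx_simps by simp
  then show ?thesis by blast
qed

lemma verts_G4: "verts G4 = range vx"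
proof -
  have "verts G4 = {(0, 0), (1, 0), (0, 1)}" by (auto simp: A_graph_def)
  then show ?thesis unfolding UNIV_three by (simp add: vx_simps)
qed

lemma arcs_G4: "arcs G4 = range arc_from" and tail_G4: "tail G4 = fst" and head_G4: "head G4 = snd"
proof -
  have "arcs G4 = {((0, 0), (1, 0)), ((1, 0), (0, 1)), ((0, 1), (0, 0))}" by (auto simp: A_graph_def)
  moreover have "arc_from 0 = ((0, 0), (1, 0))" "arc_from 1 = ((1, 0), (0, 1))" "arc_from 2 = ((0, 1), (0, 0))"
    unfolding arc_from_def add_0 one_add_one two_add_one vx_simps by (rule refl)+
  ultimately show "arcs G4 = range arc_from"
    unfolding UNIV_three by simp
qed (simp_all add: A_graph_def)

lemma wf_G4: "wf_digraph G4"
  by unfold_locales (auto simp: arcs_G4 verts_G4 tail_G4 head_G4 arc_from_def)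

lemma awalk_G4_Nil: "pre_digraph.awalk G4 u [] v \<longleftrightarrow> (\<exists>i. u = vx i \<and> v = vx i)"
  by (auto simp: pre_digraph.awalk_def pre_digraph.cas.simps verts_G4)

lemma awalk_G4_Cons:
  "pre_digraph.awalk G4 u (e # p) v \<longleftrightarrow> (\<exists>i. u = vx i \<and> e = arc_from i \<and> pre_digraph.awalk G4 (vx (i + 1)) p v)"
  using wf_digraph.awalk_Cons_iff[OF wf_G4, of u e p v]
  by (auto simp: arcs_G4 tail_G4 head_G4 arc_from_def)

text \<open>Because of this uniqueness each relation has one term, and so has each sum in axiom
  (I).\<close>

lemma paths2_G4: "paths2 G4 (vx i) (vx (i + 2)) = {(arc_from i, arc_from (i + 1))}"
  by (auto simp: paths2_def awalk_G4_Cons awalk_G4_Nil add.assoc)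

subsection \<open>The weights of a cell system do not vanish\<close>

text \<open>A zero numerator, and likewise a zero denominator, would give \<open>q ^ 4 = 1\<close>,
  whereas \<open>q ^ 4 = -1\<close>.\<close>

lemma quantum_int_4_2_nonzero: "quantum_int 4 2 \<noteq> 0"
proof -
  define q where "q = exp (\<i> * of_real pi / of_nat 4)"
  have "q ^ 4 = exp (of_nat 4 * (\<i> * of_real pi / of_nat 4))"
    unfolding q_def by (rule exp_of_nat_mult[symmetric])
  also have "\<dots> = -1" by (simp add: exp_pi_i')
  finally have q4: "q ^ 4 = -1" .
  have q0: "q \<noteq> 0" by (simp add: q_def)
  have "q ^ 2 \<noteq> inverse q ^ 2"
  proof
    assume "q ^ 2 = inverse q ^ 2"
    then have "q ^ 2 * q ^ 2 = q ^ 2 * inverse q ^ 2" by simp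
    also have "\<dots> = (q * inverse q) ^ 2" by (simp only: power_mult_distrib)
    also have "\<dots> = 1" using q0 by simp
    finally show False using q4 by (simp flip: power_add)
  qed
  moreover have "q \<noteq> inverse q"
  proof
    assume "q = inverse q"
    then have "q ^ 2 = inverse q ^ 2" by simp
    then show False using calculation by simp
  qed
  ultimately show ?thesis
    unfolding quantum_int_def Let_def q_def[symmetric] by simp
qed

text \<open>Axiom (I) with \<open>a = a'\<close> expresses the squared modulus of the weight as a
  product of nonzero factors.\<close>

lemma weight_nonzero:
  assumes "perron_frobenius G4 4 \<phi>" "cell_system G4 4 \<phi> W"
  shows "W (arc_from (i + 2)) (arc_from i) (arc_from (i + 1)) \<noteq> 0"
proof -
  let ?a = "arc_from (i + 2)" and ?b = "arc_from i" and ?c = "arc_from (i + 1)"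
  have i: "i + 2 + 1 = i" using two_add_one by (metis add.assoc add.right_neutral)
  have aw: "pre_digraph.awalk G4 (vx (i + 2)) [?a] (vx i)"
    unfolding awalk_G4_Cons awalk_G4_Nil using i by auto
  have "(\<Sum>(b1, b2)\<in>paths2 G4 (vx i) (vx (i + 2)). W ?a b1 b2 * cnj (W ?a b1 b2))
      = quantum_int 4 2 * \<phi> (vx (i + 2)) * \<phi> (vx i)"
    using assms(2)[unfolded cell_system_def, THEN conjunct2, THEN conjunct1, rule_format, OF conjI[OF aw aw]]
    by simp
  then have "W ?a ?b ?c * cnj (W ?a ?b ?c) = quantum_int 4 2 * \<phi> (vx (i + 2)) * \<phi> (vx i)"
    by (simp add: paths2_G4)
  moreover have "\<phi> (vx j) > 0" for j
    using assms(1) by (auto simp: perron_frobenius_def verts_G4)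
  ultimately show ?thesis using quantum_int_4_2_nonzero
    by (metis mult_eq_0_iff of_real_eq_0_iff less_irrefl)
qed

subsection \<open>The ideal of relations\<close>

definition lpath :: "letter \<Rightarrow> (int \<times> int, (int \<times> int) \<times> (int \<times> int)) path" where
  "lpath l = (vx (src l), if arrow l then [arc_from (src l)] else [], vx (tgt l))"

definition long_paths :: "(int \<times> int, (int \<times> int) \<times> (int \<times> int)) path set" where
  "long_paths = {(u, p, v) \<in> paths G4. 2 \<le> length p}"

lemma lpath_simps: "lpath (i, b) = (vx i, if b then [arc_from i] else [], vx (if b then i + 1 else i))"
  by (simp add: lpath_def tgt_def)

lemma lpath_in_paths: "lpath l \<in> paths G4"
  by (cases l) (auto simp: lpath_simps paths_def awalk_G4_Cons awalk_G4_Nil)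

lemma lpath_eq_iff [simp]: "lpath l = lpath k \<longleftrightarrow> l = k"
  by (cases l; cases k) (auto simp: lpath_simps)

lemma lpath_not_long: "lpath l \<notin> long_paths"
  by (auto simp: lpath_def long_paths_def)

lemma paths_G4_cases:
  assumes "p \<in> paths G4" obtains l where "p = lpath l" | "p \<in> long_paths"
proof -
  obtain u es v where p: "p = (u, es, v)" by (cases p)
  have aw: "pre_digraph.awalk G4 u es v" using assms by (simp add: p paths_def)
  consider "es = []" | e where "es = [e]" | "2 \<le> length es" by (cases es; cases "tl es") auto
  then show ?thesis
  proof cases
    case 1
    then obtain i where "p = lpath (i, False)" using aw by (auto simp: p lpath_simps awalk_G4_Nil)
    then show ?thesis by (rule that)
  next
    case 2
    then obtain i where "p = lpath (i, True)" using aw by (auto simp: p lpath_simps awalk_G4_Nil awalk_G4_Cons)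
    then show ?thesis by (rule that)
  next
    case 3
    then show ?thesis using assms that by (auto simp: p long_paths_def)
  qed
qed

definition lcoord :: "((int \<times> int, (int \<times> int) \<times> (int \<times> int)) path \<Rightarrow>\<^sub>0 complex) \<Rightarrow> (letter \<Rightarrow>\<^sub>0 complex)" where
  "lcoord x = (\<Sum>l\<in>UNIV. scale (coef x (lpath l)) (gen l))"

lemma lookup_lcoord [simp]: "coef (lcoord x) l = coef x (lpath l)"
proof -
  have "coef (lcoord x) l = (\<Sum>k\<in>UNIV. if k = l then coef x (lpath l) else 0)"
    unfolding lcoord_def lookup_sum by (rule sum.cong) (auto simp: lookup_single when_def)
  then show ?thesis by simp
qed

lemma linear_lcoord [simp]: "linear_op lcoord"
  unfolding linear_op_def by (auto intro!: poly_mapping_eqI simp: lookup_add)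

lemma lcoord_lpath: "lcoord (gen (lpath l)) = gen l"
  by (rule poly_mapping_eqI) (auto simp: lookup_single when_def)

lemma long_path_mult:
  assumes "p \<in> paths G4" "q \<in> paths G4" "p \<in> long_paths \<or> q \<in> long_paths"
  shows "supp (path_mult p q) \<subseteq> long_paths"
proof -
  have "supp (path_mult p q) \<subseteq> paths G4"
    by (rule wf_digraph.keys_path_mult[OF wf_G4 assms(1,2)])
  then show ?thesis using assms(3)
    by (cases p; cases q) (auto simp: long_paths_def split: if_splits)
qed

lemma lcoord_eq_0_iff:
  assumes "supp x \<subseteq> paths G4"
  shows "lcoord x = 0 \<longleftrightarrow> supp x \<subseteq> long_paths"
proof
  assume "lcoord x = 0"
  then have "coef x (lpath l) = 0" for l by (metis lookup_lcoord lookup_zero)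
  then have "lpath l \<notin> supp x" for l by (simp add: in_keys_iff)
  then show "supp x \<subseteq> long_paths"
    using assms paths_G4_cases by blast
next
  assume "supp x \<subseteq> long_paths"
  then have "coef x (lpath l) = 0" for l
    using lpath_not_long by (meson in_keys_iff subset_eq)
  then show "lcoord x = 0" by (intro poly_mapping_eqI) simp
qed

text \<open>Indexing by the arrow from \<open>i + 2\<close> back to \<open>i\<close> makes the
  relation a multiple of the path that starts at \<open>i\<close>.\<close>

lemma acy_relation_G4:
  "acy_relation G4 W (arc_from (i + 2)) = scale (W (arc_from (i + 2)) (arc_from i) (arc_from (i + 1)))
     (gen (vx i, [arc_from i, arc_from (i + 1)], vx (i + 2)))"
proof -
  have "i + 2 + 1 = i" using two_add_one by (metis add.assoc add.right_neutral)
  then have "head G4 (arc_from (i + 2)) = vx i" "tail G4 (arc_from (i + 2)) = vx (i + 2)"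
    by (simp_all add: head_G4 tail_G4 arc_from_def)
  then show ?thesis by (simp add: acy_relation_def paths2_G4)
qed

lemma range_shift_two: "range (\<lambda>i. f (i + 2 :: 3)) = range f"
proof -
  have eq: "i = (i + 1) + 2" for i :: 3
    using two_add_one by (simp add: add.assoc one_add_one)
  have "f i \<in> range (\<lambda>i. f (i + 2))" for i
    by (rule image_eqI[where x = "i + 1"], rule arg_cong[OF eq]) simp
  then show ?thesis by blast
qed

interpretation R: ring "path_algebra G4"
  by (rule wf_digraph.ring_path_algebra[OF wf_G4]) (simp add: verts_G4)

lemma ideal_long_paths: "ideal {x. supp x \<subseteq> long_paths} (path_algebra G4)" (is "ideal ?J _")
proof (rule idealI)
  have sub: "long_paths \<subseteq> paths G4" by (auto simp: long_paths_def)
  have "submodule ?J complex_field (path_algebra G4)"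
    unfolding lin_coord_submodule_iff[OF lin_coord_path_algebra]
    using sub subsp_keys by (auto simp: path_algebra_simps)
  then show "subgroup ?J (add_monoid (path_algebra G4))" by (rule submodule.axioms)
  show "x \<otimes>\<^bsub>path_algebra G4\<^esub> a \<in> ?J" "a \<otimes>\<^bsub>path_algebra G4\<^esub> x \<in> ?J"
    if "a \<in> ?J" "x \<in> carrier (path_algebra G4)" for a x
    using that sub unfolding pmult_eq path_algebra_simps mem_Collect_eq
    by (intro keys_pmult long_path_mult; blast)+
qed (rule R.ring_axioms)

text \<open>A path of length at least two begins with a path of length two, which is a nonzero
  multiple of a relation.\<close>

lemma idl_eq:
  assumes W: "\<And>i. W (arc_from (i + 2)) (arc_from i) (arc_from (i + 1)) \<noteq> 0"
  shows "Idl\<^bsub>path_algebra G4\<^esub> (acy_relation G4 W ` arcs G4) = {x. supp x \<subseteq> long_paths}"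
    (is "?I = ?J")
proof -
  let ?R = "path_algebra G4"
  have rels: "acy_relation G4 W ` arcs G4 = range (\<lambda>i. acy_relation G4 W (arc_from (i + 2)))"
    unfolding arcs_G4 range_shift_two[of "\<lambda>i. acy_relation G4 W (arc_from i)"] by (simp add: image_image)
  have two: "(vx i, [arc_from i, arc_from (i + 1)], vx (i + 2)) \<in> long_paths" for i
    by (auto simp: long_paths_def paths_def awalk_G4_Cons awalk_G4_Nil add.assoc)
  show ?thesis
  proof
    show "?I \<subseteq> ?J"
    proof (rule R.genideal_minimal[OF ideal_long_paths])
      show "acy_relation G4 W ` arcs G4 \<subseteq> ?J"
      proof -
        have "supp (scale c (gen p)) \<subseteq> long_paths" if "p \<in> long_paths" for c p
          by (rule keys_scale_subset) (use that in simp)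
        then show ?thesis unfolding rels acy_relation_G4 using two by blast
      qed
    qed
    show "?J \<subseteq> ?I"
      unfolding genideal_def
    proof (clarsimp)
      fix x :: "(int \<times> int, (int \<times> int) \<times> (int \<times> int)) path \<Rightarrow>\<^sub>0 complex" and K
      assume x: "supp x \<subseteq> long_paths" and K: "ideal K ?R" "acy_relation G4 W ` arcs G4 \<subseteq> K"
      interpret K: ideal K ?R by (rule K(1))
      have l: "pmult y z \<in> K" if "supp y \<subseteq> paths G4" "z \<in> K" for y z
        using K.I_l_closed[of z y] that by (simp add: pmult_eq path_algebra_simps)
      have r: "pmult z y \<in> K" if "supp y \<subseteq> paths G4" "z \<in> K" for y z
        using K.I_r_closed[of z y] that by (simp add: pmult_eq path_algebra_simps)
      have sc: "scale c (gen p) \<in> K" if p: "p \<in> long_paths" for c p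
      proof -
        obtain u es v where p': "p = (u, es, v)" by (cases p)
        then obtain e e' rest where es: "es = e # e' # rest"
          using p by (cases es; cases "tl es") (auto simp: long_paths_def)
        obtain i where i: "u = vx i" "e = arc_from i" "e' = arc_from (i + 1)"
          and rest: "pre_digraph.awalk G4 (vx (i + 2)) rest v"
          using p by (auto simp: long_paths_def p' es paths_def awalk_G4_Cons add.assoc)
        let ?w = "W (arc_from (i + 2)) (arc_from i) (arc_from (i + 1))"
        have "acy_relation G4 W (arc_from (i + 2)) \<in> K" using K(2) by (auto simp: rels)
        then have "scale ?w (gen (vx i, [arc_from i, arc_from (i + 1)], vx (i + 2))) \<in> K"
          by (simp add: acy_relation_G4)
        \<comment> \<open>The trivial path on the left carries the scalar that cancels the weight;
          the right factor supplies the rest of the path.\<close>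
        then have "pmult (scale (c / ?w) (gen (lpath (i, False))))
            (pmult (scale ?w (gen (vx i, [arc_from i, arc_from (i + 1)], vx (i + 2)))) (gen (vx (i + 2), rest, v))) \<in> K"
          using rest lpath_in_paths by (intro l r keys_scale_subset) (auto simp: paths_def)
        then show ?thesis using W[of i] by (simp add: lpath_simps p' es i)
      qed
      have "(\<Sum>k\<in>L. scale (coef x k) (gen k)) \<in> K" if "finite L" "L \<subseteq> supp x" for L
        using that
      proof (induction L rule: finite_induct)
        case empty
        then show ?case using K.zero_closed by (simp add: path_algebra_simps)
      next
        case (insert k L)
        then show ?case using K.a_closed[of "scale (coef x k) (gen k)"] sc[of k] x
          by (auto simp: path_algebra_simps)
      qed
      from this[of "supp x"] show "x \<in> K" using gen_expansion[of x] by simp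
    qed
  qed
qed

subsection \<open>Coordinates of the almost Calabi--Yau algebra\<close>

definition lprod :: "letter \<Rightarrow> letter \<Rightarrow> (letter \<Rightarrow>\<^sub>0 complex)" where
  "lprod a b = (case lmult a b of None \<Rightarrow> 0 | Some c \<Rightarrow> gen c)"

lemma lcoord_path_mult:
  assumes "p \<in> paths G4" "q \<in> paths G4"
  shows "lcoord (path_mult p q) = (\<Sum>a\<in>UNIV. \<Sum>b\<in>UNIV.
     scale (coef (gen p) (lpath a) * coef (gen q) (lpath b)) (lprod a b))"
proof (cases "p \<in> long_paths \<or> q \<in> long_paths")
  case True
  then have "lcoord (path_mult p q) = 0"
    using long_path_mult[OF assms True] lcoord_eq_0_iff[of "path_mult p q"] by (auto simp: long_paths_def)
  moreover have "coef (gen p) (lpath a) * coef (gen q) (lpath b) = 0" for a b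
    using True lpath_not_long[of a] lpath_not_long[of b] by (auto simp: lookup_single when_def)
  ultimately show ?thesis by (simp only: scale_zero sum.neutral_const)
next
  case False
  then obtain a b where p: "p = lpath a" and q: "q = lpath b" using assms paths_G4_cases by metis
  have "(\<Sum>a'\<in>UNIV. \<Sum>b'\<in>UNIV. scale (coef (gen p) (lpath a') * coef (gen q) (lpath b')) (lprod a' b'))
      = (\<Sum>a'\<in>UNIV. \<Sum>b'\<in>UNIV. if b' = b then if a' = a then lprod a b else 0 else 0)"
    by (intro sum.cong refl) (auto simp: p q lookup_single when_def)
  also have "\<dots> = lprod a b" by simp
  also have "\<dots> = lcoord (path_mult p q)"
  proof (cases "lmult a b")
    case None
    have "supp (path_mult p q) \<subseteq> long_paths"
    proof -
      have "supp (path_mult p q) \<subseteq> paths G4"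
        by (rule wf_digraph.keys_path_mult[OF wf_G4 assms])
      then show ?thesis using None
        by (auto simp: p q lpath_def long_paths_def lmult_def split: if_splits)
    qed
    then show ?thesis
      using None lcoord_eq_0_iff[of "path_mult p q"] by (auto simp: lprod_def long_paths_def)
  next
    case (Some c)
    then have "path_mult p q = gen (lpath c)"
      using lmult_SomeD[OF Some] by (cases a; cases b; cases c) (auto simp: p q lpath_def tgt_def)
    then show ?thesis by (simp add: lprod_def Some lcoord_lpath)
  qed
  finally show ?thesis ..
qed

lemma linear_op_lookup_scale: "linear_op (\<lambda>x. scale (coef x k * c) z)"
  "linear_op (\<lambda>x. scale (c * coef x k) z)"
  by (auto simp: linear_op_def lookup_add scale_add_left distrib_left distrib_right mult_ac)

lemma lcoord_pmult:
  assumes "supp x \<subseteq> paths G4" "supp y \<subseteq> paths G4"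
  shows "lcoord (pmult x y) = (\<Sum>a\<in>UNIV. \<Sum>b\<in>UNIV.
     scale (coef x (lpath a) * coef y (lpath b)) (lprod a b))"
proof (rule linear_op_eqI[where x = x])
  fix p assume p: "p \<in> supp x"
  show "lcoord (pmult (gen p) y) = (\<Sum>a\<in>UNIV. \<Sum>b\<in>UNIV.
     scale (coef (gen p) (lpath a) * coef y (lpath b)) (lprod a b))"
  proof (rule linear_op_eqI[where x = y])
    fix q assume "q \<in> supp y"
    then show "lcoord (pmult (gen p) (gen q)) = (\<Sum>a\<in>UNIV. \<Sum>b\<in>UNIV.
       scale (coef (gen p) (lpath a) * coef (gen q) (lpath b)) (lprod a b))"
      unfolding pmult_gen using p assms by (intro lcoord_path_mult) auto
  qed (intro lin_intros linear_op_compose[OF linear_lcoord] linear_op_lookup_scale linear_pmult_right)+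
qed (intro lin_intros linear_op_compose[OF linear_lcoord] linear_op_lookup_scale linear_pmult_left)+

lemma quotient_algebra_simps:
  "carrier (quotient_algebra R I) = carrier (quotient R I)"
  "\<zero>\<^bsub>quotient_algebra R I\<^esub> = \<zero>\<^bsub>quotient R I\<^esub>"
  "\<one>\<^bsub>quotient_algebra R I\<^esub> = I +>\<^bsub>R\<^esub> \<one>\<^bsub>R\<^esub>"
  "x \<oplus>\<^bsub>quotient_algebra R I\<^esub> y = x \<oplus>\<^bsub>quotient R I\<^esub> y"
  "c \<odot>\<^bsub>quotient_algebra R I\<^esub> x = c \<odot>\<^bsub>quotient R I\<^esub> x"
  "x \<otimes>\<^bsub>quotient_algebra R I\<^esub> y = rcoset_mult R I x y"
  "homog (quotient_algebra R I) d = (\<lambda>x. I +>\<^bsub>R\<^esub> x) ` homog R d"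
  by (simp_all add: quotient_algebra_def quotient_def FactRing_def ring.defs module.defs galgebra.defs)

definition acy_coord ::
  "((int \<times> int, (int \<times> int) \<times> (int \<times> int)) path \<Rightarrow>\<^sub>0 complex) set \<Rightarrow> letter \<Rightarrow> complex" where
  "acy_coord Y l = coef (lcoord (SOME x. x \<in> Y)) l"

lemma cyclic_algebra_acy:
  assumes W: "\<And>i. W (arc_from (i + 2)) (arc_from i) (arc_from (i + 1)) \<noteq> 0"
  shows "cyclic_algebra (acy_algebra G4 W) acy_coord"
proof -
  let ?R = "path_algebra G4"
  define J where "J = {x :: (int \<times> int, (int \<times> int) \<times> (int \<times> int)) path \<Rightarrow>\<^sub>0 complex. supp x \<subseteq> long_paths}"
  have A: "acy_algebra G4 W = quotient_algebra ?R J"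
    unfolding acy_algebra_def idl_eq[of W, OF W] J_def ..
  have sub: "long_paths \<subseteq> paths G4" by (auto simp: long_paths_def)
  have J: "J = {y \<in> carrier ?R. lcoord y = 0}"
    using lcoord_eq_0_iff sub by (auto simp: J_def path_algebra_simps)
  interpret J: ideal J ?R unfolding J_def by (rule ideal_long_paths)
  define g where "g Y = lcoord (SOME x. x \<in> Y)" for Y
  note L = lin_coord_quotient[OF lin_coord_path_algebra linear_lcoord J, folded g_def]
  have co: "acy_coord Y l = coef (g Y) l" for Y l by (simp add: acy_coord_def g_def)
  have sect: "supp (\<Sum>l\<in>UNIV. scale (f l) (gen (lpath l))) \<subseteq> paths G4"
    "lcoord (\<Sum>l\<in>UNIV. scale (f l) (gen (lpath l))) = (\<Sum>l\<in>UNIV. scale (f l) (gen l))" for f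
  proof -
    show "supp (\<Sum>l\<in>UNIV. scale (f l) (gen (lpath l))) \<subseteq> paths G4"
      by (intro keys_sum_subset keys_scale_subset) (use lpath_in_paths in simp)
    show "lcoord (\<Sum>l\<in>UNIV. scale (f l) (gen (lpath l))) = (\<Sum>l\<in>UNIV. scale (f l) (gen l))"
      by (simp add: linear_op_sum[OF linear_lcoord] linear_op_scale[OF linear_lcoord] lcoord_lpath)
  qed
  have lookup_sum_gen: "coef (\<Sum>k\<in>UNIV. scale (f k) (gen k)) l = f l" for f and l :: letter
  proof -
    have "(\<Sum>k\<in>UNIV. f k * coef (gen k) l) = (\<Sum>k\<in>UNIV. if k = l then f l else 0)"
      by (rule sum.cong) (auto simp: lookup_single when_def)
    then show ?thesis by (simp add: lookup_sum)
  qed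
  have V: "lcoord ` {x. supp x \<subseteq> paths G4} = UNIV"
  proof -
    have "z \<in> lcoord ` {x. supp x \<subseteq> paths G4}" for z
    proof (rule image_eqI[of _ _ "\<Sum>l\<in>UNIV. scale (coef z l) (gen (lpath l))"])
      show "z = lcoord (\<Sum>l\<in>UNIV. scale (coef z l) (gen (lpath l)))"
        unfolding sect by (rule poly_mapping_eqI) (simp only: lookup_sum_gen)
    qed (use sect(1) in blast)
    then show ?thesis by blast
  qed
  note Q = lin_coordD[OF L(1)[unfolded V]]
  have g: "g (J +>\<^bsub>?R\<^esub> x) = lcoord x" if "supp x \<subseteq> paths G4" for x
    using L(2)[of x] that by (simp add: path_algebra_simps)
  have car: "Y \<in> carrier (quotient ?R J) \<longleftrightarrow> (\<exists>x. supp x \<subseteq> paths G4 \<and> Y = J +>\<^bsub>?R\<^esub> x)" for Y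
    unfolding L(3) by (auto simp: path_algebra_simps)
  have g_eqI: "Y = Z" if "Y \<in> carrier (quotient ?R J)" "Z \<in> carrier (quotient ?R J)" "g Y = g Z" for Y Z
    using that by (rule lin_coord_eqI[OF L(1)])
  have one: "supp \<one>\<^bsub>?R\<^esub> \<subseteq> paths G4"
    using R.one_closed by (simp add: path_algebra_simps(1))
  have mult: "rcoset_mult ?R J (J +>\<^bsub>?R\<^esub> x) (J +>\<^bsub>?R\<^esub> y) = J +>\<^bsub>?R\<^esub> pmult x y"
    "supp (pmult x y) \<subseteq> paths G4"
    if "supp x \<subseteq> paths G4" "supp y \<subseteq> paths G4" for x y
    using that J.rcoset_mult_add[of x y] R.m_closed[of x y] by (simp_all add: pmult_eq path_algebra_simps(1))
  show ?thesis
    unfolding A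
  proof (unfold_locales, unfold quotient_algebra_simps)
    show "bij_betw acy_coord (carrier (quotient ?R J)) UNIV"
    proof -
      have "acy_coord = coef \<circ> g" by (auto simp: co fun_eq_iff)
      moreover have "bij_betw coef UNIV (UNIV :: (letter \<Rightarrow> complex) set)"
      proof (rule bij_betwI[where g = "\<lambda>f. \<Sum>k\<in>UNIV. scale (f k) (gen k)"])
        show "(\<Sum>k\<in>UNIV. scale (coef x k) (gen k)) = x" for x :: "letter \<Rightarrow>\<^sub>0 complex"
          by (rule poly_mapping_eqI) (rule lookup_sum_gen)
        show "coef (\<Sum>k\<in>UNIV. scale (f k) (gen k)) = f" for f :: "letter \<Rightarrow> complex"
          by (rule ext) (rule lookup_sum_gen)
      qed auto
      ultimately show ?thesis using bij_betw_trans[OF Q(1)] by metis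
    qed
    show "\<zero>\<^bsub>quotient ?R J\<^esub> \<in> carrier (quotient ?R J)" by (rule Q)
    show "acy_coord \<zero>\<^bsub>quotient ?R J\<^esub> l = 0" for l by (simp add: co Q)
    show "J +>\<^bsub>?R\<^esub> \<one>\<^bsub>?R\<^esub> \<in> carrier (quotient ?R J)" using one by (auto simp: car)
    show "acy_coord (J +>\<^bsub>?R\<^esub> \<one>\<^bsub>?R\<^esub>) l = (if arrow l then 0 else 1)" for l
    proof -
      have "acy_coord (J +>\<^bsub>?R\<^esub> \<one>\<^bsub>?R\<^esub>) l = (\<Sum>v\<in>range vx. coef (gen (v, [], v)) (lpath l))"
        unfolding co g[OF one] lookup_lcoord unfolding path_algebra_simps(3) lookup_sum verts_G4 ..
      also have "\<dots> = (\<Sum>v\<in>range vx. if v = vx (src l) then (if arrow l then 0 else 1) else 0)"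
        by (rule sum.cong) (auto simp: lookup_single when_def lpath_def tgt_def)
      finally show ?thesis by simp
    qed
    fix Y Z assume Y: "Y \<in> carrier (quotient ?R J)"
    show "c \<odot>\<^bsub>quotient ?R J\<^esub> Y \<in> carrier (quotient ?R J)"
      "acy_coord (c \<odot>\<^bsub>quotient ?R J\<^esub> Y) l = c * acy_coord Y l" for c l
      using Y by (simp_all add: co Q)
    assume Z: "Z \<in> carrier (quotient ?R J)"
    show "Y \<oplus>\<^bsub>quotient ?R J\<^esub> Z \<in> carrier (quotient ?R J)"
      "acy_coord (Y \<oplus>\<^bsub>quotient ?R J\<^esub> Z) l = acy_coord Y l + acy_coord Z l" for l
      using Y Z by (simp_all add: co Q lookup_add)
    obtain x y where x: "supp x \<subseteq> paths G4" "Y = J +>\<^bsub>?R\<^esub> x"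
      and y: "supp y \<subseteq> paths G4" "Z = J +>\<^bsub>?R\<^esub> y"
      using Y Z by (auto simp: car)
    show "rcoset_mult ?R J Y Z \<in> carrier (quotient ?R J)"
      unfolding x y mult(1)[OF x(1) y(1)] using mult(2)[OF x(1) y(1)] by (auto simp: car)
    show "acy_coord (rcoset_mult ?R J Y Z) l =
        (\<Sum>a\<in>UNIV. \<Sum>b\<in>UNIV. if lmult a b = Some l then acy_coord Y a * acy_coord Z b else 0)" for l
    proof -
      have "acy_coord (rcoset_mult ?R J Y Z) l = (\<Sum>a\<in>UNIV. \<Sum>b\<in>UNIV.
          acy_coord Y a * acy_coord Z b * coef (lprod a b) l)"
        unfolding co x(2) y(2) mult(1)[OF x(1) y(1)] g[OF mult(2)[OF x(1) y(1)]] g[OF x(1)] g[OF y(1)]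
          lcoord_pmult[OF x(1) y(1)]
        by (simp only: lookup_sum lookup_scale lookup_lcoord)
      also have "\<dots> = (\<Sum>a\<in>UNIV. \<Sum>b\<in>UNIV. if lmult a b = Some l then acy_coord Y a * acy_coord Z b else 0)"
        by (intro sum.cong refl) (auto simp: lprod_def lookup_single when_def split: option.splits)
      finally show ?thesis .
    qed
  next
    fix d
    show "(\<lambda>x. J +>\<^bsub>?R\<^esub> x) ` homog ?R d = {Y \<in> carrier (quotient ?R J). \<forall>l. acy_coord Y l \<noteq> 0 \<longrightarrow> (if arrow l then 1 else 0) = d}"
      (is "?L = ?M")
    proof (intro equalityI subsetI)
      fix Y assume "Y \<in> ?L"
      then obtain x where x: "supp x \<subseteq> {(u, p, v) \<in> paths G4. int (length p) = d}" "Y = J +>\<^bsub>?R\<^esub> x"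
        by (auto simp: path_algebra_simps)
      then have p: "supp x \<subseteq> paths G4" by auto
      have "(if arrow l then 1 else 0) = d" if "acy_coord Y l \<noteq> 0" for l
      proof -
        have "lpath l \<in> supp x" using that by (simp add: co x(2) g[OF p] in_keys_iff)
        then have "lpath l \<in> {(u, p, v) \<in> paths G4. int (length p) = d}" by (rule subsetD[OF x(1)])
        then show ?thesis by (auto simp: lpath_def split: if_splits)
      qed
      then show "Y \<in> ?M" using x(2) p by (auto simp: car)
    next
      fix Y assume Y: "Y \<in> ?M"
      let ?x = "\<Sum>l\<in>UNIV. scale (acy_coord Y l) (gen (lpath l))"
      have "g Y = g (J +>\<^bsub>?R\<^esub> ?x)"
        unfolding g[OF sect(1)] sect(2) by (rule poly_mapping_eqI) (simp only: lookup_sum_gen co)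
      moreover have "Y \<in> carrier (quotient ?R J)" using Y by blast
      moreover have "J +>\<^bsub>?R\<^esub> ?x \<in> carrier (quotient ?R J)" using sect(1) car by blast
      ultimately have "Y = J +>\<^bsub>?R\<^esub> ?x" by (intro g_eqI[of Y "J +>\<^bsub>?R\<^esub> ?x"])
      moreover have "supp ?x \<subseteq> {(u, p, v) \<in> paths G4. int (length p) = d}"
      proof (rule keys_sum_subset)
        fix l
        show "supp (scale (acy_coord Y l) (gen (lpath l))) \<subseteq> {(u, p, v) \<in> paths G4. int (length p) = d}"
        proof (cases "acy_coord Y l = 0")
          case False
          then have "(if arrow l then 1 else 0) = d" using Y by blast
          then have "lpath l \<in> {(u, p, v) \<in> paths G4. int (length p) = d}"
            using lpath_in_paths[of l] by (auto simp: lpath_def split: if_splits)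
          then show ?thesis by (intro keys_scale_subset) simp
        qed simp
      qed
      ultimately show "Y \<in> ?L" unfolding path_algebra_simps by blast
    qed
  qed
qed

subsection \<open>Spaces of dimension at most one\<close>

lemma lin_coord_dim_0:
  assumes "Module.module complex_field M" "has_dim M 0"
  shows "lin_coord M {0} (\<lambda>_. 0)"
proof -
  interpret Module.module complex_field M by (rule assms(1))
  have C: "carrier complex_field = UNIV" by (simp add: complex_field_def)
  obtain B where "is_basis M B" "card B = 0" using assms(2) by (auto simp: has_dim_def)
  then have "is_basis M {}" by (auto simp: is_basis_def)
  then have "carrier M = {\<zero>\<^bsub>M\<^esub>}"
    using M.zero_closed by (auto simp: is_basis_def)
  moreover have "c \<odot>\<^bsub>M\<^esub> \<zero>\<^bsub>M\<^esub> = \<zero>\<^bsub>M\<^esub>" for c using smult_r_null[of c] C by simp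
  ultimately show ?thesis by (auto simp: lin_coord_def bij_betw_def)
qed

text \<open>Constant vectors are used in order to match the coordinate sets \<open>hval\<close> and
  \<open>hcval\<close>.\<close>

lemma lin_coord_dim_1:
  assumes "Module.module complex_field M" "has_dim M 1"
  shows "\<exists>h. lin_coord M (pvec ` range (\<lambda>c _. c)) h"
proof -
  interpret Module.module complex_field M by (rule assms(1))
  have C: "carrier complex_field = UNIV" "x \<oplus>\<^bsub>complex_field\<^esub> y = x + y" "x \<otimes>\<^bsub>complex_field\<^esub> y = x * y"
    "\<zero>\<^bsub>complex_field\<^esub> = 0" for x y
    by (simp_all add: complex_field_def)
  obtain B where B: "is_basis M B" "card B = 1" using assms(2) by (auto simp: has_dim_def)
  then obtain b where "B = {b}" by (auto simp: card_1_singleton_iff)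
  with B(1) have b: "b \<in> carrier M" by (simp add: is_basis_def)
  have ex: "\<exists>!c. c \<in> {b} \<rightarrow>\<^sub>E UNIV \<and> x = c b \<odot>\<^bsub>M\<^esub> b" if "x \<in> carrier M" for x
    using B(1) that b smult_closed C unfolding \<open>B = {b}\<close> is_basis_def by simp
  have ex1: "\<exists>!c. x = c \<odot>\<^bsub>M\<^esub> b" if x: "x \<in> carrier M" for x
  proof -
    obtain f where f: "x = f b \<odot>\<^bsub>M\<^esub> b"
      and u: "\<And>f'. f' \<in> {b} \<rightarrow>\<^sub>E UNIV \<Longrightarrow> x = f' b \<odot>\<^bsub>M\<^esub> b \<Longrightarrow> f' = f"
      using ex[OF x] by (metis (no_types, lifting))
    show ?thesis
    proof (rule ex1I[of _ "f b"])
      show "x = f b \<odot>\<^bsub>M\<^esub> b" by (rule f)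
      fix c assume "x = c \<odot>\<^bsub>M\<^esub> b"
      then have "(\<lambda>y\<in>{b}. c) = f" by (intro u) auto
      then show "c = f b" by auto
    qed
  qed
  define k where "k x = (THE c. x = c \<odot>\<^bsub>M\<^esub> b)" for x
  have kb: "x = k x \<odot>\<^bsub>M\<^esub> b" if "x \<in> carrier M" for x
    unfolding k_def using theI'[OF ex1[OF that]] .
  have k: "k (c \<odot>\<^bsub>M\<^esub> b) = c" for c
    unfolding k_def using ex1[of "c \<odot>\<^bsub>M\<^esub> b"] b smult_closed C by (intro the1_equality) auto
  have add: "k (x \<oplus>\<^bsub>M\<^esub> y) = k x + k y" if "x \<in> carrier M" "y \<in> carrier M" for x y
  proof -
    have "x \<oplus>\<^bsub>M\<^esub> y = (k x + k y) \<odot>\<^bsub>M\<^esub> b"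
      using kb[OF that(1)] kb[OF that(2)] smult_l_distr[of "k x" "k y" b] b C by simp
    then show ?thesis by (metis k)
  qed
  have sm: "k (c \<odot>\<^bsub>M\<^esub> x) = c * k x" if "x \<in> carrier M" for c x
  proof -
    have "c \<odot>\<^bsub>M\<^esub> x = (c * k x) \<odot>\<^bsub>M\<^esub> b"
      using kb[OF that] smult_assoc1[of c "k x" b] b C by simp
    then show ?thesis by (metis k)
  qed
  have z: "k \<zero>\<^bsub>M\<^esub> = 0" using k[of 0] smult_l_null[OF b] C by simp
  have "lin_coord M (pvec ` range (\<lambda>c _. c)) (\<lambda>x. pvec (\<lambda>_. k x))"
    unfolding lin_coord_def
  proof (intro conjI ballI allI)
    have "x = y" if "x \<in> carrier M" "y \<in> carrier M" "k x = k y" for x y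
      by (subst kb[OF that(1)], subst kb[OF that(2)]) (simp only: that(3))
    moreover have "k ` carrier M = UNIV"
    proof (rule UNIV_eq_I[symmetric])
      show "c \<in> k ` carrier M" for c
        by (rule image_eqI[of _ _ "c \<odot>\<^bsub>M\<^esub> b"]) (simp_all add: k b smult_closed C)
    qed
    then have "(\<lambda>x. pvec (\<lambda>_. k x)) ` carrier M = pvec ` range (\<lambda>c _. c)"
      by (simp only: image_image[of "\<lambda>c. pvec (\<lambda>_. c)" k, symmetric] image_image[of pvec])
    ultimately show "bij_betw (\<lambda>x. pvec (\<lambda>_. k x)) (carrier M) (pvec ` range (\<lambda>c _. c))"
      unfolding bij_betw_def inj_on_def pvec_eq_iff fun_eq_iff by blast
  qed (use add sm z smult_closed C in \<open>auto intro!: poly_mapping_eqI simp: lookup_add\<close>)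
  then show ?thesis by blast
qed

text \<open>Zero spaces and lines are isomorphic to their duals; on a line a functional is
  determined by its value at a spanning vector \<open>b\<close>.\<close>

lemma lin_coord_dual:
  assumes M: "lin_coord M V h" and V: "V = {0} \<or> V = pvec ` range (\<lambda>c _. c)"
  shows "\<exists>g. lin_coord (dual_space M) V g"
proof -
  note M' = lin_coordD[OF M]
  note D = dual_space_def[of M]
  have lin: "f (x \<oplus>\<^bsub>M\<^esub> y) = f x + f y" "f (c \<odot>\<^bsub>M\<^esub> x) = c * f x"
    if "f \<in> carrier (dual_space M)" "x \<in> carrier M" "y \<in> carrier M" for f x y c
    using that by (auto simp: D)
  have eqI: "f = f'" if "f \<in> carrier (dual_space M)" "f' \<in> carrier (dual_space M)" "\<And>x. x \<in> carrier M \<Longrightarrow> f x = f' x" for f f'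
    using that by (auto simp: D intro: extensionalityI)
  have zero: "\<zero>\<^bsub>dual_space M\<^esub> \<in> carrier (dual_space M)"
    and add: "\<And>f f'. f \<in> carrier (dual_space M) \<Longrightarrow> f' \<in> carrier (dual_space M) \<Longrightarrow> f \<oplus>\<^bsub>dual_space M\<^esub> f' \<in> carrier (dual_space M)"
    and sm: "\<And>f c. f \<in> carrier (dual_space M) \<Longrightarrow> c \<odot>\<^bsub>dual_space M\<^esub> f \<in> carrier (dual_space M)"
    using M'(6,8) by (auto simp: D algebra_simps)
  have app: "\<zero>\<^bsub>dual_space M\<^esub> x = 0" "(f \<oplus>\<^bsub>dual_space M\<^esub> f') x = f x + f' x" "(c \<odot>\<^bsub>dual_space M\<^esub> f) x = c * f x"
    if "x \<in> carrier M" for f f' c x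
    using that by (simp_all add: D)
  from V show ?thesis
  proof
    assume "V = {0}"
    then have c: "carrier M = {\<zero>\<^bsub>M\<^esub>}" using lin_coord_zero_space M by blast
    have "f x = 0" if "f \<in> carrier (dual_space M)" "x \<in> carrier M" for f x
    proof -
      have "x = 0 \<odot>\<^bsub>M\<^esub> x" using c that(2) M'(8)[of x 0] by simp
      then show ?thesis using lin(2)[OF that that(2), of 0] by simp
    qed
    then have "f = \<zero>\<^bsub>dual_space M\<^esub>" if "f \<in> carrier (dual_space M)" for f
      by (intro eqI[OF that zero]) (simp only: that app(1))
    then have "carrier (dual_space M) = {\<zero>\<^bsub>dual_space M\<^esub>}"
      using zero by blast
    then have "lin_coord (dual_space M) V (\<lambda>_. 0)"
      using add sm \<open>V = {0}\<close> by (auto simp: lin_coord_def bij_betw_def)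
    then show ?thesis by blast
  next
    assume V: "V = pvec ` range (\<lambda>c _. c)"
    have "pvec (\<lambda>_. 1) \<in> h ` carrier M" unfolding M'(3) V by blast
    then obtain b where b: "b \<in> carrier M" "h b = pvec (\<lambda>_. 1)" by auto
    have ex: "\<exists>c. x = c \<odot>\<^bsub>M\<^esub> b" if "x \<in> carrier M" for x
    proof -
      have "h x \<in> pvec ` range (\<lambda>c _. c)" using imageI[OF that, of h] unfolding M'(3) V .
      then obtain c where "h x = pvec (\<lambda>_. c)" by auto
      then have "h x = h (c \<odot>\<^bsub>M\<^esub> b)"
        by (auto simp: M'(9)[OF b(1)] b(2) intro!: poly_mapping_eqI)
      then show ?thesis using lin_coord_eqI[OF M that M'(8)[OF b(1)]] by blast
    qed
    have inj: "f = f'" if "f \<in> carrier (dual_space M)" "f' \<in> carrier (dual_space M)" "f b = f' b" for f f'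
      using that(1,2)
    proof (rule eqI)
      fix x assume "x \<in> carrier M"
      then obtain c where "x = c \<odot>\<^bsub>M\<^esub> b" using ex by blast
      then show "f x = f' x" using lin(2)[OF that(1) b(1) b(1)] lin(2)[OF that(2) b(1) b(1)] that(3) by simp
    qed
    have surj: "\<exists>f\<in>carrier (dual_space M). f b = c" for c
    proof
      \<comment> \<open>\<open>h x\<close> is a constant vector, and its entry at 0 is the
        coefficient of \<open>x\<close> with respect to \<open>b\<close>.\<close>
      let ?f = "\<lambda>x\<in>carrier M. c * coef (h x) 0"
      show "?f \<in> carrier (dual_space M)"
        using M'(6-9) by (auto simp: D lookup_add distrib_left)
      show "?f b = c" using b by simp
    qed
    have "lin_coord (dual_space M) V (\<lambda>f. pvec (\<lambda>_. f b))"
      unfolding lin_coord_def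
    proof (intro conjI ballI allI)
      show "bij_betw (\<lambda>f. pvec (\<lambda>_. f b)) (carrier (dual_space M)) V"
        unfolding bij_betw_def V
      proof
        show "inj_on (\<lambda>f. pvec (\<lambda>_. f b)) (carrier (dual_space M))"
          by (rule inj_onI, rule inj) (auto simp: pvec_eq_iff fun_eq_iff)
        show "(\<lambda>f. pvec (\<lambda>_. f b)) ` carrier (dual_space M) = pvec ` range (\<lambda>c _. c)"
        proof -
          have "(\<lambda>f. f b) ` carrier (dual_space M) = UNIV"
          proof (rule UNIV_eq_I[symmetric])
            show "c \<in> (\<lambda>f. f b) ` carrier (dual_space M)" for c using surj[of c] by auto
          qed
          then show ?thesis
            by (simp only: image_image[of "\<lambda>c. pvec (\<lambda>_. c)" "\<lambda>f. f b", symmetric] image_image[of pvec])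
        qed
      qed
    qed (use zero add sm app[OF b(1)] in \<open>auto intro!: poly_mapping_eqI simp: lookup_add\<close>)
    then show ?thesis by blast
  qed
qed

lemma coords_of_X3:
  assumes "graded_space X3" "has_hilbert_series X3 (fls_X ^ 3)"
  shows "\<exists>h. lin_coord (X3 d) (pvec ` (if d = 3 then range (\<lambda>c _. c) else {\<lambda>_. 0})) h"
proof -
  have m: "Module.module complex_field (X3 d)" using assms(1) by (simp add: graded_space_def)
  obtain n where n: "has_dim (X3 d) n" "fls_nth (fls_X ^ 3 :: int fls) d = int n"
    using assms(2) by (auto simp: has_hilbert_series_def)
  show ?thesis
  proof (cases "d = 3")
    case True
    then have "n = 1" using n(2) by (simp add: fls_X_power_nth)
    then show ?thesis using lin_coord_dim_1[OF m] n(1) True by simp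
  next
    case False
    then have "n = 0" using n(2) by (simp add: fls_X_power_nth)
    then show ?thesis using lin_coord_dim_0[OF m] n(1) False by (auto simp: pvec_zero)
  qed
qed

text \<open>In degree \<open>d\<close> the shifted dual is the dual of the component of degree
  \<open>12 - d\<close>, which is a line exactly for \<open>d = 9\<close>.\<close>

lemma coords_of_dual_X3:
  assumes "graded_space X3" "has_hilbert_series X3 (fls_X ^ 3)"
  shows "\<exists>h. lin_coord ((graded_dual X3)\<lbrakk>12\<rbrakk> d) (pvec ` (if d = 9 then range (\<lambda>c _. c) else {\<lambda>_. 0})) h"
proof -
  obtain h where h: "lin_coord (X3 (12 - d)) (pvec ` (if d = 9 then range (\<lambda>c _. c) else {\<lambda>_. 0})) h"
    using coords_of_X3[OF assms, of "12 - d"] by auto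
  have "\<exists>g. lin_coord (dual_space (X3 (12 - d))) (pvec ` (if d = 9 then range (\<lambda>c _. c) else {\<lambda>_. 0})) g"
    by (rule lin_coord_dual[OF h]) (auto simp: pvec_zero)
  then show ?thesis by (simp add: degree_shift_def graded_dual_def)
qed

context cyclic_algebra
begin

lemma coords_of_degree_zero_part:
  "\<exists>h. lin_coord (degree_zero_part A d) (pvec ` hval 0 d) h"
proof (cases "d = 0")
  case True
  let ?S = "degree_zero_part A 0"
  have S: "carrier ?S = {x \<in> carrier A. \<forall>l. arrow l \<longrightarrow> co x l = 0}" "\<zero>\<^bsub>?S\<^esub> = \<zero>"
    "x \<oplus>\<^bsub>?S\<^esub> y = x \<oplus> y" "c \<odot>\<^bsub>?S\<^esub> x = c \<odot> x" for x y c
    by (auto simp: degree_zero_part_def module.truncate_def homog_iff)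
  have "lin_coord ?S (pvec ` UNIV) (\<lambda>x. pvec (\<lambda>i. co x (idem i)))"
    unfolding lin_coord_def
  proof (intro conjI ballI allI)
    show "bij_betw (\<lambda>x. pvec (\<lambda>i. co x (idem i))) (carrier ?S) (pvec ` UNIV)"
      unfolding bij_betw_def
    proof
      show "inj_on (\<lambda>x. pvec (\<lambda>i. co x (idem i))) (carrier ?S)"
      proof (rule inj_onI)
        fix x y assume xy: "x \<in> carrier ?S" "y \<in> carrier ?S" "pvec (\<lambda>i. co x (idem i)) = pvec (\<lambda>i. co y (idem i))"
        show "x = y"
        proof (rule co_eqI)
          show "co x l = co y l" for l
          proof (cases l)
            case (Pair i b)
            then show ?thesis using xy by (cases b) (auto simp: S pvec_eq_iff fun_eq_iff)
          qed
        qed (use xy in \<open>auto simp: S\<close>)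
      qed
      have "pvec f \<in> (\<lambda>x. pvec (\<lambda>i. co x (idem i))) ` carrier ?S" for f
      proof -
        let ?F = "\<lambda>l. if arrow l then 0 else f (src l)"
        have "?F \<in> co ` carrier A" using co_bij by (simp add: bij_betw_def)
        then obtain x where x: "x \<in> carrier A" "?F = co x" by (rule imageE) simp
        have "co x l = ?F l" for l using fun_cong[OF x(2), of l] by simp
        then show ?thesis using x(1) by (intro image_eqI[of _ _ x]) (simp_all add: S)
      qed
      then show "(\<lambda>x. pvec (\<lambda>i. co x (idem i))) ` carrier ?S = pvec ` UNIV" by auto
    qed
  qed (auto intro!: poly_mapping_eqI simp: S lookup_add co_zero co_add co_smult closed)
  then show ?thesis using True by (auto simp: hval_def)
next
  case False
  then have "carrier (degree_zero_part A d) = {\<zero>}" "\<zero>\<^bsub>degree_zero_part A d\<^esub> = \<zero>"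
    "x \<oplus>\<^bsub>degree_zero_part A d\<^esub> y = x \<oplus> y" "c \<odot>\<^bsub>degree_zero_part A d\<^esub> x = c \<odot> x" for x y c
    by (simp_all add: degree_zero_part_def module.truncate_def)
  moreover have "\<zero> \<oplus> \<zero> = \<zero>" "c \<odot> \<zero> = \<zero>" for c
    by (rule co_eqI; simp add: closed co_add co_smult co_zero)+
  ultimately have "lin_coord (degree_zero_part A d) {0} (\<lambda>_. 0)"
    by (simp add: lin_coord_def bij_betw_def)
  then show ?thesis using False by (auto simp: hval_def pvec_zero)
qed

section \<open>Criteria for isomorphism and vanishing, and periodicity\<close>

lemma HH_iso: "(\<And>d. \<exists>h. lin_coord (V d) (pvec ` hval n d) h) \<Longrightarrow> HH A n \<cong>\<^sub>g V"
  unfolding graded_iso_def using lin_coord_HH linear_iso_coord by blast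

lemma HH_zero:
  assumes "\<And>d. hval n d = {\<lambda>_. 0}" shows "is_zero_space (HH A n)"
  unfolding is_zero_space_def
proof
  fix j
  have "lin_coord (HH A n j) {0} (HHfun n j)"
    using lin_coord_HH[of n j] assms by (simp add: pvec_zero)
  then show "carrier (HH A n j) = {\<zero>\<^bsub>HH A n j\<^esub>}" by (rule lin_coord_zero_space)
qed

lemma HC_iso: "0 < n \<Longrightarrow> (\<And>d. \<exists>h. lin_coord (V d) (pvec ` hcval (Suc n) d) h) \<Longrightarrow> HC A n \<cong>\<^sub>g V"
  unfolding graded_iso_def using lin_coord_HC linear_iso_coord by blast

lemma HC_zero:
  assumes "0 < n" and "\<And>d. hcval (Suc n) d = {\<lambda>_. 0}" shows "is_zero_space (HC A n)"
  unfolding is_zero_space_def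
proof
  fix j
  have "lin_coord (HC A n j) {0} (HHfun (Suc n) j)"
    using lin_coord_HC[of n j] assms by (simp add: pvec_zero)
  then show "carrier (HC A n j) = {\<zero>\<^bsub>HC A n j\<^esub>}" by (rule lin_coord_zero_space)
qed

text \<open>Apart from the exceptional value at \<open>n = 0\<close>, which \<open>i\<close> avoids,
  \<open>hval n d\<close> depends only on \<open>n mod 6\<close> and \<open>d - n\<close>.\<close>

lemma HH_periodic: "1 \<le> i \<Longrightarrow> HH A (12 + i) \<cong>\<^sub>g (HH A i)\<lbrakk>12\<rbrakk>"
proof (rule HH_iso)
  fix d assume "1 \<le> i"
  moreover have "(12 + i) mod 6 = i mod 6" by presburger
  ultimately have "hval (12 + i) d = hval i (d - 12)" by (auto simp: hval_def)
  then show "\<exists>h. lin_coord ((HH A i)\<lbrakk>12\<rbrakk> d) (pvec ` hval (12 + i) d) h"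
    using lin_coord_HH[of i "d - 12"] by (auto simp: degree_shift_def)
qed

lemma HC_periodic: "1 \<le> i \<Longrightarrow> HC A (12 + i) \<cong>\<^sub>g (HC A i)\<lbrakk>12\<rbrakk>"
proof (rule HC_iso)
  fix d assume "1 \<le> i"
  have "Suc (12 + i) mod 6 = Suc i mod 6" by presburger
  then have "hcval (Suc (12 + i)) d = hcval (Suc i) (d - 12)" by (auto simp: hcval_def)
  then show "\<exists>h. lin_coord ((HC A i)\<lbrakk>12\<rbrakk> d) (pvec ` hcval (Suc (12 + i)) d) h"
    using lin_coord_HC[of i "d - 12"] \<open>1 \<le> i\<close> by (auto simp: degree_shift_def)
qed simp

end

theorem theorem3p8:
  fixes W :: "(int \<times> int) \<times> (int \<times> int) \<Rightarrow> (int \<times> int) \<times> (int \<times> int) \<Rightarrow>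
      (int \<times> int) \<times> (int \<times> int) \<Rightarrow> complex"
    and \<phi> :: "int \<times> int \<Rightarrow> real"
    and X3 :: "'x graded"
  assumes "perron_frobenius (A_graph 4) 4 \<phi>"
    and "cell_system (A_graph 4) 4 \<phi> W"
    and "A = acy_algebra (A_graph 4) W"
    and "S = degree_zero_part A"
    and "graded_space X3" and "has_hilbert_series X3 (fls_X ^ 3)"
  shows "HH A 0 \<cong>\<^sub>g S \<and> is_zero_space (HH A 1) \<and> HH A 2 \<cong>\<^sub>g X3 \<and> HH A 3 \<cong>\<^sub>g X3
      \<and> (\<forall>n\<in>{4, 5, 6, 7}. is_zero_space (HH A n))
      \<and> HH A 8 \<cong>\<^sub>g (graded_dual X3)\<lbrakk>12\<rbrakk> \<and> HH A 9 \<cong>\<^sub>g (graded_dual X3)\<lbrakk>12\<rbrakk>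
      \<and> (\<forall>n\<in>{10, 11, 12}. is_zero_space (HH A n))
      \<and> (\<forall>i\<ge>1. HH A (12 + i) \<cong>\<^sub>g (HH A i)\<lbrakk>12\<rbrakk>)
    \<and> HC A 0 \<cong>\<^sub>g S \<and> is_zero_space (HC A 1) \<and> HC A 2 \<cong>\<^sub>g X3
      \<and> (\<forall>n\<in>{3, 4, 5, 6, 7}. is_zero_space (HC A n))
      \<and> HC A 8 \<cong>\<^sub>g (graded_dual X3)\<lbrakk>12\<rbrakk>
      \<and> (\<forall>n\<in>{9, 10, 11, 12}. is_zero_space (HC A n))
      \<and> (\<forall>i\<ge>1. HC A (12 + i) \<cong>\<^sub>g (HC A i)\<lbrakk>12\<rbrakk>)"
proof -
  interpret cyclic_algebra A acy_coord
    unfolding assms(3) by (rule cyclic_algebra_acy) (rule weight_nonzero[OF assms(1,2)])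
  note X = coords_of_X3[OF assms(5,6)] and X' = coords_of_dual_X3[OF assms(5,6)]
  have S: "HH A 0 \<cong>\<^sub>g S" unfolding assms(4) by (rule HH_iso) (rule coords_of_degree_zero_part)
  have X23: "HH A n \<cong>\<^sub>g X3" if "n \<in> {2, 3}" for n
  proof (rule HH_iso)
    fix d
    have "hval n d = (if d = 3 then range (\<lambda>c _. c) else {\<lambda>_. 0})" using that by (auto simp: hval_def)
    then show "\<exists>h. lin_coord (X3 d) (pvec ` hval n d) h" using X[of d] by simp
  qed
  have X89: "HH A n \<cong>\<^sub>g (graded_dual X3)\<lbrakk>12\<rbrakk>" if "n \<in> {8, 9}" for n
  proof (rule HH_iso)
    fix d
    have "hval n d = (if d = 9 then range (\<lambda>c _. c) else {\<lambda>_. 0})" using that by (auto simp: hval_def)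
    then show "\<exists>h. lin_coord ((graded_dual X3)\<lbrakk>12\<rbrakk> d) (pvec ` hval n d) h" using X'[of d] by simp
  qed
  have X2: "HC A 2 \<cong>\<^sub>g X3"
  proof (rule HC_iso)
    fix d
    have "hcval (Suc 2) d = (if d = 3 then range (\<lambda>c _. c) else {\<lambda>_. 0})" by (auto simp: hcval_def)
    then show "\<exists>h. lin_coord (X3 d) (pvec ` hcval (Suc 2) d) h" using X[of d] by simp
  qed simp
  have X8: "HC A 8 \<cong>\<^sub>g (graded_dual X3)\<lbrakk>12\<rbrakk>"
  proof (rule HC_iso)
    fix d
    have "hcval (Suc 8) d = (if d = 9 then range (\<lambda>c _. c) else {\<lambda>_. 0})" by (auto simp: hcval_def)
    then show "\<exists>h. lin_coord ((graded_dual X3)\<lbrakk>12\<rbrakk> d) (pvec ` hcval (Suc 8) d) h" using X'[of d] by simp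
  qed simp
  have Z: "is_zero_space (HH A n)" if "n \<in> {1, 4, 5, 6, 7, 10, 11, 12}" for n
    by (rule HH_zero) (use that in \<open>auto simp: hval_def\<close>)
  have Z': "is_zero_space (HC A n)" if "n \<in> {1, 3, 4, 5, 6, 7, 9, 10, 11, 12}" for n
    by (rule HC_zero) (use that in \<open>auto simp: hcval_def\<close>)
  have S': "HC A 0 \<cong>\<^sub>g S" using S by (simp add: HC_def)
  show ?thesis
    by (intro conjI ballI allI impI S S' X23 X89 X2 X8 Z Z' HH_periodic HC_periodic) auto
qed

end
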